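(* Let $R$ be a commutative Noetherian ring with $1$, $I$ a proper ideal of $R$, $M$ a finitely generated $R$-module and $N$ a weakly Laskerian $R$-module. If $\mathrm{Tor}^R_i(R/I,M)=0$ for all $i>0$ and $\mathrm{depth}_I N>0$, then $\mathrm{Ext}^1_R(R/I,H^1_I(M,N))$ is weakly Laskerian. In particular, the set $\mathrm{Ass}_R\,\mathrm{Ext}^1_R(R/I,H^1_I(M,N))$ is finite.
   Context: An $R$-module $W$ is weakly Laskerian if $\mathrm{Ass}_R(W/U)$ is finite for every $R$-submodule $U$ of $W$. The generalized local cohomology modules are $H^i_I(M,N)=\varinjlim_n \mathrm{Ext}^i_R(M/I^nM,N)$, where the direct system is induced by the natural surjections $M/I^{n+1}M\to M/I^nM$; $H^i_I(N)=H^i_I(R,N)$ is ordinary local cohomology. For an arbitrary $R$-module $N$, $\mathrm{depth}_I N=\inf\{i\ge 0\mid H^i_I(N)\neq 0\}$. *)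

theory Defs
  imports "HOL-Algebra.Module" "HOL-Algebra.Ring_Divisibility" "HOL-Algebra.Ideal_Product"
    "HOL-Library.FSet" "HOL-Library.Extended_Nat"
begin

text \<open>
  Modules are those of \<^theory>\<open>HOL-Algebra.Module\<close>. Module records inherit the fields
  \<^const>\<open>monoid.mult\<close> and \<^const>\<open>monoid.one\<close> from ring records; the locale \<^locale>\<open>module\<close> never uses them,
  and they are left undefined in the constructions below.
\<close>

definition regular_module :: "('a, 'r) ring_scheme \<Rightarrow> ('a, 'a) module" where
  "regular_module R =
     \<lparr>carrier = carrier R, monoid.mult = (\<otimes>\<^bsub>R\<^esub>), monoid.one = \<one>\<^bsub>R\<^esub>,
      ring.zero = \<zero>\<^bsub>R\<^esub>, ring.add = (\<oplus>\<^bsub>R\<^esub>), smult = (\<otimes>\<^bsub>R\<^esub>)\<rparr>"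

definition trivial_module :: "('a, 'x) module \<Rightarrow> bool" where
  "trivial_module A \<longleftrightarrow> carrier A = {\<zero>\<^bsub>A\<^esub>}"

definition quot_module :: "('a, 'x) module \<Rightarrow> 'x set \<Rightarrow> ('a, 'x set) module" where
  "quot_module A U =
     \<lparr>carrier = a_rcosets\<^bsub>A\<^esub> U, monoid.mult = undefined, monoid.one = undefined, ring.zero = U,
      ring.add = set_add A, smult = (\<lambda>a C. \<Union>x\<in>C. U +>\<^bsub>A\<^esub> (a \<odot>\<^bsub>A\<^esub> x))\<rparr>"

text \<open>For a linear map \<open>h\<close> into \<open>A\<close> that maps the submodule \<open>V\<close> of its domain into \<open>U\<close>:
  the induced map sending the coset \<open>V + x\<close> to \<open>U + h x\<close>.\<close>

definition quot_map :: "('a, 'y) module \<Rightarrow> 'y set \<Rightarrow> ('x \<Rightarrow> 'y) \<Rightarrow> 'x set \<Rightarrow> 'y set" where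
  "quot_map A U h C = (\<Union>x\<in>C. U +>\<^bsub>A\<^esub> h x)"

definition submodule_span :: "('a, 'r) ring_scheme \<Rightarrow> ('a, 'x) module \<Rightarrow> 'x set \<Rightarrow> 'x set" where
  "submodule_span R A S = \<Inter>{U. submodule U R A \<and> S \<subseteq> U}"

definition fin_gen_module :: "('a, 'r) ring_scheme \<Rightarrow> ('a, 'x) module \<Rightarrow> bool" where
  "fin_gen_module R A \<longleftrightarrow>
     module R A \<and> (\<exists>S. finite S \<and> S \<subseteq> carrier A \<and> submodule_span R A S = carrier A)"

definition ideal_smult :: "('a, 'r) ring_scheme \<Rightarrow> 'a set \<Rightarrow> ('a, 'x) module \<Rightarrow> 'x set" where
  "ideal_smult R J A = submodule_span R A {a \<odot>\<^bsub>A\<^esub> x | a x. a \<in> J \<and> x \<in> carrier A}"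

definition Ass :: "('a, 'r) ring_scheme \<Rightarrow> ('a, 'x) module \<Rightarrow> 'a set set" where
  "Ass R A =
     {P. primeideal P R \<and>
         (\<exists>x\<in>carrier A. P = {a \<in> carrier R. a \<odot>\<^bsub>A\<^esub> x = \<zero>\<^bsub>A\<^esub>})}"

definition weakly_laskerian :: "('a, 'r) ring_scheme \<Rightarrow> ('a, 'x) module \<Rightarrow> bool" where
  "weakly_laskerian R A \<longleftrightarrow>
     module R A \<and> (\<forall>U. submodule U R A \<longrightarrow> finite (Ass R (quot_module A U)))"

definition hom_module ::
    "('a, 'r) ring_scheme \<Rightarrow> ('a, 'x) module \<Rightarrow> ('a, 'y) module \<Rightarrow> ('a, 'x \<Rightarrow> 'y) module" where
  "hom_module R A B =
     \<lparr>carrier = {f \<in> carrier A \<rightarrow>\<^sub>E carrier B.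
         (\<forall>x\<in>carrier A. \<forall>y\<in>carrier A. f (x \<oplus>\<^bsub>A\<^esub> y) = f x \<oplus>\<^bsub>B\<^esub> f y) \<and>
         (\<forall>a\<in>carrier R. \<forall>x\<in>carrier A. f (a \<odot>\<^bsub>A\<^esub> x) = a \<odot>\<^bsub>B\<^esub> f x)},
      monoid.mult = undefined, monoid.one = undefined,
      ring.zero = (\<lambda>x\<in>carrier A. \<zero>\<^bsub>B\<^esub>),
      ring.add = (\<lambda>f g. \<lambda>x\<in>carrier A. f x \<oplus>\<^bsub>B\<^esub> g x),
      smult = (\<lambda>a f. \<lambda>x\<in>carrier A. a \<odot>\<^bsub>B\<^esub> f x)\<rparr>"

definition free_module :: "('a, 'r) ring_scheme \<Rightarrow> 'b set \<Rightarrow> ('a, 'b \<Rightarrow> 'a) module" where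
  "free_module R B =
     \<lparr>carrier = {f. (\<forall>b. f b \<in> carrier R) \<and> (\<forall>b. b \<notin> B \<longrightarrow> f b = \<zero>\<^bsub>R\<^esub>) \<and>
                    finite {b. f b \<noteq> \<zero>\<^bsub>R\<^esub>}},
      monoid.mult = undefined, monoid.one = undefined,
      ring.zero = (\<lambda>b. \<zero>\<^bsub>R\<^esub>),
      ring.add = (\<lambda>f g b. f b \<oplus>\<^bsub>R\<^esub> g b),
      smult = (\<lambda>a f b. a \<otimes>\<^bsub>R\<^esub> f b)\<rparr>"

definition basis_vec :: "('a, 'r) ring_scheme \<Rightarrow> 'b \<Rightarrow> 'b \<Rightarrow> 'a" where
  "basis_vec R b = (\<lambda>c. if c = b then \<one>\<^bsub>R\<^esub> else \<zero>\<^bsub>R\<^esub>)"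

text \<open>For \<open>\<iota>\<close> injective on \<open>S\<close>: the linear map from the free module on \<open>\<iota> ` S\<close> to \<open>A\<close>
  that sends the basis vector of \<open>\<iota> s\<close> to \<open>\<phi> s\<close>.\<close>

definition lin_ext ::
    "('a, 'r) ring_scheme \<Rightarrow> ('a, 'x) module \<Rightarrow> 's set \<Rightarrow> ('s \<Rightarrow> 'b) \<Rightarrow> ('s \<Rightarrow> 'x) \<Rightarrow>
     ('b \<Rightarrow> 'a) \<Rightarrow> 'x" where
  "lin_ext R A S \<iota> \<phi> f = (\<Oplus>\<^bsub>A\<^esub>s\<in>{s \<in> S. f (\<iota> s) \<noteq> \<zero>\<^bsub>R\<^esub>}. f (\<iota> s) \<odot>\<^bsub>A\<^esub> \<phi> s)"

definition tensor_relations ::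
    "('a, 'r) ring_scheme \<Rightarrow> ('a, 'x) module \<Rightarrow> ('a, 'y) module \<Rightarrow> ('x \<times> 'y \<Rightarrow> 'a) set" where
  "tensor_relations R A B =
     (let F = free_module R (carrier A \<times> carrier B); e = basis_vec R in
      submodule_span R F
       ({e (x \<oplus>\<^bsub>A\<^esub> x', y) \<ominus>\<^bsub>F\<^esub> (e (x, y) \<oplus>\<^bsub>F\<^esub> e (x', y)) | x x' y.
            x \<in> carrier A \<and> x' \<in> carrier A \<and> y \<in> carrier B} \<union>
        {e (x, y \<oplus>\<^bsub>B\<^esub> y') \<ominus>\<^bsub>F\<^esub> (e (x, y) \<oplus>\<^bsub>F\<^esub> e (x, y')) | x y y'.
            x \<in> carrier A \<and> y \<in> carrier B \<and> y' \<in> carrier B} \<union>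
        {e (a \<odot>\<^bsub>A\<^esub> x, y) \<ominus>\<^bsub>F\<^esub> a \<odot>\<^bsub>F\<^esub> e (x, y) | a x y.
            a \<in> carrier R \<and> x \<in> carrier A \<and> y \<in> carrier B} \<union>
        {e (x, a \<odot>\<^bsub>B\<^esub> y) \<ominus>\<^bsub>F\<^esub> a \<odot>\<^bsub>F\<^esub> e (x, y) | a x y.
            a \<in> carrier R \<and> x \<in> carrier A \<and> y \<in> carrier B}))"

definition tensor ::
    "('a, 'r) ring_scheme \<Rightarrow> ('a, 'x) module \<Rightarrow> ('a, 'y) module \<Rightarrow>
     ('a, ('x \<times> 'y \<Rightarrow> 'a) set) module" where
  "tensor R A B =
     quot_module (free_module R (carrier A \<times> carrier B)) (tensor_relations R A B)"

text \<open>The map \<open>f \<otimes> id\<close> from \<open>A \<otimes> B\<close> to \<open>A' \<otimes> B\<close>.\<close>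

definition tensor_map ::
    "('a, 'r) ring_scheme \<Rightarrow> ('a, 'x) module \<Rightarrow> ('a, 'z) module \<Rightarrow> ('a, 'y) module \<Rightarrow>
     ('x \<Rightarrow> 'z) \<Rightarrow> ('x \<times> 'y \<Rightarrow> 'a) set \<Rightarrow> ('z \<times> 'y \<Rightarrow> 'a) set" where
  "tensor_map R A A' B f =
     (let F' = free_module R (carrier A' \<times> carrier B) in
      quot_map F' (tensor_relations R A' B)
        (lin_ext R F' (carrier A \<times> carrier B) (\<lambda>p. p) (\<lambda>(x, y). basis_vec R (f x, y))))"

text \<open>
  Functorial free resolution of a module \<open>X\<close>: \<open>\<dots> \<rightarrow> F\<^sub>1 \<rightarrow> F\<^sub>0 \<rightarrow> X\<close>, where \<open>F\<^sub>0\<close> is free on the set \<open>X\<close> and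
  \<open>F\<^sub>i\<^sub>+\<^sub>1\<close> is free on the set of \<open>i\<close>-cycles, each basis element being mapped to the element
  it stands for. To have all \<open>F\<^sub>i\<close> in a single type, their basis elements are taken from the
  following type: \<open>Gen x\<close> stands for an element of \<open>X\<close>, and \<open>Cyc\<close>, applied to the
  graph of a finitely supported function on its support, stands for that function.
\<close>

datatype ('a, 'x) cell = Gen 'x | Cyc "(('a, 'x) cell \<times> 'a) fset"

definition cyc :: "('a, 'r) ring_scheme \<Rightarrow> (('a, 'x) cell \<Rightarrow> 'a) \<Rightarrow> ('a, 'x) cell" where
  "cyc R f = Cyc (Abs_fset {(c, f c) | c. f c \<noteq> \<zero>\<^bsub>R\<^esub>})"

primrec std_cycles ::
    "('a, 'r) ring_scheme \<Rightarrow> ('a, 'x) module \<Rightarrow> nat \<Rightarrow> (('a, 'x) cell \<Rightarrow> 'a) set" where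
  "std_cycles R X 0 =
     {f \<in> carrier (free_module R (Gen ` carrier X)).
        lin_ext R X (carrier X) Gen (\<lambda>x. x) f = \<zero>\<^bsub>X\<^esub>}"
| "std_cycles R X (Suc i) =
     {f \<in> carrier (free_module R (cyc R ` std_cycles R X i)).
        lin_ext R (free_module R UNIV) (std_cycles R X i) (cyc R) (\<lambda>z. z) f = (\<lambda>c. \<zero>\<^bsub>R\<^esub>)}"

definition std_res ::
    "('a, 'r) ring_scheme \<Rightarrow> ('a, 'x) module \<Rightarrow> nat \<Rightarrow> ('a, ('a, 'x) cell \<Rightarrow> 'a) module" where
  "std_res R X i =
     free_module R (case i of 0 \<Rightarrow> Gen ` carrier X | Suc j \<Rightarrow> cyc R ` std_cycles R X j)"

text \<open>The boundary map from degree \<open>i + 1\<close> to degree \<open>i\<close>.\<close>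

definition std_bd ::
    "('a, 'r) ring_scheme \<Rightarrow> ('a, 'x) module \<Rightarrow> nat \<Rightarrow>
     (('a, 'x) cell \<Rightarrow> 'a) \<Rightarrow> ('a, 'x) cell \<Rightarrow> 'a" where
  "std_bd R X i = lin_ext R (free_module R UNIV) (std_cycles R X i) (cyc R) (\<lambda>z. z)"

text \<open>The chain map between the standard resolutions of \<open>X\<close> and \<open>Y\<close> lifting a linear map
  \<open>h\<close> from \<open>X\<close> to \<open>Y\<close>.\<close>

primrec std_map ::
    "('a, 'r) ring_scheme \<Rightarrow> ('a, 'x) module \<Rightarrow> ('x \<Rightarrow> 'y) \<Rightarrow> nat \<Rightarrow>
     (('a, 'x) cell \<Rightarrow> 'a) \<Rightarrow> ('a, 'y) cell \<Rightarrow> 'a" where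
  "std_map R X h 0 =
     lin_ext R (free_module R UNIV) (carrier X) Gen (\<lambda>x. basis_vec R (Gen (h x)))"
| "std_map R X h (Suc i) =
     lin_ext R (free_module R UNIV) (std_cycles R X i) (cyc R)
       (\<lambda>z. basis_vec R (cyc R (std_map R X h i z)))"

text \<open>Here \<open>d i\<close> maps \<open>C i\<close> to \<open>C (i + 1)\<close>.\<close>

definition coboundaries :: "(nat \<Rightarrow> ('a, 'x) module) \<Rightarrow> (nat \<Rightarrow> 'x \<Rightarrow> 'x) \<Rightarrow> nat \<Rightarrow> 'x set" where
  "coboundaries C d i = (case i of 0 \<Rightarrow> {\<zero>\<^bsub>C 0\<^esub>} | Suc j \<Rightarrow> d j ` carrier (C j))"

definition cohomology ::
    "(nat \<Rightarrow> ('a, 'x) module) \<Rightarrow> (nat \<Rightarrow> 'x \<Rightarrow> 'x) \<Rightarrow> nat \<Rightarrow> ('a, 'x set) module" where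
  "cohomology C d i =
     quot_module ((C i)\<lparr>carrier := {x \<in> carrier (C i). d i x = \<zero>\<^bsub>C (Suc i)\<^esub>}\<rparr>)
       (coboundaries C d i)"

text \<open>Here \<open>d i\<close> maps \<open>C (i + 1)\<close> to \<open>C i\<close>.\<close>

definition homology ::
    "(nat \<Rightarrow> ('a, 'x) module) \<Rightarrow> (nat \<Rightarrow> 'x \<Rightarrow> 'x) \<Rightarrow> nat \<Rightarrow> ('a, 'x set) module" where
  "homology C d i =
     quot_module
       ((C i)\<lparr>carrier := (case i of 0 \<Rightarrow> carrier (C 0)
                                  | Suc j \<Rightarrow> {x \<in> carrier (C (Suc j)). d j x = \<zero>\<^bsub>C j\<^esub>})\<rparr>)
       (d i ` carrier (C (Suc i)))"

definition Tor ::
    "('a, 'r) ring_scheme \<Rightarrow> nat \<Rightarrow> ('a, 'x) module \<Rightarrow> ('a, 'y) module \<Rightarrow>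
     ('a, ((('a, 'x) cell \<Rightarrow> 'a) \<times> 'y \<Rightarrow> 'a) set set) module" where
  "Tor R i X Y =
     homology (\<lambda>j. tensor R (std_res R X j) Y)
       (\<lambda>j. tensor_map R (std_res R X (Suc j)) (std_res R X j) Y (std_bd R X j)) i"

definition Ext_complex ::
    "('a, 'r) ring_scheme \<Rightarrow> ('a, 'x) module \<Rightarrow> ('a, 'y) module \<Rightarrow> nat \<Rightarrow>
     ('a, (('a, 'x) cell \<Rightarrow> 'a) \<Rightarrow> 'y) module" where
  "Ext_complex R X N i = hom_module R (std_res R X i) N"

definition Ext_diff ::
    "('a, 'r) ring_scheme \<Rightarrow> ('a, 'x) module \<Rightarrow> nat \<Rightarrow>
     ((('a, 'x) cell \<Rightarrow> 'a) \<Rightarrow> 'y) \<Rightarrow> (('a, 'x) cell \<Rightarrow> 'a) \<Rightarrow> 'y" where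
  "Ext_diff R X i \<phi> = compose (carrier (std_res R X (Suc i))) \<phi> (std_bd R X i)"

definition Ext ::
    "('a, 'r) ring_scheme \<Rightarrow> nat \<Rightarrow> ('a, 'x) module \<Rightarrow> ('a, 'y) module \<Rightarrow>
     ('a, ((('a, 'x) cell \<Rightarrow> 'a) \<Rightarrow> 'y) set) module" where
  "Ext R i X N = cohomology (Ext_complex R X N) (Ext_diff R X) i"

text \<open>The map from \<open>Ext R i Y N\<close> to \<open>Ext R i X N\<close> induced by a linear map \<open>h\<close> from \<open>X\<close> to
  \<open>Y\<close>.\<close>

definition Ext_map ::
    "('a, 'r) ring_scheme \<Rightarrow> nat \<Rightarrow> ('a, 'x) module \<Rightarrow> ('x \<Rightarrow> 'z) \<Rightarrow> ('a, 'y) module \<Rightarrow>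
     ((('a, 'z) cell \<Rightarrow> 'a) \<Rightarrow> 'y) set \<Rightarrow> ((('a, 'x) cell \<Rightarrow> 'a) \<Rightarrow> 'y) set" where
  "Ext_map R i X h N =
     quot_map (Ext_complex R X N i) (coboundaries (Ext_complex R X N) (Ext_diff R X) i)
       (\<lambda>\<phi>. compose (carrier (std_res R X i)) \<phi> (std_map R X h i))"

text \<open>A direct system is a sequence of modules \<open>A n\<close> with maps \<open>t n\<close> from \<open>A n\<close> to
  \<open>A (n + 1)\<close>; \<open>transition t n k\<close> is the composite from \<open>A n\<close> to \<open>A (n + k)\<close>. The elements
  of the limit are the classes of pairs \<open>(n, x)\<close> with \<open>x\<close> in \<open>A n\<close>, two pairs being
  equivalent if they become equal at some later stage.\<close>

primrec transition :: "(nat \<Rightarrow> 'x \<Rightarrow> 'x) \<Rightarrow> nat \<Rightarrow> nat \<Rightarrow> 'x \<Rightarrow> 'x" where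
  "transition t n 0 x = x"
| "transition t n (Suc k) x = t (n + k) (transition t n k x)"

definition dirlim_rel ::
    "(nat \<Rightarrow> ('a, 'x) module) \<Rightarrow> (nat \<Rightarrow> 'x \<Rightarrow> 'x) \<Rightarrow> ((nat \<times> 'x) \<times> (nat \<times> 'x)) set" where
  "dirlim_rel A t =
     {((m, x), (n, y)) | m x n y. x \<in> carrier (A m) \<and> y \<in> carrier (A n) \<and>
        (\<exists>k l. m + k = n + l \<and> transition t m k x = transition t n l y)}"

definition direct_limit ::
    "(nat \<Rightarrow> ('a, 'x) module) \<Rightarrow> (nat \<Rightarrow> 'x \<Rightarrow> 'x) \<Rightarrow> ('a, (nat \<times> 'x) set) module" where
  "direct_limit A t =
     \<lparr>carrier = (SIGMA n:UNIV. carrier (A n)) // dirlim_rel A t,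
      monoid.mult = undefined, monoid.one = undefined,
      ring.zero = dirlim_rel A t `` {(0, \<zero>\<^bsub>A 0\<^esub>)},
      ring.add = (\<lambda>C D. \<Union>(m, x)\<in>C. \<Union>(n, y)\<in>D.
               dirlim_rel A t `` {(m + n, transition t m n x \<oplus>\<^bsub>A (m + n)\<^esub> transition t n m y)}),
      smult = (\<lambda>a C. \<Union>(m, x)\<in>C. dirlim_rel A t `` {(m, a \<odot>\<^bsub>A m\<^esub> x)})\<rparr>"

text \<open>The quotient \<open>M / I\<^sup>n M\<close>; the monoid \<^term>\<open>ideals_set R\<close> has ideal product as its
  multiplication and unit \<^term>\<open>carrier R\<close>, so \<open>I\<^sup>0 = R\<close>.\<close>

definition power_quot ::
    "('a, 'r) ring_scheme \<Rightarrow> 'a set \<Rightarrow> ('a, 'm) module \<Rightarrow> nat \<Rightarrow> ('a, 'm set) module" where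
  "power_quot R I M n = quot_module M (ideal_smult R (I [^]\<^bsub>ideals_set R\<^esub> n) M)"

text \<open>The natural surjection from \<open>M / I\<^sup>n\<^sup>+\<^sup>1 M\<close> to \<open>M / I\<^sup>n M\<close>.\<close>

definition power_quot_proj ::
    "('a, 'r) ring_scheme \<Rightarrow> 'a set \<Rightarrow> ('a, 'm) module \<Rightarrow> nat \<Rightarrow> 'm set \<Rightarrow> 'm set" where
  "power_quot_proj R I M n = quot_map M (ideal_smult R (I [^]\<^bsub>ideals_set R\<^esub> n) M) (\<lambda>x. x)"

definition gen_local_cohomology ::
    "('a, 'r) ring_scheme \<Rightarrow> 'a set \<Rightarrow> nat \<Rightarrow> ('a, 'm) module \<Rightarrow> ('a, 'n) module \<Rightarrow>
     ('a, (nat \<times> ((('a, 'm set) cell \<Rightarrow> 'a) \<Rightarrow> 'n) set) set) module" where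
  "gen_local_cohomology R I i M N =
     direct_limit (\<lambda>n. Ext R i (power_quot R I M n) N)
       (\<lambda>n. Ext_map R i (power_quot R I M (Suc n)) (power_quot_proj R I M n) N)"

definition local_cohomology ::
    "('a, 'r) ring_scheme \<Rightarrow> 'a set \<Rightarrow> nat \<Rightarrow> ('a, 'n) module \<Rightarrow>
     ('a, (nat \<times> ((('a, 'a set) cell \<Rightarrow> 'a) \<Rightarrow> 'n) set) set) module" where
  "local_cohomology R I i N = gen_local_cohomology R I i (regular_module R) N"

definition ideal_depth ::
    "('a, 'r) ring_scheme \<Rightarrow> 'a set \<Rightarrow> ('a, 'n) module \<Rightarrow> enat" where
  "ideal_depth R I N = Inf {enat i | i. \<not> trivial_module (local_cohomology R I i N)}"

end

theory Submission
  imports Defs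
begin

text \<open>
  Positive depth means that no nonzero element of \<open>N\<close> is killed by \<open>I\<close>. This makes the first local
  cohomology module \<open>H\<close> of \<open>M\<close> and \<open>N\<close> explicit. Let \<open>L\<close> be the free module on a finite set \<open>S\<close> of generators of \<open>M\<close>,
  and \<open>K\<^sub>n\<close> the preimage of \<open>I\<^sup>n M\<close> in \<open>L\<close>. The first extension module of \<open>M / I\<^sup>n M\<close> and \<open>N\<close> consists of the linear
  maps \<open>K\<^sub>n \<rightarrow> N\<close> modulo those that extend to \<open>L\<close>, and the limit restricts such maps to later \<open>K\<^sub>n\<close>. A map
  that becomes extendable on a later \<open>K\<^sub>n\<close> was extendable before. In the same way, an element of
  the first extension module of \<open>R / I\<close> and \<open>H\<close> is represented by a linear map \<open>g : I \<rightarrow> H\<close>, and it vanishes if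
  \<open>g\<close> is multiplication by an element of \<open>H\<close>.

  Let \<open>G\<close> be a finite set of generators of \<open>I\<close>. Represent the elements \<open>g f\<close>, for \<open>f\<close> in \<open>G\<close>, by linear maps
  \<open>\<phi> f : K\<^sub>n \<rightarrow> N\<close> with a common \<open>n\<close>. From \<open>f' (g f) = f (g f')\<close> it follows that \<open>f' (\<phi> f) - f (\<phi> f')\<close> extends to a linear map
  \<open>\<psi> f f' : L \<rightarrow> N\<close>. Record the values of all \<open>\<psi> f f'\<close> on \<open>S\<close> and of all \<open>\<phi> f\<close> on a finite generating set \<open>W\<close> of the
  kernel of \<open>L \<rightarrow> M\<close>, which exists since \<open>R\<close> is Noetherian. These values form a vector in a finite power
  of \<open>N\<close>. It depends on choices, but it determines the class of \<open>g\<close>: by linearity, it suffices to see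
  that \<open>g\<close> is a multiplication if the vector is zero (\<open>obstruction_zero\<close>). In that case the \<open>\<phi> f\<close> vanish on the
  kernel of \<open>L \<rightarrow> M\<close> and satisfy \<open>f' (\<phi> f) = f (\<phi> f')\<close>, and this is what is needed to divide: on \<open>K\<^sub>n\<^sub>+\<^sub>1\<close>, which is the sum
  of that kernel and of \<open>I K\<^sub>n\<close>, there is a unique linear map \<open>\<chi>\<close> with \<open>\<phi> f = f \<chi>\<close> for all \<open>f\<close>
  (\<open>division_exists\<close>, \<open>common_quotient\<close>). Its class \<open>h\<close> in \<open>H\<close> satisfies \<open>g f = f h\<close>.

  Hence the extension module is a subquotient of a finite power of \<open>N\<close>, and weakly Laskerian modules are
  closed under finite powers (\<open>weakly_laskerian_power_module\<close>) and subquotients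
  (\<open>weakly_laskerian_linear_relation\<close>).
\<close>

section \<open>Modules, submodules and quotient modules\<close>

definition linear_map ::
    "('a, 'r) ring_scheme \<Rightarrow> ('a, 'x) module \<Rightarrow> ('a, 'y) module \<Rightarrow> ('x \<Rightarrow> 'y) \<Rightarrow> bool" where
  "linear_map R A B f \<longleftrightarrow> f \<in> carrier A \<rightarrow> carrier B \<and>
     (\<forall>x\<in>carrier A. \<forall>y\<in>carrier A. f (x \<oplus>\<^bsub>A\<^esub> y) = f x \<oplus>\<^bsub>B\<^esub> f y) \<and>
     (\<forall>a\<in>carrier R. \<forall>x\<in>carrier A. f (a \<odot>\<^bsub>A\<^esub> x) = a \<odot>\<^bsub>B\<^esub> f x)"

lemma linear_mapI:
  assumes "\<And>x. x \<in> carrier A \<Longrightarrow> f x \<in> carrier B"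
    and "\<And>x y. x \<in> carrier A \<Longrightarrow> y \<in> carrier A \<Longrightarrow> f (x \<oplus>\<^bsub>A\<^esub> y) = f x \<oplus>\<^bsub>B\<^esub> f y"
    and "\<And>a x. a \<in> carrier R \<Longrightarrow> x \<in> carrier A \<Longrightarrow> f (a \<odot>\<^bsub>A\<^esub> x) = a \<odot>\<^bsub>B\<^esub> f x"
  shows "linear_map R A B f"
  using assms by (auto simp: linear_map_def)

lemma linear_mapD:
  assumes "linear_map R A B f"
  shows "\<And>x. x \<in> carrier A \<Longrightarrow> f x \<in> carrier B"
    and "\<And>x y. x \<in> carrier A \<Longrightarrow> y \<in> carrier A \<Longrightarrow> f (x \<oplus>\<^bsub>A\<^esub> y) = f x \<oplus>\<^bsub>B\<^esub> f y"
    and "\<And>a x. a \<in> carrier R \<Longrightarrow> x \<in> carrier A \<Longrightarrow> f (a \<odot>\<^bsub>A\<^esub> x) = a \<odot>\<^bsub>B\<^esub> f x"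
  using assms by (auto simp: linear_map_def)

text \<open>Writing negatives as scalar multiples leaves sums and scalar multiples as the only operations
  to check in closure and linearity statements. It also avoids the negatives of a submodule taken as
  a module of its own, which are formed with respect to the smaller carrier.\<close>

lemma module_neg_smult:
  assumes "module R A" "x \<in> carrier A"
  shows "\<ominus>\<^bsub>A\<^esub> x = (\<ominus>\<^bsub>R\<^esub> \<one>\<^bsub>R\<^esub>) \<odot>\<^bsub>A\<^esub> x"
proof -
  interpret module R A by fact
  show ?thesis using assms(2) by (simp add: smult_l_minus)
qed

lemma module_minus_simps:
  assumes "module R A"
  shows "\<ominus>\<^bsub>A\<^esub> \<zero>\<^bsub>A\<^esub> = \<zero>\<^bsub>A\<^esub>"
    and "x \<in> carrier A \<Longrightarrow> x \<ominus>\<^bsub>A\<^esub> \<zero>\<^bsub>A\<^esub> = x"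
    and "x \<in> carrier A \<Longrightarrow> x \<ominus>\<^bsub>A\<^esub> x = \<zero>\<^bsub>A\<^esub>"
    and "x \<in> carrier A \<Longrightarrow> y \<in> carrier A \<Longrightarrow> x \<ominus>\<^bsub>A\<^esub> y = \<zero>\<^bsub>A\<^esub> \<longleftrightarrow> x = y"
    and "x \<in> carrier A \<Longrightarrow> y \<in> carrier A \<Longrightarrow> (x \<ominus>\<^bsub>A\<^esub> y) \<oplus>\<^bsub>A\<^esub> y = x"
    and "x \<in> carrier A \<Longrightarrow> y \<in> carrier A \<Longrightarrow> (x \<oplus>\<^bsub>A\<^esub> y) \<ominus>\<^bsub>A\<^esub> y = x"
proof -
  interpret module R A by fact
  show m: "\<ominus>\<^bsub>A\<^esub> \<zero>\<^bsub>A\<^esub> = \<zero>\<^bsub>A\<^esub>" by (metis M.l_neg M.r_zero M.zero_closed M.a_inv_closed)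
  show "x \<in> carrier A \<Longrightarrow> x \<ominus>\<^bsub>A\<^esub> \<zero>\<^bsub>A\<^esub> = x" by (simp add: a_minus_def m)
  show "x \<in> carrier A \<Longrightarrow> x \<ominus>\<^bsub>A\<^esub> x = \<zero>\<^bsub>A\<^esub>" by (simp add: a_minus_def M.r_neg)
  show d: "x \<in> carrier A \<Longrightarrow> y \<in> carrier A \<Longrightarrow> (x \<ominus>\<^bsub>A\<^esub> y) \<oplus>\<^bsub>A\<^esub> y = x"
    by (simp add: a_minus_def M.a_assoc M.l_neg)
  show "x \<in> carrier A \<Longrightarrow> y \<in> carrier A \<Longrightarrow> (x \<oplus>\<^bsub>A\<^esub> y) \<ominus>\<^bsub>A\<^esub> y = x"
    by (simp add: a_minus_def M.a_assoc M.r_neg)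
  show "x \<in> carrier A \<Longrightarrow> y \<in> carrier A \<Longrightarrow> x \<ominus>\<^bsub>A\<^esub> y = \<zero>\<^bsub>A\<^esub> \<longleftrightarrow> x = y"
    using d by (metis M.l_zero M.r_neg a_minus_def)
qed

lemma linear_map_zero:
  assumes "module R A" "module R B" "linear_map R A B f"
  shows "f \<zero>\<^bsub>A\<^esub> = \<zero>\<^bsub>B\<^esub>"
proof -
  interpret A: module R A by fact
  interpret B: module R B by fact
  have "f (\<zero>\<^bsub>R\<^esub> \<odot>\<^bsub>A\<^esub> \<zero>\<^bsub>A\<^esub>) = \<zero>\<^bsub>R\<^esub> \<odot>\<^bsub>B\<^esub> f \<zero>\<^bsub>A\<^esub>"
    using linear_mapD(3)[OF assms(3)] A.R.zero_closed A.M.zero_closed by blast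
  thus ?thesis using linear_mapD(1)[OF assms(3)] by (simp add: A.smult_l_null)
qed

lemma linear_map_neg:
  assumes "module R A" "module R B" "linear_map R A B f" "x \<in> carrier A"
  shows "f (\<ominus>\<^bsub>A\<^esub> x) = \<ominus>\<^bsub>B\<^esub> f x"
proof -
  interpret A: module R A by fact
  show ?thesis using linear_mapD[OF assms(3)] assms
    by (simp add: module_neg_smult[of R])
qed

lemma linear_map_minus:
  assumes "module R A" "module R B" "linear_map R A B f" "x \<in> carrier A" "y \<in> carrier A"
  shows "f (x \<ominus>\<^bsub>A\<^esub> y) = f x \<ominus>\<^bsub>B\<^esub> f y"
proof -
  interpret A: module R A by fact
  show ?thesis using linear_mapD[OF assms(3)] assms
    by (simp add: a_minus_def linear_map_neg[of R])
qed

lemma linear_map_comp: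
  assumes "linear_map R A B f" "linear_map R B C g"
  shows "linear_map R A C (\<lambda>x. g (f x))"
  using assms by (auto simp: linear_map_def Pi_iff)

lemma submodule_simps:
  assumes "module R A" "submodule U R A"
  shows "U \<subseteq> carrier A" "\<zero>\<^bsub>A\<^esub> \<in> U"
    "\<And>x. x \<in> U \<Longrightarrow> x \<in> carrier A"
    "\<And>x y. x \<in> U \<Longrightarrow> y \<in> U \<Longrightarrow> x \<oplus>\<^bsub>A\<^esub> y \<in> U"
    "\<And>a x. a \<in> carrier R \<Longrightarrow> x \<in> U \<Longrightarrow> a \<odot>\<^bsub>A\<^esub> x \<in> U"
    "\<And>x. x \<in> U \<Longrightarrow> \<ominus>\<^bsub>A\<^esub> x \<in> U"
    "\<And>x y. x \<in> U \<Longrightarrow> y \<in> U \<Longrightarrow> x \<ominus>\<^bsub>A\<^esub> y \<in> U"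
proof -
  interpret module R A by fact
  note E = submoduleE[OF assms(2)]
  show "U \<subseteq> carrier A" by (rule E)
  thus "\<And>x. x \<in> U \<Longrightarrow> x \<in> carrier A" by auto
  show "\<zero>\<^bsub>A\<^esub> \<in> U" using subgroup.one_closed[OF submodule.axioms(1)[OF assms(2)]] by simp
  show "\<And>x y. x \<in> U \<Longrightarrow> y \<in> U \<Longrightarrow> x \<oplus>\<^bsub>A\<^esub> y \<in> U"
    "\<And>a x. a \<in> carrier R \<Longrightarrow> x \<in> U \<Longrightarrow> a \<odot>\<^bsub>A\<^esub> x \<in> U"
    "\<And>x. x \<in> U \<Longrightarrow> \<ominus>\<^bsub>A\<^esub> x \<in> U" by (auto intro: E)
  thus "\<And>x y. x \<in> U \<Longrightarrow> y \<in> U \<Longrightarrow> x \<ominus>\<^bsub>A\<^esub> y \<in> U" by (simp add: a_minus_def)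
qed

lemma submoduleI':
  assumes "module R A" and "U \<subseteq> carrier A" and "\<zero>\<^bsub>A\<^esub> \<in> U"
    and "\<And>x y. x \<in> U \<Longrightarrow> y \<in> U \<Longrightarrow> x \<oplus>\<^bsub>A\<^esub> y \<in> U"
    and "\<And>a x. a \<in> carrier R \<Longrightarrow> x \<in> U \<Longrightarrow> a \<odot>\<^bsub>A\<^esub> x \<in> U"
  shows "submodule U R A"
proof -
  interpret module R A by fact
  show ?thesis
    by (rule submoduleI) (use assms in \<open>auto simp: subset_eq module_neg_smult[of R A]\<close>)
qed

lemma submodule_module:
  assumes "module R A" "submodule U R A"
  shows "module R (A\<lparr>carrier := U\<rparr>)"
  using submodule.submodule_is_module assms by blast

lemma kernel_submodule:
  assumes "module R A" "module R B" "linear_map R A B f"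
  shows "submodule {x \<in> carrier A. f x = \<zero>\<^bsub>B\<^esub>} R A"
proof -
  interpret A: module R A by fact
  interpret B: module R B by fact
  show ?thesis
    by (rule submoduleI')
      (use assms linear_mapD[OF assms(3)] linear_map_zero[OF assms] in auto)
qed

lemma image_submodule:
  assumes "module R A" "module R B" "linear_map R A B f" "submodule U R A"
  shows "submodule (f ` U) R B"
proof -
  interpret A: module R A by fact
  interpret B: module R B by fact
  note s = submodule_simps[OF assms(1,4)]
  show ?thesis
  proof (rule submoduleI')
    show "\<zero>\<^bsub>B\<^esub> \<in> f ` U" using linear_map_zero[OF assms(1-3)] s(2) by force
    show "f ` U \<subseteq> carrier B" using linear_mapD[OF assms(3)] s by auto
    fix x y assume "x \<in> f ` U" "y \<in> f ` U"
    then obtain u v where u: "u \<in> U" "v \<in> U" "x = f u" "y = f v" by auto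
    hence "x \<oplus>\<^bsub>B\<^esub> y = f (u \<oplus>\<^bsub>A\<^esub> v)" using linear_mapD(2)[OF assms(3)] s(3) by auto
    thus "x \<oplus>\<^bsub>B\<^esub> y \<in> f ` U" using u s by auto
  next
    fix a x assume "a \<in> carrier R" "x \<in> f ` U"
    then obtain u where u: "u \<in> U" "x = f u" "a \<in> carrier R" by auto
    hence "a \<odot>\<^bsub>B\<^esub> x = f (a \<odot>\<^bsub>A\<^esub> u)" using linear_mapD(3)[OF assms(3)] s(3) by auto
    thus "a \<odot>\<^bsub>B\<^esub> x \<in> f ` U" using u s by auto
  qed fact
qed

lemma preimage_submodule:
  assumes "module R A" "module R B" "linear_map R A B f" "submodule U R B"
  shows "submodule {x \<in> carrier A. f x \<in> U} R A"
proof -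
  interpret A: module R A by fact
  show ?thesis
    by (rule submoduleI')
      (use assms linear_mapD[OF assms(3)] linear_map_zero[OF assms(1-3)]
        submodule_simps[OF assms(2,4)] in auto)
qed

lemma equalizer_submodule:
  assumes "module R A" "module R B" "linear_map R A B f" "linear_map R A B g"
  shows "submodule {x \<in> carrier A. f x = g x} R A"
proof -
  interpret A: module R A by fact
  show ?thesis
    by (rule submoduleI')
      (use assms linear_mapD[OF assms(3)] linear_mapD[OF assms(4)]
         linear_map_zero[OF assms(1-3)] linear_map_zero[OF assms(1,2,4)] in auto)
qed

lemma submodule_trans:
  assumes A: "module R A" and U: "submodule U R A" and V: "submodule V R (A\<lparr>carrier := U\<rparr>)"
  shows "submodule V R A"
proof -
  note u = submodule_simps[OF A U]
  note v = submodule_simps[OF submodule_module[OF A U] V]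
  have "V \<subseteq> carrier A" using u(1) v(1) by auto
  thus ?thesis by (rule submoduleI'[OF A]) (use v(2,4,5) in auto)
qed

lemma linear_map_submodule_domain:
  assumes "linear_map R A B f" "U \<subseteq> carrier A"
  shows "linear_map R (A\<lparr>carrier := U\<rparr>) B f"
  by (rule linear_mapI) (use linear_mapD[OF assms(1)] assms(2) in \<open>auto simp: subset_iff\<close>)

lemma linear_map_submodule_codomain:
  assumes "linear_map R A B f" "\<And>x. x \<in> carrier A \<Longrightarrow> f x \<in> V"
  shows "linear_map R A (B\<lparr>carrier := V\<rparr>) f"
  using assms by (auto simp: linear_map_def)

lemma linear_map_restrict:
  assumes "module R A"
  shows "linear_map R A B (restrict f (carrier A)) \<longleftrightarrow> linear_map R A B f"
proof -
  interpret module R A by fact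
  show ?thesis by (auto simp: linear_map_def Pi_iff)
qed

lemma linear_map_cong:
  assumes "module R A" "\<And>x. x \<in> carrier A \<Longrightarrow> f x = g x"
  shows "linear_map R A B f \<longleftrightarrow> linear_map R A B g"
proof -
  interpret module R A by fact
  show ?thesis using assms(2) by (simp add: linear_map_def Pi_iff)
qed

lemma linear_map_pointwise:
  assumes "module R B" "module R A"
  shows "linear_map R A B (\<lambda>x. \<zero>\<^bsub>B\<^esub>)"
    and "linear_map R A B f \<Longrightarrow> linear_map R A B g \<Longrightarrow> linear_map R A B (\<lambda>x. f x \<oplus>\<^bsub>B\<^esub> g x)"
    and "linear_map R A B f \<Longrightarrow> a \<in> carrier R \<Longrightarrow> linear_map R A B (\<lambda>x. a \<odot>\<^bsub>B\<^esub> f x)"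
    and "linear_map R A B f \<Longrightarrow> linear_map R A B g \<Longrightarrow> linear_map R A B (\<lambda>x. f x \<ominus>\<^bsub>B\<^esub> g x)"
proof -
  interpret module R B by fact
  show "linear_map R A B (\<lambda>x. \<zero>\<^bsub>B\<^esub>)"
    by (auto simp: linear_map_def)
  show add: "linear_map R A B f \<Longrightarrow> linear_map R A B g \<Longrightarrow> linear_map R A B (\<lambda>x. f x \<oplus>\<^bsub>B\<^esub> g x)" for f g
    by (auto simp: linear_map_def Pi_iff M.a_ac smult_r_distr)
  show sm: "linear_map R A B f \<Longrightarrow> a \<in> carrier R \<Longrightarrow> linear_map R A B (\<lambda>x. a \<odot>\<^bsub>B\<^esub> f x)" for a f
    by (auto simp: linear_map_def Pi_iff smult_r_distr smult_assoc1[symmetric] R.m_comm)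
  show "linear_map R A B f \<Longrightarrow> linear_map R A B g \<Longrightarrow> linear_map R A B (\<lambda>x. f x \<ominus>\<^bsub>B\<^esub> g x)"
  proof -
    assume f: "linear_map R A B f" and g: "linear_map R A B g"
    have lp: "linear_map R A B (\<lambda>x. f x \<oplus>\<^bsub>B\<^esub> (\<ominus>\<^bsub>R\<^esub> \<one>\<^bsub>R\<^esub>) \<odot>\<^bsub>B\<^esub> g x)" by (intro add f sm g) simp
    have e: "f x \<oplus>\<^bsub>B\<^esub> (\<ominus>\<^bsub>R\<^esub> \<one>\<^bsub>R\<^esub>) \<odot>\<^bsub>B\<^esub> g x = f x \<ominus>\<^bsub>B\<^esub> g x" if "x \<in> carrier A" for x
      using linear_mapD(1)[OF g that] by (simp add: module_neg_smult[OF assms(1), symmetric] a_minus_def)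
    show ?thesis by (rule iffD1[OF linear_map_cong[OF assms(2)] lp]) (rule e)
  qed
qed

lemma submodule_abelian_subgroup:
  assumes "module R A" "submodule U R A"
  shows "abelian_subgroup U A"
proof -
  interpret module R A by fact
  show ?thesis
    using abelian_subgroupI3[OF additive_subgroupI[OF submodule.axioms(1)[OF assms(2)]]]
      M.abelian_group_axioms by blast
qed

lemma coset_eq_iff:
  assumes "module R A" "submodule U R A" "x \<in> carrier A" "y \<in> carrier A"
  shows "U +>\<^bsub>A\<^esub> x = U +>\<^bsub>A\<^esub> y \<longleftrightarrow> x \<ominus>\<^bsub>A\<^esub> y \<in> U"
proof -
  interpret module R A by fact
  interpret U: abelian_subgroup U A by (rule submodule_abelian_subgroup[OF assms(1,2)])
  have "U +>\<^bsub>A\<^esub> x = U +>\<^bsub>A\<^esub> y \<longleftrightarrow> x \<in> U +>\<^bsub>A\<^esub> y"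
    using U.a_repr_independence' U.a_rcos_self assms by metis
  also have "\<dots> \<longleftrightarrow> x \<ominus>\<^bsub>A\<^esub> y \<in> U"
    using U.a_rcos_module[OF assms(4,3)] by (simp add: a_minus_def)
  finally show ?thesis .
qed

lemma coset_memD:
  assumes "module R A" "submodule U R A" "x \<in> carrier A" "y \<in> U +>\<^bsub>A\<^esub> x"
  shows "y \<in> carrier A" "U +>\<^bsub>A\<^esub> y = U +>\<^bsub>A\<^esub> x"
proof -
  interpret module R A by fact
  interpret U: abelian_subgroup U A by (rule submodule_abelian_subgroup[OF assms(1,2)])
  show "y \<in> carrier A" using U.a_elemrcos_carrier assms by blast
  show "U +>\<^bsub>A\<^esub> y = U +>\<^bsub>A\<^esub> x" using U.a_repr_independence' assms by metis
qed

lemma coset_self: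
  assumes "module R A" "submodule U R A" "x \<in> carrier A"
  shows "x \<in> U +>\<^bsub>A\<^esub> x"
proof -
  interpret module R A by fact
  interpret U: abelian_subgroup U A by (rule submodule_abelian_subgroup[OF assms(1,2)])
  show ?thesis using U.a_rcos_self assms by blast
qed

lemma coset_zero:
  assumes "module R A" "submodule U R A"
  shows "U +>\<^bsub>A\<^esub> \<zero>\<^bsub>A\<^esub> = U"
proof -
  interpret module R A by fact
  show ?thesis using submodule_simps[OF assms] by (simp add: a_coset_add_zero)
qed

lemma coset_eq_self_iff:
  assumes "module R A" "submodule U R A" "x \<in> carrier A"
  shows "U +>\<^bsub>A\<^esub> x = U \<longleftrightarrow> x \<in> U"
proof -
  interpret module R A by fact
  have "U +>\<^bsub>A\<^esub> x = U +>\<^bsub>A\<^esub> \<zero>\<^bsub>A\<^esub> \<longleftrightarrow> x \<in> U"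
    using coset_eq_iff[OF assms, of "\<zero>\<^bsub>A\<^esub>"] assms(3) by (simp add: module_minus_simps[OF assms(1)])
  thus ?thesis using coset_zero[OF assms(1,2)] by simp
qed

text \<open>Besides induced maps between quotients, this covers scalar multiplication on a quotient, which is
  the map induced by multiplication with a scalar.\<close>

lemma quot_map_coset:
  assumes "module R B" "submodule V R B" "module R A" "submodule U R A"
    and "linear_map R B A h" "h ` V \<subseteq> U" "x \<in> carrier B"
  shows "quot_map A U h (V +>\<^bsub>B\<^esub> x) = U +>\<^bsub>A\<^esub> h x"
proof -
  interpret B: module R B by fact
  have "U +>\<^bsub>A\<^esub> h y = U +>\<^bsub>A\<^esub> h x" if y: "y \<in> V +>\<^bsub>B\<^esub> x" for y
  proof -
    have yB: "y \<in> carrier B" and "V +>\<^bsub>B\<^esub> y = V +>\<^bsub>B\<^esub> x"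
      using coset_memD[OF assms(1,2,7) y] by auto
    hence "y \<ominus>\<^bsub>B\<^esub> x \<in> V" using coset_eq_iff[OF assms(1,2) yB assms(7)] by simp
    hence "h y \<ominus>\<^bsub>A\<^esub> h x \<in> U"
      using linear_map_minus[OF assms(1,3,5) yB assms(7)] assms(6) by force
    thus ?thesis using coset_eq_iff[OF assms(3,4)] linear_mapD(1)[OF assms(5)] yB assms(7) by simp
  qed
  thus ?thesis using coset_self[OF assms(1,2,7)] unfolding quot_map_def by blast
qed

lemma carrier_quot_module:
  "carrier (quot_module A U) = (\<lambda>x. U +>\<^bsub>A\<^esub> x) ` carrier A"
  by (auto simp: quot_module_def A_RCOSETS_def')

lemma zero_quot_module [simp]: "\<zero>\<^bsub>quot_module A U\<^esub> = U"
  by (simp add: quot_module_def)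

lemma quot_module_add:
  assumes "module R A" "submodule U R A" "x \<in> carrier A" "y \<in> carrier A"
  shows "(U +>\<^bsub>A\<^esub> x) \<oplus>\<^bsub>quot_module A U\<^esub> (U +>\<^bsub>A\<^esub> y) = U +>\<^bsub>A\<^esub> (x \<oplus>\<^bsub>A\<^esub> y)"
proof -
  interpret module R A by fact
  interpret U: abelian_subgroup U A by (rule submodule_abelian_subgroup[OF assms(1,2)])
  show ?thesis using U.a_rcos_sum[OF assms(3,4)] by (simp add: quot_module_def)
qed

lemma linear_map_smult:
  assumes "module R A" "a \<in> carrier R"
  shows "linear_map R A A (\<lambda>x. a \<odot>\<^bsub>A\<^esub> x)"
proof -
  interpret module R A by fact
  show ?thesis using assms(2)
    by (auto intro!: linear_mapI simp: smult_r_distr smult_assoc1[symmetric] R.m_comm)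
qed

lemma quot_module_smult:
  assumes "module R A" "submodule U R A" "a \<in> carrier R" "x \<in> carrier A"
  shows "a \<odot>\<^bsub>quot_module A U\<^esub> (U +>\<^bsub>A\<^esub> x) = U +>\<^bsub>A\<^esub> (a \<odot>\<^bsub>A\<^esub> x)"
  using quot_map_coset[OF assms(1,2,1,2) linear_map_smult[OF assms(1,3)] _ assms(4)]
    submodule_simps(5)[OF assms(1,2,3)]
  by (auto simp: quot_module_def quot_map_def)

lemma quot_module_module:
  assumes "module R A" "submodule U R A"
  shows "module R (quot_module A U)"
proof -
  interpret module R A by fact
  let ?Q = "quot_module A U"
  note s = quot_module_add[OF assms] quot_module_smult[OF assms]
  note z = coset_zero[OF assms]
  have Z: "\<zero>\<^bsub>?Q\<^esub> = U +>\<^bsub>A\<^esub> \<zero>\<^bsub>A\<^esub>" using z by simp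
  note d = carrier_quot_module[of A U]
  have ag: "abelian_group ?Q"
  proof (rule abelian_groupI)
    fix x assume "x \<in> carrier ?Q"
    then obtain u where u: "u \<in> carrier A" "x = U +>\<^bsub>A\<^esub> u" by (auto simp: d)
    hence "(U +>\<^bsub>A\<^esub> (\<ominus>\<^bsub>A\<^esub> u)) \<oplus>\<^bsub>?Q\<^esub> x = \<zero>\<^bsub>?Q\<^esub>" unfolding Z using u by (simp add: s M.l_neg)
    thus "\<exists>y\<in>carrier ?Q. y \<oplus>\<^bsub>?Q\<^esub> x = \<zero>\<^bsub>?Q\<^esub>" using u by (auto simp: d)
  next
    show "\<zero>\<^bsub>?Q\<^esub> \<in> carrier ?Q" unfolding Z d by auto
    fix x assume "x \<in> carrier ?Q"
    thus "\<zero>\<^bsub>?Q\<^esub> \<oplus>\<^bsub>?Q\<^esub> x = x" unfolding Z by (auto simp: d s)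
  qed (auto simp: d s M.a_ac)
  show ?thesis
    by (rule moduleI[OF R.is_cring ag])
      (auto simp: d s smult_l_distr smult_r_distr smult_assoc1)
qed

lemma linear_map_proj:
  assumes "module R A" "submodule U R A"
  shows "linear_map R A (quot_module A U) (\<lambda>x. U +>\<^bsub>A\<^esub> x)"
  by (rule linear_mapI)
    (simp_all add: carrier_quot_module quot_module_add[OF assms] quot_module_smult[OF assms])

lemma linear_map_quot_factor:
  assumes A: "module R A" and U: "submodule U R A" and B: "module R B" and f: "linear_map R A B f"
    and zero: "\<And>u. u \<in> U \<Longrightarrow> f u = \<zero>\<^bsub>B\<^esub>"
  obtains q where "linear_map R (quot_module A U) B q" "\<And>x. x \<in> carrier A \<Longrightarrow> q (U +>\<^bsub>A\<^esub> x) = f x"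
proof -
  define q where "q C = f (SOME x. x \<in> C)" for C
  have q: "q (U +>\<^bsub>A\<^esub> x) = f x" if x: "x \<in> carrier A" for x
  proof -
    let ?y = "SOME y. y \<in> U +>\<^bsub>A\<^esub> x"
    have y: "?y \<in> U +>\<^bsub>A\<^esub> x" using coset_self[OF A U x] by (rule someI)
    note c = coset_memD[OF A U x y]
    have "f (?y \<ominus>\<^bsub>A\<^esub> x) = \<zero>\<^bsub>B\<^esub>" using coset_eq_iff[OF A U c(1) x] c(2) zero by simp
    thus ?thesis
      using linear_map_minus[OF A B f c(1) x] module_minus_simps(4)[OF B] linear_mapD(1)[OF f] c(1) x
      by (simp add: q_def)
  qed
  have "linear_map R (quot_module A U) B q"
    by (rule linear_mapI)
      (auto simp: carrier_quot_module quot_module_add[OF A U] quot_module_smult[OF A U]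
        module.smult_closed[OF A] abelian_monoid.a_closed[OF abelian_group.axioms(1)[OF module.axioms(2)[OF A]]]
        q linear_mapD[OF f])
  thus ?thesis using that q by blast
qed

section \<open>Weakly Laskerian modules\<close>

lemma Ass_quot_module:
  assumes "module R A" "submodule U R A"
  shows "Ass R (quot_module A U) =
    {P. primeideal P R \<and> (\<exists>x\<in>carrier A. P = {a \<in> carrier R. a \<odot>\<^bsub>A\<^esub> x \<in> U})}"
proof -
  interpret module R A by fact
  have e: "a \<odot>\<^bsub>quot_module A U\<^esub> (U +>\<^bsub>A\<^esub> x) = U \<longleftrightarrow> a \<odot>\<^bsub>A\<^esub> x \<in> U"
    if "x \<in> carrier A" "a \<in> carrier R" for a x
    using quot_module_smult[OF assms that(2,1)] coset_eq_self_iff[OF assms smult_closed[OF that(2,1)]]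
    by metis
  have k: "{a \<in> carrier R. a \<odot>\<^bsub>quot_module A U\<^esub> (U +>\<^bsub>A\<^esub> x) = U} =
        {a \<in> carrier R. a \<odot>\<^bsub>A\<^esub> x \<in> U}" if "x \<in> carrier A" for x
    by (rule Collect_cong) (use e[OF that] in blast)
  have "(\<exists>y\<in>(\<lambda>x. U +>\<^bsub>A\<^esub> x) ` carrier A. P = {a \<in> carrier R. a \<odot>\<^bsub>quot_module A U\<^esub> y = U}) \<longleftrightarrow>
        (\<exists>x\<in>carrier A. P = {a \<in> carrier R. a \<odot>\<^bsub>A\<^esub> x \<in> U})" for P
    unfolding Set.bex_simps(7) by (rule bex_cong[OF refl]) (simp only: k)
  thus ?thesis unfolding Ass_def carrier_quot_module zero_quot_module by (simp only:)
qed

lemma Ass_quot_module_zero: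
  assumes "module R A"
  shows "Ass R A = Ass R (quot_module A {\<zero>\<^bsub>A\<^esub>})"
proof -
  interpret module R A by fact
  have "submodule {\<zero>\<^bsub>A\<^esub>} R A" by (rule submoduleI') (use assms in auto)
  thus ?thesis unfolding Ass_quot_module[OF assms \<open>submodule {\<zero>\<^bsub>A\<^esub>} R A\<close>] by (simp add: Ass_def)
qed

lemma weakly_laskerian_finite_Ass:
  assumes "weakly_laskerian R A"
  shows "finite (Ass R A)"
proof -
  have m: "module R A" using assms by (simp add: weakly_laskerian_def)
  then interpret module R A .
  have "submodule {\<zero>\<^bsub>A\<^esub>} R A" by (rule submoduleI') (use m in auto)
  thus ?thesis using assms Ass_quot_module_zero[OF m] by (simp add: weakly_laskerian_def)
qed

text \<open>Subquotients of weakly Laskerian modules are weakly Laskerian. A subquotient of \<open>P\<close> is given by a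
  linear relation \<open>\<Phi>\<close> between \<open>P\<close> and \<open>T\<close> that reaches all of \<open>T\<close> and relates \<open>0\<close> only to \<open>0\<close>: then \<open>T\<close> is the
  domain of \<open>\<Phi>\<close> modulo the vectors related to \<open>0\<close>. In this form no choice of related vectors has to be
  made linear. If \<open>V\<close> is the set of all vectors related to elements of \<open>U\<close>, and \<open>v\<close> is related to \<open>x\<close>, then
  \<open>v + V\<close> and \<open>x + U\<close> have the same annihilator.\<close>

lemma weakly_laskerian_linear_relation:
  assumes P: "weakly_laskerian R P" and T: "module R T"
    and dom: "\<And>v x. \<Phi> v x \<Longrightarrow> v \<in> carrier P \<and> x \<in> carrier T"
    and add: "\<And>v w x y. \<Phi> v x \<Longrightarrow> \<Phi> w y \<Longrightarrow> \<Phi> (v \<oplus>\<^bsub>P\<^esub> w) (x \<oplus>\<^bsub>T\<^esub> y)"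
    and smult: "\<And>a v x. a \<in> carrier R \<Longrightarrow> \<Phi> v x \<Longrightarrow> \<Phi> (a \<odot>\<^bsub>P\<^esub> v) (a \<odot>\<^bsub>T\<^esub> x)"
    and onto: "\<And>x. x \<in> carrier T \<Longrightarrow> \<exists>v. \<Phi> v x"
    and inj: "\<And>x. \<Phi> \<zero>\<^bsub>P\<^esub> x \<Longrightarrow> x = \<zero>\<^bsub>T\<^esub>"
  shows "weakly_laskerian R T"
  unfolding weakly_laskerian_def
proof (intro conjI allI impI T)
  fix U assume U: "submodule U R T"
  have mP: "module R P" using P by (simp add: weakly_laskerian_def)
  interpret P: module R P by (rule mP)
  interpret T: module R T by (rule T)
  note sU = submodule_simps[OF T U]
  define V where "V = {v. \<exists>x\<in>U. \<Phi> v x}"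
  have fn: "x = y" if "\<Phi> v x" "\<Phi> v y" for v x y
  proof -
    have "\<Phi> (v \<oplus>\<^bsub>P\<^esub> \<ominus>\<^bsub>P\<^esub> v) (x \<oplus>\<^bsub>T\<^esub> \<ominus>\<^bsub>T\<^esub> y)"
      using add[OF that(1) smult[OF _ that(2), of "\<ominus>\<^bsub>R\<^esub> \<one>\<^bsub>R\<^esub>"]] dom[OF that(1)] dom[OF that(2)]
      by (simp add: module_neg_smult[OF mP] module_neg_smult[OF T])
    hence "x \<oplus>\<^bsub>T\<^esub> \<ominus>\<^bsub>T\<^esub> y = \<zero>\<^bsub>T\<^esub>" using inj dom[OF that(1)] by (simp add: P.M.r_neg)
    thus ?thesis using dom[OF that(1)] dom[OF that(2)] module_minus_simps(4)[OF T, of x y]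
      by (simp add: a_minus_def)
  qed
  have "submodule V R P"
  proof (rule submoduleI'[OF mP])
    show "V \<subseteq> carrier P" using dom by (auto simp: V_def)
    obtain v where v: "\<Phi> v \<zero>\<^bsub>T\<^esub>" using onto by blast
    have "\<Phi> (\<zero>\<^bsub>R\<^esub> \<odot>\<^bsub>P\<^esub> v) (\<zero>\<^bsub>R\<^esub> \<odot>\<^bsub>T\<^esub> \<zero>\<^bsub>T\<^esub>)" by (rule smult[OF _ v]) simp
    thus "\<zero>\<^bsub>P\<^esub> \<in> V" using dom[OF v] sU by (auto simp: V_def)
    fix v w assume "v \<in> V" "w \<in> V"
    then obtain x y where "x \<in> U" "y \<in> U" "\<Phi> v x" "\<Phi> w y" by (auto simp: V_def)
    thus "v \<oplus>\<^bsub>P\<^esub> w \<in> V" using sU(4) add unfolding V_def by blast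
  next
    fix a v assume a: "a \<in> carrier R" and "v \<in> V"
    then obtain x where "x \<in> U" "\<Phi> v x" by (auto simp: V_def)
    thus "a \<odot>\<^bsub>P\<^esub> v \<in> V" using sU(5)[OF a] smult[OF a] unfolding V_def by blast
  qed
  hence fin: "finite (Ass R (quot_module P V))" and V: "submodule V R P"
    using P by (auto simp: weakly_laskerian_def)
  have "Ass R (quot_module T U) \<subseteq> Ass R (quot_module P V)"
  proof
    fix p assume "p \<in> Ass R (quot_module T U)"
    then obtain x where p: "primeideal p R" "x \<in> carrier T" "p = {a \<in> carrier R. a \<odot>\<^bsub>T\<^esub> x \<in> U}"
      by (auto simp: Ass_quot_module[OF T U])
    obtain v where v: "\<Phi> v x" using onto p by blast
    have "a \<odot>\<^bsub>T\<^esub> x \<in> U \<longleftrightarrow> a \<odot>\<^bsub>P\<^esub> v \<in> V" if "a \<in> carrier R" for a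
      using smult[OF that v] fn by (auto simp: V_def)
    hence "p = {a \<in> carrier R. a \<odot>\<^bsub>P\<^esub> v \<in> V}" using p(3) by auto
    thus "p \<in> Ass R (quot_module P V)" using p dom[OF v] by (auto simp: Ass_quot_module[OF mP V])
  qed
  thus "finite (Ass R (quot_module T U))" using fin finite_subset by blast
qed

text \<open>Let \<open>p\<close> be the annihilator of \<open>x + U\<close> and \<open>K\<close> the kernel of \<open>f\<close>. If \<open>a x = k + u\<close> for some \<open>a\<close> outside \<open>p\<close>, with
  \<open>k\<close> in \<open>K\<close> and \<open>u\<close> in \<open>U\<close>, then \<open>p\<close> is also the annihilator of \<open>k + (U \<inter> K)\<close>, because \<open>p\<close> is prime. Otherwise
  it is the annihilator of \<open>f x + f U\<close>.\<close>

lemma weakly_laskerian_extension: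
  assumes A: "module R A" and Q: "weakly_laskerian R Q" and f: "linear_map R A Q f"
    and K: "weakly_laskerian R (A\<lparr>carrier := {x \<in> carrier A. f x = \<zero>\<^bsub>Q\<^esub>}\<rparr>)"
  shows "weakly_laskerian R A"
  unfolding weakly_laskerian_def
proof (intro conjI allI impI A)
  fix U assume U: "submodule U R A"
  interpret A: module R A by (rule A)
  have mQ: "module R Q" using Q by (simp add: weakly_laskerian_def)
  then interpret Q: module R Q .
  define K where "K = {x \<in> carrier A. f x = \<zero>\<^bsub>Q\<^esub>}"
  have sK: "submodule K R A" unfolding K_def by (rule kernel_submodule[OF A mQ f])
  have mK: "module R (A\<lparr>carrier := K\<rparr>)" by (rule submodule_module[OF A sK])
  note sU = submodule_simps[OF A U] note ssK = submodule_simps[OF A sK]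
  have UK: "submodule (U \<inter> K) R (A\<lparr>carrier := K\<rparr>)"
    by (rule submoduleI'[OF mK]) (use sU ssK in auto)
  have fU: "submodule (f ` U) R Q" by (rule image_submodule[OF A mQ f U])
  have "Ass R (quot_module A U) \<subseteq>
     Ass R (quot_module (A\<lparr>carrier := K\<rparr>) (U \<inter> K)) \<union> Ass R (quot_module Q (f ` U))"
  proof
    fix p assume "p \<in> Ass R (quot_module A U)"
    then obtain x where p: "primeideal p R" "x \<in> carrier A" "p = {a \<in> carrier R. a \<odot>\<^bsub>A\<^esub> x \<in> U}"
      by (auto simp: Ass_quot_module[OF A U])
    show "p \<in> Ass R (quot_module (A\<lparr>carrier := K\<rparr>) (U \<inter> K)) \<union> Ass R (quot_module Q (f ` U))"
    proof (cases "\<exists>a\<in>carrier R - p. f (a \<odot>\<^bsub>A\<^esub> x) \<in> f ` U")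
      case True
      then obtain a u where a: "a \<in> carrier R" "a \<notin> p" "u \<in> U" "f (a \<odot>\<^bsub>A\<^esub> x) = f u" by auto
      define k where "k = a \<odot>\<^bsub>A\<^esub> x \<ominus>\<^bsub>A\<^esub> u"
      have uA: "u \<in> carrier A" using a sU by auto
      have kK: "k \<in> K"
        using a p uA linear_map_minus[OF A mQ f, of "a \<odot>\<^bsub>A\<^esub> x" u] linear_mapD(1)[OF f uA]
        unfolding K_def k_def by (simp add: Q.M.r_neg a_minus_def)
      have "b \<odot>\<^bsub>A\<^esub> k \<in> U \<inter> K \<longleftrightarrow> b \<in> p" if b: "b \<in> carrier R" for b
      proof -
        have e: "b \<odot>\<^bsub>A\<^esub> (a \<odot>\<^bsub>A\<^esub> x) = b \<odot>\<^bsub>A\<^esub> k \<oplus>\<^bsub>A\<^esub> b \<odot>\<^bsub>A\<^esub> u"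
          using a p b uA unfolding k_def
          by (simp add: A.smult_r_distr[symmetric] a_minus_def A.M.a_assoc A.M.l_neg)
        have bu: "b \<odot>\<^bsub>A\<^esub> u \<in> U" using sU a b by auto
        have "b \<odot>\<^bsub>A\<^esub> k = b \<odot>\<^bsub>A\<^esub> (a \<odot>\<^bsub>A\<^esub> x) \<ominus>\<^bsub>A\<^esub> b \<odot>\<^bsub>A\<^esub> u"
          using e ssK(3)[OF kK] uA b by (simp add: a_minus_def A.M.a_assoc A.M.r_neg)
        hence "b \<odot>\<^bsub>A\<^esub> k \<in> U \<longleftrightarrow> b \<odot>\<^bsub>A\<^esub> (a \<odot>\<^bsub>A\<^esub> x) \<in> U"
          using e bu sU(4,7) by metis
        also have "\<dots> \<longleftrightarrow> b \<otimes>\<^bsub>R\<^esub> a \<in> p" using p a b by (simp add: A.smult_assoc1)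
        also have "\<dots> \<longleftrightarrow> b \<in> p"
          using primeideal.I_prime[OF p(1) b a(1)] a(2) b a(1)
            ideal.I_r_closed[OF primeideal.axioms(1)[OF p(1)]] by auto
        finally show ?thesis using ssK(5)[OF b kK] by auto
      qed
      hence "p = {b \<in> carrier R. b \<odot>\<^bsub>A\<^esub> k \<in> U \<inter> K}"
        using ideal.Icarr[OF primeideal.axioms(1)[OF p(1)]] by blast
      hence "p \<in> Ass R (quot_module (A\<lparr>carrier := K\<rparr>) (U \<inter> K))"
        unfolding Ass_quot_module[OF mK UK] using kK p(1) by auto
      thus ?thesis by simp
    next
      case False
      have "f (a \<odot>\<^bsub>A\<^esub> x) \<in> f ` U \<longleftrightarrow> a \<in> p" if "a \<in> carrier R" for a
        using that p(3) False by blast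
      hence "p = {a \<in> carrier R. a \<odot>\<^bsub>Q\<^esub> f x \<in> f ` U}"
        using ideal.Icarr[OF primeideal.axioms(1)[OF p(1)]] linear_mapD(3)[OF f _ p(2)] by auto
      hence "p \<in> Ass R (quot_module Q (f ` U))"
        unfolding Ass_quot_module[OF mQ fU] using p linear_mapD(1)[OF f p(2)] by auto
      thus ?thesis by simp
    qed
  qed
  moreover have "finite (Ass R (quot_module (A\<lparr>carrier := K\<rparr>) (U \<inter> K)))"
    using K UK unfolding weakly_laskerian_def K_def by blast
  moreover have "finite (Ass R (quot_module Q (f ` U)))"
    using Q fU unfolding weakly_laskerian_def by blast
  ultimately show "finite (Ass R (quot_module A U))" by (meson finite_UnI finite_subset)
qed

text \<open>The power \<open>N\<^sup>B\<close>. The entries outside \<open>B\<close> are zero, so that the kernel of the projection to one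
  coordinate is again a power of \<open>N\<close>, over a smaller index set and inside the same type.\<close>

definition power_module :: "('a, 'x) module \<Rightarrow> 'b set \<Rightarrow> ('a, 'b \<Rightarrow> 'x) module" where
  "power_module N B =
     \<lparr>carrier = {v. (\<forall>b. v b \<in> carrier N) \<and> (\<forall>b. b \<notin> B \<longrightarrow> v b = \<zero>\<^bsub>N\<^esub>)},
      monoid.mult = undefined, monoid.one = undefined,
      ring.zero = (\<lambda>b. \<zero>\<^bsub>N\<^esub>),
      ring.add = (\<lambda>v w b. v b \<oplus>\<^bsub>N\<^esub> w b),
      smult = (\<lambda>a v b. a \<odot>\<^bsub>N\<^esub> v b)\<rparr>"

lemma power_module_simps:
  "carrier (power_module N B) = {v. (\<forall>b. v b \<in> carrier N) \<and> (\<forall>b. b \<notin> B \<longrightarrow> v b = \<zero>\<^bsub>N\<^esub>)}"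
  "\<zero>\<^bsub>power_module N B\<^esub> = (\<lambda>b. \<zero>\<^bsub>N\<^esub>)"
  "v \<oplus>\<^bsub>power_module N B\<^esub> w = (\<lambda>b. v b \<oplus>\<^bsub>N\<^esub> w b)"
  "a \<odot>\<^bsub>power_module N B\<^esub> v = (\<lambda>b. a \<odot>\<^bsub>N\<^esub> v b)"
  by (simp_all add: power_module_def)

lemma power_module_module:
  assumes "module R N" shows "module R (power_module N B)"
proof -
  interpret module R N by fact
  have "\<exists>y\<in>carrier (power_module N B). y \<oplus>\<^bsub>power_module N B\<^esub> x = \<zero>\<^bsub>power_module N B\<^esub>"
    if "x \<in> carrier (power_module N B)" for x
    using that by (intro bexI[of _ "\<lambda>b. \<ominus>\<^bsub>N\<^esub> x b"]) (auto simp: power_module_def M.l_neg)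
  thus ?thesis
    by (intro moduleI abelian_groupI R.is_cring)
      (auto simp: power_module_def M.a_ac smult_l_distr smult_r_distr smult_assoc1)
qed

lemma weakly_laskerian_power_module:
  assumes "weakly_laskerian R N" "finite B"
  shows "weakly_laskerian R (power_module N B)"
  using assms(2)
proof (induction B)
  case empty
  have N: "module R N" using assms by (simp add: weakly_laskerian_def)
  then interpret module R N .
  show ?case
  proof (rule weakly_laskerian_linear_relation[OF assms(1) power_module_module[OF N],
      where \<Phi> = "\<lambda>v x. v = \<zero>\<^bsub>N\<^esub> \<and> x = (\<lambda>b. \<zero>\<^bsub>N\<^esub>)"])
  qed (auto simp: power_module_def)
next
  case (insert b B)
  have N: "module R N" using assms by (simp add: weakly_laskerian_def)
  have lin: "linear_map R (power_module N (insert b B)) N (\<lambda>v. v b)"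
    by (rule linear_mapI) (auto simp: power_module_def)
  have "(power_module N (insert b B))\<lparr>carrier := {v \<in> carrier (power_module N (insert b B)). v b = \<zero>\<^bsub>N\<^esub>}\<rparr>
      = power_module N B"
    using insert(2) by (auto simp: power_module_def)
  thus ?case
    using weakly_laskerian_extension[OF power_module_module[OF N] assms(1) lin] insert by simp
qed

section \<open>Free modules and modules of linear maps\<close>

lemma free_module_simps:
  "carrier (free_module R C) = {f. (\<forall>b. f b \<in> carrier R) \<and> (\<forall>b. b \<notin> C \<longrightarrow> f b = \<zero>\<^bsub>R\<^esub>) \<and>
                    finite {b. f b \<noteq> \<zero>\<^bsub>R\<^esub>}}"
  "\<zero>\<^bsub>free_module R C\<^esub> = (\<lambda>b. \<zero>\<^bsub>R\<^esub>)"
  "f \<oplus>\<^bsub>free_module R C\<^esub> g = (\<lambda>b. f b \<oplus>\<^bsub>R\<^esub> g b)"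
  "a \<odot>\<^bsub>free_module R C\<^esub> f = (\<lambda>b. a \<otimes>\<^bsub>R\<^esub> f b)"
  by (simp_all add: free_module_def)

lemma free_module_module:
  assumes "cring R" shows "module R (free_module R C)"
proof -
  interpret cring R by fact
  have fin_add: "finite {b. f b \<oplus>\<^bsub>R\<^esub> g b \<noteq> \<zero>\<^bsub>R\<^esub>}"
    if "finite {b. f b \<noteq> \<zero>\<^bsub>R\<^esub>}" "finite {b. g b \<noteq> \<zero>\<^bsub>R\<^esub>}" for f g :: "_ \<Rightarrow> 'a"
    by (rule finite_subset[OF _ finite_UnI[OF that]]) auto
  have fin_smult: "finite {b. a \<otimes>\<^bsub>R\<^esub> f b \<noteq> \<zero>\<^bsub>R\<^esub>}"
    if "finite {b. f b \<noteq> \<zero>\<^bsub>R\<^esub>}" "a \<in> carrier R" for f :: "_ \<Rightarrow> 'a" and a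
    by (rule finite_subset[OF _ that(1)]) (use that in auto)
  have "\<exists>y\<in>carrier (free_module R C). y \<oplus>\<^bsub>free_module R C\<^esub> x = \<zero>\<^bsub>free_module R C\<^esub>"
    if x: "x \<in> carrier (free_module R C)" for x
    using that fin_smult[of x "\<ominus>\<^bsub>R\<^esub> \<one>\<^bsub>R\<^esub>"]
    by (intro bexI[of _ "\<lambda>b. (\<ominus>\<^bsub>R\<^esub> \<one>\<^bsub>R\<^esub>) \<otimes>\<^bsub>R\<^esub> x b"]) (auto simp: free_module_simps l_minus l_neg)
  thus ?thesis
    by (intro moduleI abelian_groupI assms)
      (auto simp: free_module_simps a_ac l_distr r_distr m_assoc fin_add fin_smult)
qed

lemma basis_vec_carrier:
  assumes "cring R" "c \<in> C"
  shows "basis_vec R c \<in> carrier (free_module R C)"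
proof -
  interpret cring R by fact
  have "finite {b. basis_vec R c b \<noteq> \<zero>\<^bsub>R\<^esub>}"
    by (rule finite_subset[of _ "{c}"]) (auto simp: basis_vec_def)
  thus ?thesis using assms by (auto simp: free_module_simps basis_vec_def)
qed

lemma free_module_submodule:
  assumes "cring R" "submodule U R (free_module R C)" "C \<subseteq> D"
  shows "submodule U R (free_module R D)"
proof -
  note s = submodule_simps[OF free_module_module[OF assms(1)] assms(2)]
  have "carrier (free_module R C) \<subseteq> carrier (free_module R D)"
    using assms(3) by (auto simp: free_module_simps)
  hence "U \<subseteq> carrier (free_module R D)" using s(1) by blast
  thus ?thesis
    by (rule submoduleI'[OF free_module_module[OF assms(1)]])
      (use s(2,4,5) in \<open>auto simp: free_module_simps\<close>)
qed

text \<open>Induction on the support of \<open>f\<close>. Equalizers and preimages of submodules under linear maps are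
  submodules, so statements about linear maps on a free module have to be checked on the basis only.\<close>

lemma free_module_induct:
  assumes "cring R" "submodule U R (free_module R C)" "\<And>c. c \<in> C \<Longrightarrow> basis_vec R c \<in> U"
    and "f \<in> carrier (free_module R C)"
  shows "f \<in> U"
proof -
  interpret cring R by fact
  note s = submodule_simps[OF free_module_module[OF assms(1)] assms(2)]
  have "\<forall>f\<in>carrier (free_module R C). {b. f b \<noteq> \<zero>\<^bsub>R\<^esub>} \<subseteq> D \<longrightarrow> f \<in> U"
    if "finite D" "D \<subseteq> C" for D
    using that
  proof (induction D)
    case empty
    show ?case
    proof (intro ballI impI)
      fix f assume "f \<in> carrier (free_module R C)" "{b. f b \<noteq> \<zero>\<^bsub>R\<^esub>} \<subseteq> {}"
      hence "f = (\<lambda>b. \<zero>\<^bsub>R\<^esub>)" by auto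
      thus "f \<in> U" using s(2) by (simp add: free_module_simps)
    qed
  next
    case (insert d D)
    show ?case
    proof (intro ballI impI)
      fix f assume f: "f \<in> carrier (free_module R C)" "{b. f b \<noteq> \<zero>\<^bsub>R\<^esub>} \<subseteq> insert d D"
      let ?g = "f(d := \<zero>\<^bsub>R\<^esub>)"
      have "finite {b. ?g b \<noteq> \<zero>\<^bsub>R\<^esub>}"
        by (rule finite_subset[of _ "{b. f b \<noteq> \<zero>\<^bsub>R\<^esub>}"]) (use f in \<open>auto simp: free_module_simps\<close>)
      hence "?g \<in> carrier (free_module R C)" using f by (auto simp: free_module_simps)
      moreover have "{b. ?g b \<noteq> \<zero>\<^bsub>R\<^esub>} \<subseteq> D" using f by auto
      ultimately have g: "?g \<in> U" using insert by auto
      have "f d \<odot>\<^bsub>free_module R C\<^esub> basis_vec R d \<in> U"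
        using insert f assms(3) by (intro s(5)) (auto simp: free_module_simps)
      hence "?g \<oplus>\<^bsub>free_module R C\<^esub> f d \<odot>\<^bsub>free_module R C\<^esub> basis_vec R d \<in> U" by (rule s(4)[OF g])
      also have "?g \<oplus>\<^bsub>free_module R C\<^esub> f d \<odot>\<^bsub>free_module R C\<^esub> basis_vec R d = f"
        using f by (auto simp: free_module_simps basis_vec_def)
      finally show "f \<in> U" .
    qed
  qed
  from this[of "{b. f b \<noteq> \<zero>\<^bsub>R\<^esub>}"] show ?thesis using assms(4) by (auto simp: free_module_simps)
qed

lemma linear_map_free_range:
  assumes "cring R" "module R A" "linear_map R (free_module R C) A h" "submodule U R A"
    and "\<And>c. c \<in> C \<Longrightarrow> h (basis_vec R c) \<in> U"
    and "f \<in> carrier (free_module R C)"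
  shows "h f \<in> U"
proof -
  have "f \<in> {x \<in> carrier (free_module R C). h x \<in> U}"
    by (rule free_module_induct[OF assms(1)
          preimage_submodule[OF free_module_module[OF assms(1)] assms(2-4)] _ assms(6)])
      (simp add: assms(5) basis_vec_carrier[OF assms(1)])
  thus ?thesis by simp
qed

lemma linear_map_free_eq:
  assumes "cring R" "module R A" "linear_map R (free_module R C) A g" "linear_map R (free_module R C) A h"
    and "\<And>c. c \<in> C \<Longrightarrow> g (basis_vec R c) = h (basis_vec R c)"
    and "f \<in> carrier (free_module R C)"
  shows "g f = h f"
proof -
  have "f \<in> {x \<in> carrier (free_module R C). g x = h x}"
    by (rule free_module_induct[OF assms(1)
          equalizer_submodule[OF free_module_module[OF assms(1)] assms(2-4)] _ assms(6)])
      (simp add: assms(5) basis_vec_carrier[OF assms(1)])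
  thus ?thesis by simp
qed

text \<open>The sum that defines \<^const>\<open>lin_ext\<close> runs over the support of its argument. Sums over larger finite
  sets are needed to compare it for arguments with different supports.\<close>

lemma lin_ext_finsum:
  assumes "module R A" "inj_on \<iota> S" "\<phi> \<in> S \<rightarrow> carrier A"
    and "f \<in> carrier (free_module R (\<iota> ` S))" "finite D" "D \<subseteq> S" "{s \<in> S. f (\<iota> s) \<noteq> \<zero>\<^bsub>R\<^esub>} \<subseteq> D"
  shows "lin_ext R A S \<iota> \<phi> f = (\<Oplus>\<^bsub>A\<^esub>s\<in>D. f (\<iota> s) \<odot>\<^bsub>A\<^esub> \<phi> s)"
proof -
  interpret module R A by fact
  have z: "f (\<iota> s) \<odot>\<^bsub>A\<^esub> \<phi> s = \<zero>\<^bsub>A\<^esub>" if "s \<in> D - {s \<in> S. f (\<iota> s) \<noteq> \<zero>\<^bsub>R\<^esub>}" for s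
    using that Pi_mem[OF assms(3)] assms(6) by force
  have c: "(\<lambda>s. f (\<iota> s) \<odot>\<^bsub>A\<^esub> \<phi> s) \<in> D \<rightarrow> carrier A"
  proof
    fix s assume "s \<in> D"
    hence "\<phi> s \<in> carrier A" using Pi_mem[OF assms(3)] assms(6) by blast
    moreover have "f (\<iota> s) \<in> carrier R" using assms(4) by (simp add: free_module_simps)
    ultimately show "f (\<iota> s) \<odot>\<^bsub>A\<^esub> \<phi> s \<in> carrier A" by simp
  qed
  show ?thesis unfolding lin_ext_def
    by (rule M.add.finprod_mono_neutral_cong_left[OF assms(5,7) z refl c])
qed

lemma finite_support:
  assumes "inj_on \<iota> S" "f \<in> carrier (free_module R C)"
  shows "finite {s \<in> S. f (\<iota> s) \<noteq> \<zero>\<^bsub>R\<^esub>}"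
proof -
  have "finite (\<iota> -` {b. f b \<noteq> \<zero>\<^bsub>R\<^esub>} \<inter> S)"
    using assms by (intro finite_vimage_IntI) (auto simp: free_module_simps)
  thus ?thesis by (rule rev_finite_subset) auto
qed

lemma linear_map_lin_ext:
  assumes "module R A" "inj_on \<iota> S" "\<phi> \<in> S \<rightarrow> carrier A"
  shows "linear_map R (free_module R (\<iota> ` S)) A (lin_ext R A S \<iota> \<phi>)"
proof -
  interpret module R A by fact
  interpret F: module R "free_module R (\<iota> ` S)" by (rule free_module_module) (rule R.is_cring)
  let ?supp = "\<lambda>f. {s \<in> S. f (\<iota> s) \<noteq> \<zero>\<^bsub>R\<^esub>}"
  note L = lin_ext_finsum[OF assms]
  note fs = finite_support[OF assms(2)]
  have pc: "\<phi> s \<in> carrier A" if "s \<in> S" for s using assms(3) that by auto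
  show ?thesis
  proof (rule linear_mapI)
    fix f assume f: "f \<in> carrier (free_module R (\<iota> ` S))"
    show "lin_ext R A S \<iota> \<phi> f \<in> carrier A"
      unfolding lin_ext_def using f assms(3) by (intro M.finsum_closed) (auto simp: free_module_simps)
  next
    fix f g assume f: "f \<in> carrier (free_module R (\<iota> ` S))" and g: "g \<in> carrier (free_module R (\<iota> ` S))"
    let ?D = "?supp f \<union> ?supp g"
    have D: "finite ?D" "?D \<subseteq> S" using fs f g by auto
    have cl: "f b \<in> carrier R" "g b \<in> carrier R" for b using f g by (auto simp: free_module_simps)
    have "lin_ext R A S \<iota> \<phi> (f \<oplus>\<^bsub>free_module R (\<iota> ` S)\<^esub> g)
       = (\<Oplus>\<^bsub>A\<^esub>s\<in>?D. (f (\<iota> s) \<oplus>\<^bsub>R\<^esub> g (\<iota> s)) \<odot>\<^bsub>A\<^esub> \<phi> s)"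
      by (subst L[OF F.M.a_closed[OF f g] D]) (auto simp: free_module_simps)
    also have "\<dots> = (\<Oplus>\<^bsub>A\<^esub>s\<in>?D. f (\<iota> s) \<odot>\<^bsub>A\<^esub> \<phi> s \<oplus>\<^bsub>A\<^esub> g (\<iota> s) \<odot>\<^bsub>A\<^esub> \<phi> s)"
      using cl pc D by (intro M.finsum_cong') (auto simp: smult_l_distr)
    also have "\<dots> = (\<Oplus>\<^bsub>A\<^esub>s\<in>?D. f (\<iota> s) \<odot>\<^bsub>A\<^esub> \<phi> s) \<oplus>\<^bsub>A\<^esub> (\<Oplus>\<^bsub>A\<^esub>s\<in>?D. g (\<iota> s) \<odot>\<^bsub>A\<^esub> \<phi> s)"
      using cl pc D by (intro M.finsum_addf) auto
    also have "\<dots> = lin_ext R A S \<iota> \<phi> f \<oplus>\<^bsub>A\<^esub> lin_ext R A S \<iota> \<phi> g"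
      using L[OF f D] L[OF g D] by auto
    finally show "lin_ext R A S \<iota> \<phi> (f \<oplus>\<^bsub>free_module R (\<iota> ` S)\<^esub> g) =
      lin_ext R A S \<iota> \<phi> f \<oplus>\<^bsub>A\<^esub> lin_ext R A S \<iota> \<phi> g" .
  next
    fix a f assume a: "a \<in> carrier R" and f: "f \<in> carrier (free_module R (\<iota> ` S))"
    have D: "finite (?supp f)" "?supp f \<subseteq> S" using fs f by auto
    have cl: "f b \<in> carrier R" for b using f by (auto simp: free_module_simps)
    have "lin_ext R A S \<iota> \<phi> (a \<odot>\<^bsub>free_module R (\<iota> ` S)\<^esub> f)
       = (\<Oplus>\<^bsub>A\<^esub>s\<in>?supp f. (a \<otimes>\<^bsub>R\<^esub> f (\<iota> s)) \<odot>\<^bsub>A\<^esub> \<phi> s)"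
      by (subst L[OF F.smult_closed[OF a f] D]) (use a in \<open>auto simp: free_module_simps\<close>)
    also have "\<dots> = (\<Oplus>\<^bsub>A\<^esub>s\<in>?supp f. a \<odot>\<^bsub>A\<^esub> (f (\<iota> s) \<odot>\<^bsub>A\<^esub> \<phi> s))"
      using cl pc D a by (intro M.finsum_cong') (auto simp: smult_assoc1)
    also have "\<dots> = a \<odot>\<^bsub>A\<^esub> (\<Oplus>\<^bsub>A\<^esub>s\<in>?supp f. f (\<iota> s) \<odot>\<^bsub>A\<^esub> \<phi> s)"
      using cl pc D a by (intro finsum_smult_ldistr[symmetric]) auto
    finally show "lin_ext R A S \<iota> \<phi> (a \<odot>\<^bsub>free_module R (\<iota> ` S)\<^esub> f) = a \<odot>\<^bsub>A\<^esub> lin_ext R A S \<iota> \<phi> f"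
      using L[OF f D] by simp
  qed
qed

lemma lin_ext_basis:
  assumes "module R A" "inj_on \<iota> S" "\<phi> \<in> S \<rightarrow> carrier A" "s \<in> S"
  shows "lin_ext R A S \<iota> \<phi> (basis_vec R (\<iota> s)) = \<phi> s"
proof -
  interpret module R A by fact
  have "lin_ext R A S \<iota> \<phi> (basis_vec R (\<iota> s)) = (\<Oplus>\<^bsub>A\<^esub>t\<in>{s}. basis_vec R (\<iota> s) (\<iota> t) \<odot>\<^bsub>A\<^esub> \<phi> t)"
  proof (rule lin_ext_finsum[OF assms(1-3)])
    show "basis_vec R (\<iota> s) \<in> carrier (free_module R (\<iota> ` S))"
      using assms(4) by (intro basis_vec_carrier R.is_cring) auto
    show "{t \<in> S. basis_vec R (\<iota> s) (\<iota> t) \<noteq> \<zero>\<^bsub>R\<^esub>} \<subseteq> {s}"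
      using inj_onD[OF assms(2)] assms(4) by (auto simp: basis_vec_def split: if_splits)
  qed (use assms(4) in auto)
  also have "\<dots> = basis_vec R (\<iota> s) (\<iota> s) \<odot>\<^bsub>A\<^esub> \<phi> s"
    using Pi_mem[OF assms(3,4)] by (subst M.finsum_insert) (simp_all add: basis_vec_def)
  also have "\<dots> = \<phi> s" using Pi_mem[OF assms(3,4)] by (simp add: basis_vec_def)
  finally show ?thesis .
qed

lemma hom_module_carrier:
  "\<phi> \<in> carrier (hom_module R A B) \<longleftrightarrow> \<phi> \<in> extensional (carrier A) \<and> linear_map R A B \<phi>"
  by (auto simp: hom_module_def linear_map_def PiE_def)

lemma hom_module_simps:
  "\<zero>\<^bsub>hom_module R A B\<^esub> = (\<lambda>x\<in>carrier A. \<zero>\<^bsub>B\<^esub>)"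
  "f \<oplus>\<^bsub>hom_module R A B\<^esub> g = (\<lambda>x\<in>carrier A. f x \<oplus>\<^bsub>B\<^esub> g x)"
  "a \<odot>\<^bsub>hom_module R A B\<^esub> f = (\<lambda>x\<in>carrier A. a \<odot>\<^bsub>B\<^esub> f x)"
  by (simp_all add: hom_module_def)

lemma hom_module_module:
  assumes "module R A" "module R B"
  shows "module R (hom_module R A B)"
proof -
  interpret A: module R A by fact
  interpret B: module R B by fact
  let ?H = "hom_module R A B"
  note D = hom_module_carrier hom_module_simps
  have v: "f x \<in> carrier B" if "f \<in> carrier ?H" "x \<in> carrier A" for f x
    using that linear_mapD(1) by (auto simp: hom_module_carrier)
  have ext: "f = g" if "f \<in> extensional (carrier A)" "g \<in> extensional (carrier A)"
    "\<And>x. x \<in> carrier A \<Longrightarrow> f x = g x" for f g by (rule extensionalityI[OF that])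
  have e: "f \<in> extensional (carrier A)" if "f \<in> carrier ?H" for f using that by (simp add: hom_module_carrier)
  have l: "linear_map R A B f" if "f \<in> carrier ?H" for f using that by (simp add: hom_module_carrier)
  have cl: "f \<oplus>\<^bsub>?H\<^esub> g \<in> carrier ?H" if "f \<in> carrier ?H" "g \<in> carrier ?H" for f g
    unfolding hom_module_carrier hom_module_simps
    by (simp add: linear_map_restrict[OF assms(1)] linear_map_pointwise(2)[OF assms(2,1) l l] that)
  have cs: "a \<odot>\<^bsub>?H\<^esub> f \<in> carrier ?H" if "f \<in> carrier ?H" "a \<in> carrier R" for f a
    unfolding hom_module_carrier hom_module_simps
    by (simp add: linear_map_restrict[OF assms(1)] linear_map_pointwise(3)[OF assms(2,1) l] that)
  have cz: "\<zero>\<^bsub>?H\<^esub> \<in> carrier ?H"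
    unfolding hom_module_carrier hom_module_simps
    by (simp add: linear_map_restrict[OF assms(1)] linear_map_pointwise(1)[OF assms(2,1)])
  have inv: "\<exists>y\<in>carrier ?H. y \<oplus>\<^bsub>?H\<^esub> x = \<zero>\<^bsub>?H\<^esub>" if x: "x \<in> carrier ?H" for x
  proof (rule bexI[OF _ cs[OF x, of "\<ominus>\<^bsub>R\<^esub> \<one>\<^bsub>R\<^esub>"]])
    show "(\<ominus>\<^bsub>R\<^esub> \<one>\<^bsub>R\<^esub>) \<odot>\<^bsub>?H\<^esub> x \<oplus>\<^bsub>?H\<^esub> x = \<zero>\<^bsub>?H\<^esub>"
      unfolding hom_module_simps
      by (rule ext) (simp_all add: v[OF x] module_neg_smult[OF assms(2), symmetric] B.M.l_neg)
  qed simp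
  show ?thesis
  proof (intro moduleI abelian_groupI A.R.is_cring)
    show "\<zero>\<^bsub>?H\<^esub> \<in> carrier ?H" by (rule cz)
  next
    fix f g h assume f: "f \<in> carrier ?H" and g: "g \<in> carrier ?H"
    show "f \<oplus>\<^bsub>?H\<^esub> g = g \<oplus>\<^bsub>?H\<^esub> f" unfolding hom_module_simps
      by (rule ext) (simp_all add: v[OF f] v[OF g] B.M.a_comm)
    assume h: "h \<in> carrier ?H"
    show "(f \<oplus>\<^bsub>?H\<^esub> g) \<oplus>\<^bsub>?H\<^esub> h = f \<oplus>\<^bsub>?H\<^esub> (g \<oplus>\<^bsub>?H\<^esub> h)" unfolding hom_module_simps
      by (rule ext) (simp_all add: v[OF f] v[OF g] v[OF h] B.M.a_assoc)
  next
    fix f assume f: "f \<in> carrier ?H"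
    show "\<zero>\<^bsub>?H\<^esub> \<oplus>\<^bsub>?H\<^esub> f = f" unfolding hom_module_simps
      by (rule ext) (simp_all add: v[OF f] e[OF f])
    show "\<one>\<^bsub>R\<^esub> \<odot>\<^bsub>?H\<^esub> f = f" unfolding hom_module_simps
      by (rule ext) (simp_all add: v[OF f] e[OF f])
  next
    fix a b f g assume a: "a \<in> carrier R" and f: "f \<in> carrier ?H"
    show "a \<odot>\<^bsub>?H\<^esub> (f \<oplus>\<^bsub>?H\<^esub> g) = a \<odot>\<^bsub>?H\<^esub> f \<oplus>\<^bsub>?H\<^esub> a \<odot>\<^bsub>?H\<^esub> g" if g: "g \<in> carrier ?H"
      unfolding hom_module_simps
      by (rule ext) (simp_all add: v[OF f] v[OF g] a B.smult_r_distr)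
    assume b: "b \<in> carrier R"
    show "(a \<oplus>\<^bsub>R\<^esub> b) \<odot>\<^bsub>?H\<^esub> f = a \<odot>\<^bsub>?H\<^esub> f \<oplus>\<^bsub>?H\<^esub> b \<odot>\<^bsub>?H\<^esub> f" unfolding hom_module_simps
      by (rule ext) (simp_all add: v[OF f] a b B.smult_l_distr)
    show "(a \<otimes>\<^bsub>R\<^esub> b) \<odot>\<^bsub>?H\<^esub> f = a \<odot>\<^bsub>?H\<^esub> (b \<odot>\<^bsub>?H\<^esub> f)" unfolding hom_module_simps
      by (rule ext) (simp_all add: v[OF f] a b B.smult_assoc1)
  qed (use cl cs inv in auto)
qed

lemma hom_module_precomp:
  assumes "module R A" "module R A'" "module R B" "linear_map R A A' h"
  shows "linear_map R (hom_module R A' B) (hom_module R A B) (\<lambda>\<phi>. compose (carrier A) \<phi> h)"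
proof -
  interpret A: module R A by fact
  interpret A': module R A' by fact
  interpret B: module R B by fact
  note h = linear_mapD[OF assms(4)]
  show ?thesis
  proof (rule linear_mapI)
    fix \<phi> assume p: "\<phi> \<in> carrier (hom_module R A' B)"
    hence "linear_map R A B (\<lambda>x. \<phi> (h x))" using linear_map_comp[OF assms(4), of B \<phi>] by (simp add: hom_module_carrier)
    thus "compose (carrier A) \<phi> h \<in> carrier (hom_module R A B)"
      unfolding hom_module_carrier compose_def using linear_map_restrict[OF assms(1)] by auto
  qed (auto simp: hom_module_simps compose_def h)
qed

section \<open>The standard free resolution\<close>

text \<open>A function is determined by its graph on its support, and the support is finite here, so that
  \<^const>\<open>Abs_fset\<close> loses nothing.\<close>

lemma inj_on_cyc: "inj_on (cyc R) (carrier (free_module R C))"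
proof (rule inj_onI)
  fix f g assume f: "f \<in> carrier (free_module R C)" and g: "g \<in> carrier (free_module R C)"
    and eq: "cyc R f = cyc R g"
  have fin: "finite {(c, f c) | c. f c \<noteq> \<zero>\<^bsub>R\<^esub>}" if "f \<in> carrier (free_module R C)" for f
  proof -
    have "{(c, f c) | c. f c \<noteq> \<zero>\<^bsub>R\<^esub>} = (\<lambda>c. (c, f c)) ` {c. f c \<noteq> \<zero>\<^bsub>R\<^esub>}" by auto
    thus ?thesis using that by (simp add: free_module_simps)
  qed
  have "{(c, f c) | c. f c \<noteq> \<zero>\<^bsub>R\<^esub>} = {(c, g c) | c. g c \<noteq> \<zero>\<^bsub>R\<^esub>}"
    using eq fin[OF f] fin[OF g] by (simp add: cyc_def Abs_fset_inject)
  hence *: "(c, x) \<in> {(c, f c) | c. f c \<noteq> \<zero>\<^bsub>R\<^esub>} \<longleftrightarrow> (c, x) \<in> {(c, g c) | c. g c \<noteq> \<zero>\<^bsub>R\<^esub>}" for c x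
    by simp
  show "f = g"
  proof
    fix c show "f c = g c" using *[of c "f c"] *[of c "g c"] by (cases "f c = \<zero>\<^bsub>R\<^esub>"; cases "g c = \<zero>\<^bsub>R\<^esub>") auto
  qed
qed

lemma inj_on_Gen: "inj_on Gen S" by (auto simp: inj_on_def)

lemma std_res_simps:
  "std_res R X 0 = free_module R (Gen ` carrier X)"
  "std_res R X (Suc i) = free_module R (cyc R ` std_cycles R X i)"
  by (simp_all add: std_res_def)

lemma std_res_module: "cring R \<Longrightarrow> module R (std_res R X i)"
  by (simp add: std_res_def free_module_module)

lemma basis_vec_std_res:
  assumes "cring R"
  shows "x \<in> carrier X \<Longrightarrow> basis_vec R (Gen x) \<in> carrier (std_res R X 0)"
    and "z \<in> std_cycles R X i \<Longrightarrow> basis_vec R (cyc R z) \<in> carrier (std_res R X (Suc i))"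
  unfolding std_res_simps by (auto intro: basis_vec_carrier[OF assms])

text \<open>All maps of the resolution are linear extensions formed in the free module on all cells.
  They take values in the free submodule on the cells of the right degree, because their values
  on basis vectors do.\<close>

lemma lin_ext_std_res:
  fixes \<phi> :: "'s \<Rightarrow> ('a, 'y) cell \<Rightarrow> 'a"
  assumes R: "cring R" and inj: "inj_on \<iota> S" and P: "\<phi> \<in> S \<rightarrow> carrier (std_res R Y j)"
  shows "linear_map R (free_module R (\<iota> ` S)) (std_res R Y j) (lin_ext R (free_module R UNIV) S \<iota> \<phi>)"
    and "s \<in> S \<Longrightarrow> lin_ext R (free_module R UNIV) S \<iota> \<phi> (basis_vec R (\<iota> s)) = \<phi> s"
proof -
  let ?U = "free_module R (UNIV :: ('a, 'y) cell set)"
  let ?h = "lin_ext R ?U S \<iota> \<phi>"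
  have sub: "submodule (carrier (std_res R Y j)) R ?U"
    unfolding std_res_def
    by (rule free_module_submodule[OF R module.carrier_is_submodule[OF free_module_module[OF R]] subset_UNIV])
  note U = free_module_module[OF R, of UNIV]
  have P': "\<phi> \<in> S \<rightarrow> carrier ?U"
    using P submodule_simps(3)[OF U sub] by blast
  have basis: "?h (basis_vec R (\<iota> s)) = \<phi> s" if "s \<in> S" for s
    by (rule lin_ext_basis[OF U inj P' that])
  thus "s \<in> S \<Longrightarrow> ?h (basis_vec R (\<iota> s)) = \<phi> s" .
  have lin: "linear_map R (free_module R (\<iota> ` S)) ?U ?h" by (rule linear_map_lin_ext[OF U inj P'])
  have "?h f \<in> carrier (std_res R Y j)" if "f \<in> carrier (free_module R (\<iota> ` S))" for f
    by (rule linear_map_free_range[OF R U lin sub _ that]) (use basis P in auto)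
  thus "linear_map R (free_module R (\<iota> ` S)) (std_res R Y j) ?h"
    using lin by (auto simp: linear_map_def std_res_def free_module_def)
qed

text \<open>The augmentation of the resolution, from its degree \<open>0\<close> to the resolved module.\<close>

definition std_aug :: "('a, 'r) ring_scheme \<Rightarrow> ('a, 'x) module \<Rightarrow> (('a, 'x) cell \<Rightarrow> 'a) \<Rightarrow> 'x" where
  "std_aug R X = lin_ext R X (carrier X) Gen (\<lambda>x. x)"

lemma std_aug_linear:
  assumes "module R X" shows "linear_map R (std_res R X 0) X (std_aug R X)"
  unfolding std_res_simps std_aug_def by (rule linear_map_lin_ext[OF assms inj_on_Gen]) simp

lemma std_aug_basis:
  assumes "module R X" "x \<in> carrier X"
  shows "std_aug R X (basis_vec R (Gen x)) = x"
  unfolding std_aug_def by (rule lin_ext_basis[OF assms(1) inj_on_Gen _ assms(2)]) simp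

text \<open>Exactness of the resolution is built into the definition of the cycles: the basis of each
  degree is the set of cycles of the degree below.\<close>

lemma std_cycles_eq:
  "std_cycles R X 0 = {f \<in> carrier (std_res R X 0). std_aug R X f = \<zero>\<^bsub>X\<^esub>}"
  "std_cycles R X (Suc i) = {f \<in> carrier (std_res R X (Suc i)). std_bd R X i f = \<zero>\<^bsub>std_res R X i\<^esub>}"
  by (simp_all add: std_res_simps(1) std_aug_def, simp add: std_res_def std_bd_def free_module_simps)

declare std_map.simps [simp del] std_cycles.simps [simp del]

lemma std_cycles_res: "(\<lambda>z. z) \<in> std_cycles R X i \<rightarrow> carrier (std_res R X i)"
  by (cases i) (auto simp: std_cycles_eq)

lemma inj_on_cyc_cycles: "inj_on (cyc R) (std_cycles R X i)"
proof (rule inj_on_subset[OF inj_on_cyc[of R UNIV]])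
  have "carrier (std_res R X i) \<subseteq> carrier (free_module R UNIV)"
    by (auto simp: std_res_def free_module_simps)
  thus "std_cycles R X i \<subseteq> carrier (free_module R UNIV)" using std_cycles_res by blast
qed

lemma std_bd_linear:
  assumes "cring R"
  shows "linear_map R (std_res R X (Suc i)) (std_res R X i) (std_bd R X i)"
  unfolding std_res_simps std_bd_def by (rule lin_ext_std_res(1)[OF assms inj_on_cyc_cycles std_cycles_res])

lemma std_bd_basis:
  assumes "cring R" "z \<in> std_cycles R X i"
  shows "std_bd R X i (basis_vec R (cyc R z)) = z"
  unfolding std_bd_def by (rule lin_ext_std_res(2)[OF assms(1) inj_on_cyc_cycles std_cycles_res assms(2)])

lemma std_cycles_submodule:
  assumes "module R X"
  shows "submodule (std_cycles R X i) R (std_res R X i)"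
proof -
  note R = module.axioms(1)[OF assms]
  show ?thesis
    using kernel_submodule[OF std_res_module[OF R] assms std_aug_linear[OF assms]]
      kernel_submodule[OF std_res_module[OF R] std_res_module[OF R] std_bd_linear[OF R]]
    by (cases i) (simp_all add: std_cycles_eq)
qed

lemma std_bd_cycles:
  assumes "module R X" "f \<in> carrier (std_res R X (Suc i))"
  shows "std_bd R X i f \<in> std_cycles R X i"
proof -
  note R = module.axioms(1)[OF assms(1)]
  show ?thesis
    by (rule linear_map_free_range[OF R std_res_module[OF R] std_bd_linear[OF R, unfolded std_res_simps]
          std_cycles_submodule[OF assms(1)] _ assms(2)[unfolded std_res_simps]])
      (auto simp: std_bd_basis[OF R])
qed

lemma std_map_0_linear:
  fixes R :: "('a, 'r) ring_scheme" and X :: "('a, 'b) module" and Y :: "('a, 'c) module"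
  assumes X: "module R X" and Y: "module R Y" and h: "linear_map R X Y h"
  shows "linear_map R (std_res R X 0) (std_res R Y 0) (std_map R X h 0)"
    and "x \<in> carrier X \<Longrightarrow> std_map R X h 0 (basis_vec R (Gen x)) = basis_vec R (Gen (h x))"
    and "f \<in> carrier (std_res R X 0) \<Longrightarrow> std_aug R Y (std_map R X h 0 f) = h (std_aug R X f)"
proof -
  note R = module.axioms(1)[OF X]
  have P: "(\<lambda>x. basis_vec R (Gen (h x))) \<in> carrier X \<rightarrow> carrier (std_res R Y 0)"
    by (intro Pi_I basis_vec_std_res(1)[OF R] linear_mapD(1)[OF h])
  have b: "std_map R X h 0 (basis_vec R (Gen x)) = basis_vec R (Gen (h x))" if "x \<in> carrier X" for x
    unfolding std_map.simps by (rule lin_ext_std_res(2)[OF R inj_on_Gen P that])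
  thus "x \<in> carrier X \<Longrightarrow> std_map R X h 0 (basis_vec R (Gen x)) = basis_vec R (Gen (h x))" .
  show L: "linear_map R (std_res R X 0) (std_res R Y 0) (std_map R X h 0)"
    unfolding std_map.simps std_res_simps(1)[of R X] by (rule lin_ext_std_res(1)[OF R inj_on_Gen P])
  assume f: "f \<in> carrier (std_res R X 0)"
  show "std_aug R Y (std_map R X h 0 f) = h (std_aug R X f)"
  proof (rule linear_map_free_eq[OF R Y _ _ _ f[unfolded std_res_simps]])
    show "linear_map R (free_module R (Gen ` carrier X)) Y (\<lambda>f. std_aug R Y (std_map R X h 0 f))"
      using linear_map_comp[OF L std_aug_linear[OF Y]] unfolding std_res_simps .
    show "linear_map R (free_module R (Gen ` carrier X)) Y (\<lambda>f. h (std_aug R X f))"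
      using linear_map_comp[OF std_aug_linear[OF X] h] unfolding std_res_simps .
    fix c assume "c \<in> (Gen :: _ \<Rightarrow> ('a, 'b) cell) ` carrier X"
    then obtain x where x: "x \<in> carrier X" "c = Gen x" by auto
    show "std_aug R Y (std_map R X h 0 (basis_vec R c)) = h (std_aug R X (basis_vec R c))"
      using x linear_mapD(1)[OF h] by (simp only: b std_aug_basis[OF X] std_aug_basis[OF Y])
  qed
qed

lemma std_map_Suc_linear:
  assumes X: "module R X" and Y: "module R Y"
    and L: "linear_map R (std_res R X i) (std_res R Y i) (std_map R X h i)"
    and Z: "\<And>z. z \<in> std_cycles R X i \<Longrightarrow> std_map R X h i z \<in> std_cycles R Y i"
  shows "linear_map R (std_res R X (Suc i)) (std_res R Y (Suc i)) (std_map R X h (Suc i))"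
    and "z \<in> std_cycles R X i \<Longrightarrow>
      std_map R X h (Suc i) (basis_vec R (cyc R z)) = basis_vec R (cyc R (std_map R X h i z))"
    and "f \<in> carrier (std_res R X (Suc i)) \<Longrightarrow>
      std_bd R Y i (std_map R X h (Suc i) f) = std_map R X h i (std_bd R X i f)"
proof -
  note R = module.axioms(1)[OF X]
  let ?b = "\<lambda>z. basis_vec R (cyc R (std_map R X h i z))"
  let ?C = "cyc R ` std_cycles R X i"
  have P: "?b \<in> std_cycles R X i \<rightarrow> carrier (std_res R Y (Suc i))"
    by (intro Pi_I basis_vec_std_res(2)[OF R] Z)
  have b: "std_map R X h (Suc i) (basis_vec R (cyc R z)) = ?b z" if "z \<in> std_cycles R X i" for z
    unfolding std_map.simps by (rule lin_ext_std_res(2)[OF R inj_on_cyc_cycles P that])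
  thus "z \<in> std_cycles R X i \<Longrightarrow> std_map R X h (Suc i) (basis_vec R (cyc R z)) = ?b z" .
  show L': "linear_map R (std_res R X (Suc i)) (std_res R Y (Suc i)) (std_map R X h (Suc i))"
    unfolding std_map.simps std_res_simps(2)[of R X]
    by (rule lin_ext_std_res(1)[OF R inj_on_cyc_cycles P])
  assume f: "f \<in> carrier (std_res R X (Suc i))"
  show "std_bd R Y i (std_map R X h (Suc i) f) = std_map R X h i (std_bd R X i f)"
  proof (rule linear_map_free_eq[OF R std_res_module[OF R] _ _ _ f[unfolded std_res_simps]])
    show "linear_map R (free_module R ?C) (std_res R Y i) (\<lambda>f. std_bd R Y i (std_map R X h (Suc i) f))"
      using linear_map_comp[OF L' std_bd_linear[OF R]] unfolding std_res_simps .
    show "linear_map R (free_module R ?C) (std_res R Y i) (\<lambda>f. std_map R X h i (std_bd R X i f))"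
      using linear_map_comp[OF std_bd_linear[OF R] L] unfolding std_res_simps .
    fix c assume "c \<in> ?C"
    then obtain z where z: "z \<in> std_cycles R X i" "c = cyc R z" by auto
    show "std_bd R Y i (std_map R X h (Suc i) (basis_vec R c)) = std_map R X h i (std_bd R X i (basis_vec R c))"
      using z Z by (simp only: b std_bd_basis[OF R])
  qed
qed

lemma std_map_linear_cycles:
  assumes X: "module R X" and Y: "module R Y" and h: "linear_map R X Y h"
  shows "linear_map R (std_res R X i) (std_res R Y i) (std_map R X h i) \<and>
     (\<forall>z \<in> std_cycles R X i. std_map R X h i z \<in> std_cycles R Y i)"
proof (induction i)
  case 0
  note m = std_map_0_linear[OF assms]
  show ?case using m(1) m(3) linear_mapD(1)[OF m(1)] linear_map_zero[OF X Y h]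
    by (auto simp: std_cycles_eq)
next
  case (Suc i)
  note R = module.axioms(1)[OF X]
  from Suc have l: "linear_map R (std_res R X i) (std_res R Y i) (std_map R X h i)"
    and z: "\<And>z. z \<in> std_cycles R X i \<Longrightarrow> std_map R X h i z \<in> std_cycles R Y i" by auto
  note m = std_map_Suc_linear[OF X Y l z]
  show ?case using m(1) m(3) linear_mapD(1)[OF m(1)]
      linear_map_zero[OF std_res_module[OF R] std_res_module[OF R] l]
    by (auto simp: std_cycles_eq)
qed

lemma std_map_linear:
  assumes X: "module R X" and Y: "module R Y" and h: "linear_map R X Y h"
  shows "linear_map R (std_res R X i) (std_res R Y i) (std_map R X h i)"
    and "z \<in> std_cycles R X i \<Longrightarrow> std_map R X h i z \<in> std_cycles R Y i"
    and "z \<in> std_cycles R X i \<Longrightarrow>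
      std_map R X h (Suc i) (basis_vec R (cyc R z)) = basis_vec R (cyc R (std_map R X h i z))"
    and "f \<in> carrier (std_res R X (Suc i)) \<Longrightarrow>
      std_bd R Y i (std_map R X h (Suc i) f) = std_map R X h i (std_bd R X i f)"
proof -
  show L: "linear_map R (std_res R X i) (std_res R Y i) (std_map R X h i)"
    and Z: "\<And>z. z \<in> std_cycles R X i \<Longrightarrow> std_map R X h i z \<in> std_cycles R Y i"
    using std_map_linear_cycles[OF assms, of i] by auto
  show "z \<in> std_cycles R X i \<Longrightarrow>
      std_map R X h (Suc i) (basis_vec R (cyc R z)) = basis_vec R (cyc R (std_map R X h i z))"
    by (rule std_map_Suc_linear(2)[OF X Y L Z])
  show "f \<in> carrier (std_res R X (Suc i)) \<Longrightarrow>
      std_bd R Y i (std_map R X h (Suc i) f) = std_map R X h i (std_bd R X i f)"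
    by (rule std_map_Suc_linear(3)[OF X Y L Z])
qed

section \<open>Cohomology and extension modules\<close>

locale cochain_complex =
  fixes R :: "('a, 'r) ring_scheme" and C :: "nat \<Rightarrow> ('a, 'x) module" and d :: "nat \<Rightarrow> 'x \<Rightarrow> 'x"
  assumes mod: "\<And>i. module R (C i)"
    and lin: "\<And>i. linear_map R (C i) (C (Suc i)) (d i)"
    and dd: "\<And>i x. x \<in> carrier (C i) \<Longrightarrow> d (Suc i) (d i x) = \<zero>\<^bsub>C (Suc (Suc i))\<^esub>"
begin

definition cocycles :: "nat \<Rightarrow> 'x set" where
  "cocycles i = {x \<in> carrier (C i). d i x = \<zero>\<^bsub>C (Suc i)\<^esub>}"

abbreviation cocycle_module :: "nat \<Rightarrow> ('a, 'x) module" where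
  "cocycle_module i \<equiv> (C i)\<lparr>carrier := cocycles i\<rparr>"

definition coclass :: "nat \<Rightarrow> 'x \<Rightarrow> 'x set" where
  "coclass i x = coboundaries C d i +>\<^bsub>cocycle_module i\<^esub> x"

lemma cocycles_submodule: "submodule (cocycles i) R (C i)"
  unfolding cocycles_def by (rule kernel_submodule[OF mod mod lin])

lemma cocycle_module: "module R (cocycle_module i)"
  by (rule submodule_module[OF mod cocycles_submodule])

lemma coboundaries_submodule: "submodule (coboundaries C d i) R (cocycle_module i)"
proof (cases i)
  case 0
  interpret C: module R "C 0" by (rule mod)
  show ?thesis
    by (rule submoduleI'[OF cocycle_module])
      (use submodule_simps(2)[OF mod cocycles_submodule] in \<open>auto simp: coboundaries_def 0\<close>)
next
  case (Suc j)
  have s: "submodule (d j ` carrier (C j)) R (C i)"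
    unfolding Suc by (rule image_submodule[OF mod mod lin module.carrier_is_submodule[OF mod]])
  have "d j ` carrier (C j) \<subseteq> cocycles i"
    using submodule_simps(1)[OF mod s] dd by (auto simp: cocycles_def Suc)
  thus ?thesis
    using submodule_simps[OF mod s]
    by (intro submoduleI'[OF cocycle_module]) (auto simp: coboundaries_def Suc)
qed

lemma cohomology_eq: "cohomology C d i = quot_module (cocycle_module i) (coboundaries C d i)"
  by (simp add: cohomology_def cocycles_def)

lemma cohomology_module: "module R (cohomology C d i)"
  unfolding cohomology_eq by (rule quot_module_module[OF cocycle_module coboundaries_submodule])

lemma carrier_cohomology: "carrier (cohomology C d i) = coclass i ` cocycles i"
  by (simp add: cohomology_eq carrier_quot_module coclass_def[abs_def])

lemma coclass_add:
  assumes "x \<in> cocycles i" "y \<in> cocycles i"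
  shows "coclass i x \<oplus>\<^bsub>cohomology C d i\<^esub> coclass i y = coclass i (x \<oplus>\<^bsub>C i\<^esub> y)"
  using quot_module_add[OF cocycle_module coboundaries_submodule, of x i y] assms
  by (simp add: cohomology_eq coclass_def)

lemma coclass_smult:
  assumes "a \<in> carrier R" "x \<in> cocycles i"
  shows "a \<odot>\<^bsub>cohomology C d i\<^esub> coclass i x = coclass i (a \<odot>\<^bsub>C i\<^esub> x)"
  using quot_module_smult[OF cocycle_module coboundaries_submodule assms(1), of x i] assms
  by (simp add: cohomology_eq coclass_def)

lemma coclass_eq_zero_iff:
  assumes "x \<in> cocycles i"
  shows "coclass i x = \<zero>\<^bsub>cohomology C d i\<^esub> \<longleftrightarrow> x \<in> coboundaries C d i"
  using coset_eq_self_iff[OF cocycle_module coboundaries_submodule, of x i] assms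
  by (simp add: cohomology_eq coclass_def)

end

lemma Ext_diff_linear:
  assumes "module R X" "module R N"
  shows "linear_map R (Ext_complex R X N i) (Ext_complex R X N (Suc i)) (Ext_diff R X i)"
proof -
  interpret X: module R X by fact
  have e: "Ext_diff R X i = (\<lambda>\<phi>. compose (carrier (std_res R X (Suc i))) \<phi> (std_bd R X i))"
    by (rule ext) (simp add: Ext_diff_def)
  show ?thesis unfolding e Ext_complex_def
    by (rule hom_module_precomp[OF std_res_module[OF X.R.is_cring] std_res_module[OF X.R.is_cring] assms(2)
          std_bd_linear[OF module.axioms(1)[OF assms(1)], of X]])
qed

lemma Ext_cochain_complex:
  assumes "module R X" "module R N"
  shows "cochain_complex R (Ext_complex R X N) (Ext_diff R X)"
proof (rule cochain_complex.intro)
  interpret X: module R X by fact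
  note R = X.R.is_cring
  show "module R (Ext_complex R X N i)" for i
    unfolding Ext_complex_def by (rule hom_module_module[OF std_res_module[OF R] assms(2)])
  show "linear_map R (Ext_complex R X N i) (Ext_complex R X N (Suc i)) (Ext_diff R X i)" for i
    by (rule Ext_diff_linear[OF assms])
  fix i \<phi> assume "\<phi> \<in> carrier (Ext_complex R X N i)"
  hence l: "linear_map R (std_res R X i) N \<phi>" by (simp add: Ext_complex_def hom_module_carrier)
  have "\<phi> (std_bd R X i (std_bd R X (Suc i) f)) = \<zero>\<^bsub>N\<^esub>"
    if "f \<in> carrier (std_res R X (Suc (Suc i)))" for f
    using std_bd_cycles[OF assms(1) that] linear_map_zero[OF std_res_module[OF R] assms(2) l]
    by (simp add: std_cycles_eq)
  thus "Ext_diff R X (Suc i) (Ext_diff R X i \<phi>) = \<zero>\<^bsub>Ext_complex R X N (Suc (Suc i))\<^esub>"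
    using linear_mapD(1)[OF std_bd_linear[OF module.axioms(1)[OF assms(1)], of X]]
    by (auto simp: Ext_diff_def Ext_complex_def hom_module_simps compose_def restrict_def)
qed

text \<open>Precomposition with \<^const>\<open>std_map\<close> commutes with the differentials, and therefore preserves cocycles and
  coboundaries.\<close>

lemma Ext_map_coclass:
  assumes X: "module R X" and Y: "module R Y" and N: "module R N" and h: "linear_map R X Y h"
    and c: "c \<in> cochain_complex.cocycles (Ext_complex R Y N) (Ext_diff R Y) i"
  shows "compose (carrier (std_res R X i)) c (std_map R X h i)
      \<in> cochain_complex.cocycles (Ext_complex R X N) (Ext_diff R X) i"
    and "Ext_map R i X h N (cochain_complex.coclass (Ext_complex R Y N) (Ext_diff R Y) i c) =
      cochain_complex.coclass (Ext_complex R X N) (Ext_diff R X) i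
        (compose (carrier (std_res R X i)) c (std_map R X h i))"
proof -
  interpret X: module R X by fact
  interpret CX: cochain_complex R "Ext_complex R X N" "Ext_diff R X" by (rule Ext_cochain_complex[OF X N])
  interpret CY: cochain_complex R "Ext_complex R Y N" "Ext_diff R Y" by (rule Ext_cochain_complex[OF Y N])
  note R = X.R.is_cring
  let ?p = "\<lambda>i \<phi>. compose (carrier (std_res R X i)) \<phi> (std_map R X h i)"
  note m = std_map_linear[OF X Y h]
  have pl: "linear_map R (Ext_complex R Y N i) (Ext_complex R X N i) (?p i)" for i
    unfolding Ext_complex_def by (rule hom_module_precomp[OF std_res_module[OF R] std_res_module[OF R] N m(1)])
  \<comment> \<open>In extensional functions, the equation outside the carrier holds because both sides are undefined.\<close>
  have comm: "Ext_diff R X i (?p i \<phi>) = ?p (Suc i) (Ext_diff R Y i \<phi>)" for i \<phi>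
    using linear_mapD(1)[OF std_bd_linear[OF R, of X]] linear_mapD(1)[OF m(1)] m(4)
    unfolding Ext_diff_def compose_def by (intro ext) (simp add: restrict_def)
  have cc: "?p i \<phi> \<in> CX.cocycles i" if "\<phi> \<in> CY.cocycles i" for i \<phi>
    using that linear_mapD(1)[OF pl] linear_map_zero[OF CY.mod CX.mod pl]
    by (auto simp: CX.cocycles_def CY.cocycles_def comm)
  show "?p i c \<in> CX.cocycles i" by (rule cc[OF c])
  have l: "linear_map R (CY.cocycle_module i) (CX.cocycle_module i) (?p i)"
    using pl[of i] cc submodule_simps(3)[OF CY.mod CY.cocycles_submodule]
    by (auto simp: linear_map_def)
  have im: "?p i ` coboundaries (Ext_complex R Y N) (Ext_diff R Y) i
      \<subseteq> coboundaries (Ext_complex R X N) (Ext_diff R X) i"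
  proof (cases i)
    case 0
    thus ?thesis using linear_map_zero[OF CY.mod CX.mod pl, of 0] by (simp add: coboundaries_def)
  next
    case (Suc j)
    thus ?thesis using linear_mapD(1)[OF pl, of _ j] by (auto simp: coboundaries_def comm[symmetric])
  qed
  have "quot_map (CX.cocycle_module i) (coboundaries (Ext_complex R X N) (Ext_diff R X) i) (?p i)
      (CY.coclass i c) = CX.coclass i (?p i c)"
    unfolding CY.coclass_def CX.coclass_def
    by (rule quot_map_coset[OF CY.cocycle_module CY.coboundaries_submodule
          CX.cocycle_module CX.coboundaries_submodule l im]) (use c in simp)
  thus "Ext_map R i X h N (CY.coclass i c) = CX.coclass i (?p i c)"
    by (simp add: Ext_map_def quot_map_def a_r_coset_def r_coset_def)
qed

lemma Ext_map_linear:
  assumes X: "module R X" and Y: "module R Y" and N: "module R N" and h: "linear_map R X Y h"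
  shows "linear_map R (Ext R i Y N) (Ext R i X N) (Ext_map R i X h N)"
proof -
  interpret X: module R X by fact
  interpret CX: cochain_complex R "Ext_complex R X N" "Ext_diff R X" by (rule Ext_cochain_complex[OF X N])
  interpret CY: cochain_complex R "Ext_complex R Y N" "Ext_diff R Y" by (rule Ext_cochain_complex[OF Y N])
  note R = X.R.is_cring
  let ?p = "\<lambda>i \<phi>. compose (carrier (std_res R X i)) \<phi> (std_map R X h i)"
  have pl: "linear_map R (Ext_complex R Y N i) (Ext_complex R X N i) (?p i)"
    unfolding Ext_complex_def
    by (rule hom_module_precomp[OF std_res_module[OF R] std_res_module[OF R] N std_map_linear(1)[OF X Y h]])
  note e = Ext_map_coclass[OF assms]
  note sY = submodule_simps[OF CY.mod CY.cocycles_submodule]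
  show ?thesis unfolding Ext_def
  proof (rule linear_mapI)
    fix \<xi> \<eta> assume "\<xi> \<in> carrier (cohomology (Ext_complex R Y N) (Ext_diff R Y) i)"
    then obtain c where c: "c \<in> CY.cocycles i" "\<xi> = CY.coclass i c" by (auto simp: CY.carrier_cohomology)
    show "Ext_map R i X h N \<xi> \<in> carrier (cohomology (Ext_complex R X N) (Ext_diff R X) i)"
      using c e by (auto simp: CX.carrier_cohomology)
    assume "\<eta> \<in> carrier (cohomology (Ext_complex R Y N) (Ext_diff R Y) i)"
    then obtain c' where c': "c' \<in> CY.cocycles i" "\<eta> = CY.coclass i c'" by (auto simp: CY.carrier_cohomology)
    show "Ext_map R i X h N (\<xi> \<oplus>\<^bsub>cohomology (Ext_complex R Y N) (Ext_diff R Y) i\<^esub> \<eta>) =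
       Ext_map R i X h N \<xi> \<oplus>\<^bsub>cohomology (Ext_complex R X N) (Ext_diff R X) i\<^esub> Ext_map R i X h N \<eta>"
      using c c' e sY linear_mapD(2)[OF pl] by (simp add: CY.coclass_add CX.coclass_add)
  next
    fix a \<xi> assume a: "a \<in> carrier R" and "\<xi> \<in> carrier (cohomology (Ext_complex R Y N) (Ext_diff R Y) i)"
    then obtain c where c: "c \<in> CY.cocycles i" "\<xi> = CY.coclass i c" by (auto simp: CY.carrier_cohomology)
    show "Ext_map R i X h N (a \<odot>\<^bsub>cohomology (Ext_complex R Y N) (Ext_diff R Y) i\<^esub> \<xi>) =
       a \<odot>\<^bsub>cohomology (Ext_complex R X N) (Ext_diff R X) i\<^esub> Ext_map R i X h N \<xi>"
      using a c e sY linear_mapD(3)[OF pl] by (simp add: CY.coclass_smult CX.coclass_smult)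
  qed
qed

lemma Ext_module:
  assumes "module R X" "module R N"
  shows "module R (Ext R i X N)"
proof -
  interpret CX: cochain_complex R "Ext_complex R X N" "Ext_diff R X"
    by (rule Ext_cochain_complex[OF assms])
  show ?thesis unfolding Ext_def by (rule CX.cohomology_module)
qed

section \<open>Direct limits\<close>

locale direct_system =
  fixes R :: "('a, 'r) ring_scheme" and A :: "nat \<Rightarrow> ('a, 'x) module" and t :: "nat \<Rightarrow> 'x \<Rightarrow> 'x"
  assumes mod: "\<And>n. module R (A n)"
    and lin: "\<And>n. linear_map R (A n) (A (Suc n)) (t n)"
begin

definition cls :: "nat \<Rightarrow> 'x \<Rightarrow> (nat \<times> 'x) set" where
  "cls n x = dirlim_rel A t `` {(n, x)}"

lemma transition_linear: "linear_map R (A n) (A (n + k)) (transition t n k)"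
proof (induction k)
  case 0
  show ?case by (rule linear_mapI) auto
next
  case (Suc k)
  show ?case using linear_map_comp[OF Suc lin] by simp
qed

lemma transition_add: "transition t n (k + l) x = transition t (n + k) l (transition t n k x)"
  by (induction l) (simp_all add: add.assoc)

lemma transition_trans:
  assumes "p = m + k" "q = k + l"
  shows "transition t p l (transition t m k x) = transition t m q x"
  by (simp add: assms transition_add)

lemma dirlim_rel_iff:
  "((m, x), (n, y)) \<in> dirlim_rel A t \<longleftrightarrow> x \<in> carrier (A m) \<and> y \<in> carrier (A n) \<and>
        (\<exists>k l. m + k = n + l \<and> transition t m k x = transition t n l y)"
  by (auto simp: dirlim_rel_def)

lemma dirlim_equiv: "equiv (SIGMA n:UNIV. carrier (A n)) (dirlim_rel A t)"
proof (rule equivI)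
  show "dirlim_rel A t \<subseteq> (SIGMA n:UNIV. carrier (A n)) \<times> (SIGMA n:UNIV. carrier (A n))"
    by (auto simp: dirlim_rel_def)
  show "refl_on (SIGMA n:UNIV. carrier (A n)) (dirlim_rel A t)"
    by (auto simp: refl_on_def dirlim_rel_def)
  show "sym (dirlim_rel A t)" by (rule symI) (auto simp: dirlim_rel_def, metis)
  show "trans (dirlim_rel A t)"
  proof (rule transI)
    fix p q r assume pq: "(p, q) \<in> dirlim_rel A t" and qr: "(q, r) \<in> dirlim_rel A t"
    obtain m x n y l z where p: "p = (m, x)" "q = (n, y)" "r = (l, z)" by (metis surj_pair)
    from pq p obtain k k' where k: "x \<in> carrier (A m)" "m + k = n + k'" "transition t m k x = transition t n k' y"
      by (auto simp: dirlim_rel_iff)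
    from qr p obtain j j' where j: "z \<in> carrier (A l)" "n + j = l + j'" "transition t n j y = transition t l j' z"
      by (auto simp: dirlim_rel_iff)
    have "transition t m (k + j) x = transition t n (k' + j) y"
      by (simp only: transition_add k)
    also have "k' + j = j + k'" by simp
    also have "transition t n (j + k') y = transition t l (j' + k') z"
      by (simp only: transition_add j)
    finally have "transition t m (k + j) x = transition t l (j' + k') z" .
    moreover have "m + (k + j) = l + (j' + k')" using k j by simp
    ultimately have "\<exists>a b. m + a = l + b \<and> transition t m a x = transition t l b z" by blast
    thus "(p, r) \<in> dirlim_rel A t" unfolding p dirlim_rel_iff using k(1) j(1) by simp
  qed
qed

lemma cls_eq_iff:
  assumes "x \<in> carrier (A m)" "y \<in> carrier (A n)"
  shows "cls m x = cls n y \<longleftrightarrow> (\<exists>k l. m + k = n + l \<and> transition t m k x = transition t n l y)"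
  using eq_equiv_class_iff[OF dirlim_equiv, of "(m, x)" "(n, y)"] assms
  by (simp add: cls_def dirlim_rel_iff)

lemma cls_eqI:
  assumes "x \<in> carrier (A m)" "y \<in> carrier (A n)" "m + k = n + l" "transition t m k x = transition t n l y"
  shows "cls m x = cls n y"
  using assms(3,4) unfolding cls_eq_iff[OF assms(1,2)] by blast

lemma carrier_direct_limit:
  "C \<in> carrier (direct_limit A t) \<longleftrightarrow> (\<exists>n x. x \<in> carrier (A n) \<and> C = cls n x)"
  by (auto simp: direct_limit_def quotient_def cls_def)

lemma cls_transition:
  assumes "x \<in> carrier (A n)" shows "cls (n + k) (transition t n k x) = cls n x"
proof -
  have "n + k + 0 = n + k \<and> transition t (n + k) 0 (transition t n k x) = transition t n k x" by simp
  thus ?thesis using cls_eq_iff[OF linear_mapD(1)[OF transition_linear assms] assms] by blast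
qed

lemma mem_cls: "x \<in> carrier (A n) \<Longrightarrow> (n, x) \<in> cls n x"
  by (auto simp: cls_def dirlim_rel_iff)

lemma cls_memD:
  assumes "p \<in> cls n x"
  obtains m y where "p = (m, y)" "y \<in> carrier (A m)" "cls m y = cls n x"
proof -
  obtain m y where p: "p = (m, y)" by (cases p)
  have r: "((n, x), (m, y)) \<in> dirlim_rel A t" using assms p by (simp add: cls_def)
  show ?thesis
  proof (rule that[OF p])
    show "y \<in> carrier (A m)" using r by (simp add: dirlim_rel_iff)
    show "cls m y = cls n x" unfolding cls_def using equiv_class_eq[OF dirlim_equiv r] by simp
  qed
qed

lemma UN_cls:
  assumes "x \<in> carrier (A n)"
    and "\<And>m y. y \<in> carrier (A m) \<Longrightarrow> cls m y = cls n x \<Longrightarrow> F m y = (r :: 'b set)"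
  shows "(\<Union>(m, y)\<in>cls n x. F m y) = r"
proof -
  have "case_prod F p = r" if "p \<in> cls n x" for p
    using that by (rule cls_memD) (simp add: assms(2))
  thus ?thesis using mem_cls[OF assms(1)] by blast
qed

text \<open>Addition moves both summands to the stage that is the sum of their stages. Two such sums agree
  after both have been moved on to a stage at which both pairs of representatives have become equal.\<close>

lemma cls_add_wd:
  assumes x: "x \<in> carrier (A m)" and y: "y \<in> carrier (A n)"
    and x': "x' \<in> carrier (A m')" and y': "y' \<in> carrier (A n')"
    and e: "cls m' x' = cls m x" "cls n' y' = cls n y"
  shows "cls (m' + n') (transition t m' n' x' \<oplus>\<^bsub>A (m' + n')\<^esub> transition t n' m' y') =
         cls (m + n) (transition t m n x \<oplus>\<^bsub>A (m + n)\<^esub> transition t n m y)"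
proof -
  let ?T = "transition t"
  note tl = transition_linear
  obtain k k' where k: "m' + k' = m + k" "?T m' k' x' = ?T m k x"
    using e(1) cls_eq_iff[OF x' x] by auto
  obtain l l' where l: "n' + l' = n + l" "?T n' l' y' = ?T n l y"
    using e(2) cls_eq_iff[OF y' y] by auto
  have tc: "?T m n x \<in> carrier (A (m + n))" "?T n m y \<in> carrier (A (m + n))"
    "?T m' n' x' \<in> carrier (A (m' + n'))" "?T n' m' y' \<in> carrier (A (m' + n'))"
    using linear_mapD(1)[OF tl x, of n] linear_mapD(1)[OF tl y, of m]
      linear_mapD(1)[OF tl x', of n'] linear_mapD(1)[OF tl y', of m'] by (simp_all add: add.commute)
  have a: "m + n + (k + l) = m' + n' + (k' + l')" using k l by simp
  have X: "?T (m' + n') (k' + l') (?T m' n' x') = ?T (m + n) (k + l) (?T m n x)"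
  proof -
    have "?T (m' + n') (k' + l') (?T m' n' x') = ?T m' (k' + (n' + l')) x'"
      by (rule transition_trans) simp_all
    also have "\<dots> = ?T (m + k) (n + l) (?T m k x)"
      by (simp only: transition_add k l)
    also have "\<dots> = ?T m (k + (n + l)) x" by (rule transition_trans) simp_all
    also have "\<dots> = ?T (m + n) (k + l) (?T m n x)"
      by (rule transition_trans[symmetric]) simp_all
    finally show ?thesis .
  qed
  have Y: "?T (m' + n') (k' + l') (?T n' m' y') = ?T (m + n) (k + l) (?T n m y)"
  proof -
    have "?T (m' + n') (k' + l') (?T n' m' y') = ?T n' (l' + (m' + k')) y'"
      by (rule transition_trans) simp_all
    also have "\<dots> = ?T (n + l) (m + k) (?T n l y)"
      by (simp only: transition_add k l)
    also have "\<dots> = ?T n (l + (m + k)) y" by (rule transition_trans) simp_all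
    also have "\<dots> = ?T (m + n) (k + l) (?T n m y)"
      by (rule transition_trans[symmetric]) simp_all
    finally show ?thesis .
  qed
  interpret A: module R "A (m + n)" by (rule mod)
  interpret A': module R "A (m' + n')" by (rule mod)
  have "?T (m' + n') (k' + l') (?T m' n' x' \<oplus>\<^bsub>A (m' + n')\<^esub> ?T n' m' y') =
        ?T (m + n) (k + l) (?T m n x \<oplus>\<^bsub>A (m + n)\<^esub> ?T n m y)"
    using linear_mapD(2)[OF tl[of "m + n" "k + l"] tc(1,2)]
      linear_mapD(2)[OF tl[of "m' + n'" "k' + l'"] tc(3,4)] X Y a by simp
  thus ?thesis
    by (rule cls_eqI[OF A'.M.a_closed[OF tc(3,4)] A.M.a_closed[OF tc(1,2)] a[symmetric]])
qed

lemma cls_add_aux: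
  assumes x: "x \<in> carrier (A m)" and y: "y \<in> carrier (A n)"
  shows "cls m x \<oplus>\<^bsub>direct_limit A t\<^esub> cls n y =
         cls (m + n) (transition t m n x \<oplus>\<^bsub>A (m + n)\<^esub> transition t n m y)" (is "_ = ?r")
proof -
  have "(\<Union>(n', y')\<in>cls n y. cls (m' + n') (transition t m' n' x' \<oplus>\<^bsub>A (m' + n')\<^esub> transition t n' m' y')) = ?r"
    if p: "x' \<in> carrier (A m')" "cls m' x' = cls m x" for m' x'
    by (rule UN_cls[OF y]) (rule cls_add_wd[OF x y p(1) _ p(2)])
  hence "(\<Union>(m', x')\<in>cls m x. \<Union>(n', y')\<in>cls n y.
      cls (m' + n') (transition t m' n' x' \<oplus>\<^bsub>A (m' + n')\<^esub> transition t n' m' y')) = ?r"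
    by (rule UN_cls[OF x])
  thus ?thesis by (simp add: direct_limit_def cls_def)
qed

lemma cls_add:
  assumes x: "x \<in> carrier (A n)" and y: "y \<in> carrier (A n)"
  shows "cls n x \<oplus>\<^bsub>direct_limit A t\<^esub> cls n y = cls n (x \<oplus>\<^bsub>A n\<^esub> y)"
proof -
  interpret A: module R "A n" by (rule mod)
  have "cls n x \<oplus>\<^bsub>direct_limit A t\<^esub> cls n y = cls (n + n) (transition t n n (x \<oplus>\<^bsub>A n\<^esub> y))"
    unfolding cls_add_aux[OF x y] linear_mapD(2)[OF transition_linear x y] ..
  thus ?thesis using cls_transition x y by simp
qed

lemma cls_zero: "\<zero>\<^bsub>direct_limit A t\<^esub> = cls n \<zero>\<^bsub>A n\<^esub>"
proof -
  interpret A: module R "A n" by (rule mod)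
  interpret A0: module R "A 0" by (rule mod)
  have "transition t 0 n \<zero>\<^bsub>A 0\<^esub> = \<zero>\<^bsub>A n\<^esub>"
    using linear_map_zero[OF mod mod transition_linear, of 0 n] by simp
  hence "cls 0 \<zero>\<^bsub>A 0\<^esub> = cls n \<zero>\<^bsub>A n\<^esub>" using cls_transition[OF A0.M.zero_closed, of n] by simp
  thus ?thesis by (simp add: direct_limit_def cls_def)
qed

lemma cls_smult:
  assumes a: "a \<in> carrier R" and x: "x \<in> carrier (A n)"
  shows "a \<odot>\<^bsub>direct_limit A t\<^esub> cls n x = cls n (a \<odot>\<^bsub>A n\<^esub> x)"
proof -
  have "cls m (a \<odot>\<^bsub>A m\<^esub> y) = cls n (a \<odot>\<^bsub>A n\<^esub> x)" if y: "y \<in> carrier (A m)" "cls m y = cls n x" for m y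
  proof -
    interpret A: module R "A n" by (rule mod)
    interpret A': module R "A m" by (rule mod)
    obtain k l where k: "m + k = n + l" "transition t m k y = transition t n l x"
      using y(2) cls_eq_iff[OF y(1) x] by auto
    have "transition t m k (a \<odot>\<^bsub>A m\<^esub> y) = transition t n l (a \<odot>\<^bsub>A n\<^esub> x)"
      using linear_mapD(3)[OF transition_linear a y(1)] linear_mapD(3)[OF transition_linear a x] k by simp
    thus ?thesis by (rule cls_eqI[OF A'.smult_closed[OF a y(1)] A.smult_closed[OF a x] k(1)])
  qed
  hence "(\<Union>(m, y)\<in>cls n x. cls m (a \<odot>\<^bsub>A m\<^esub> y)) = cls n (a \<odot>\<^bsub>A n\<^esub> x)"
    by (rule UN_cls[OF x])
  thus ?thesis by (simp add: direct_limit_def cls_def)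
qed

lemma common_stage2:
  assumes "C \<in> carrier (direct_limit A t)" "D \<in> carrier (direct_limit A t)"
  obtains n x y where "x \<in> carrier (A n)" "y \<in> carrier (A n)" "C = cls n x" "D = cls n y"
proof -
  obtain m x n y where e: "x \<in> carrier (A m)" "C = cls m x" "y \<in> carrier (A n)" "D = cls n y"
    using assms by (auto simp: carrier_direct_limit)
  have "C = cls (m + n) (transition t m n x)" "D = cls (m + n) (transition t n m y)"
    using cls_transition[OF e(1), of n] cls_transition[OF e(3), of m] e by (simp_all add: add.commute)
  moreover have "transition t m n x \<in> carrier (A (m + n))" "transition t n m y \<in> carrier (A (m + n))"
    using linear_mapD(1)[OF transition_linear e(1), of n] linear_mapD(1)[OF transition_linear e(3), of m]
    by (simp_all add: add.commute)
  ultimately show ?thesis using that by blast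
qed

lemma common_stage3:
  assumes "C \<in> carrier (direct_limit A t)" "D \<in> carrier (direct_limit A t)" "E \<in> carrier (direct_limit A t)"
  obtains n x y z where "x \<in> carrier (A n)" "y \<in> carrier (A n)" "z \<in> carrier (A n)"
    "C = cls n x" "D = cls n y" "E = cls n z"
proof -
  obtain m x y where e: "x \<in> carrier (A m)" "y \<in> carrier (A m)" "C = cls m x" "D = cls m y"
    using common_stage2[OF assms(1,2)] .
  obtain n z where f: "z \<in> carrier (A n)" "E = cls n z" using assms by (auto simp: carrier_direct_limit)
  have "C = cls (m + n) (transition t m n x)" "D = cls (m + n) (transition t m n y)"
      "E = cls (m + n) (transition t n m z)"
    using cls_transition[OF e(1), of n] cls_transition[OF e(2), of n] cls_transition[OF f(1), of m] e f
    by (simp_all add: add.commute)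
  moreover have "transition t m n x \<in> carrier (A (m + n))" "transition t m n y \<in> carrier (A (m + n))"
      "transition t n m z \<in> carrier (A (m + n))"
    using linear_mapD(1)[OF transition_linear e(1), of n] linear_mapD(1)[OF transition_linear e(2), of n]
      linear_mapD(1)[OF transition_linear f(1), of m]
    by (simp_all add: add.commute)
  ultimately show ?thesis using that by blast
qed

lemma cls_carrier: "x \<in> carrier (A n) \<Longrightarrow> cls n x \<in> carrier (direct_limit A t)"
  by (auto simp: carrier_direct_limit)

lemma direct_limit_module: "module R (direct_limit A t)"
proof -
  let ?L = "direct_limit A t"
  interpret A0: module R "A 0" by (rule mod)
  have ab: "abelian_group ?L"
  proof (rule abelian_groupI)
    fix C D assume "C \<in> carrier ?L" "D \<in> carrier ?L"
    then obtain n x y where n: "x \<in> carrier (A n)" "y \<in> carrier (A n)" "C = cls n x" "D = cls n y"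
      by (rule common_stage2)
    interpret A: module R "A n" by (rule mod)
    show "C \<oplus>\<^bsub>?L\<^esub> D \<in> carrier ?L" using n by (simp add: cls_add cls_carrier)
    show "C \<oplus>\<^bsub>?L\<^esub> D = D \<oplus>\<^bsub>?L\<^esub> C" using n by (simp add: cls_add A.M.a_comm)
  next
    fix C D E assume "C \<in> carrier ?L" "D \<in> carrier ?L" "E \<in> carrier ?L"
    then obtain n x y z where n: "x \<in> carrier (A n)" "y \<in> carrier (A n)" "z \<in> carrier (A n)"
        "C = cls n x" "D = cls n y" "E = cls n z"
      by (rule common_stage3)
    interpret A: module R "A n" by (rule mod)
    show "C \<oplus>\<^bsub>?L\<^esub> D \<oplus>\<^bsub>?L\<^esub> E = C \<oplus>\<^bsub>?L\<^esub> (D \<oplus>\<^bsub>?L\<^esub> E)" using n by (simp add: cls_add A.M.a_assoc)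
  next
    show "\<zero>\<^bsub>?L\<^esub> \<in> carrier ?L" unfolding cls_zero[of 0] by (simp add: cls_carrier)
  next
    fix C assume "C \<in> carrier ?L"
    then obtain n x where n: "x \<in> carrier (A n)" "C = cls n x" by (auto simp: carrier_direct_limit)
    interpret A: module R "A n" by (rule mod)
    show "\<zero>\<^bsub>?L\<^esub> \<oplus>\<^bsub>?L\<^esub> C = C" using n by (simp add: cls_zero[of n] cls_add)
    have "cls n (\<ominus>\<^bsub>A n\<^esub> x) \<oplus>\<^bsub>?L\<^esub> C = \<zero>\<^bsub>?L\<^esub>" using n by (simp add: cls_zero[of n] cls_add A.M.l_neg)
    thus "\<exists>D\<in>carrier ?L. D \<oplus>\<^bsub>?L\<^esub> C = \<zero>\<^bsub>?L\<^esub>" using n cls_carrier[OF A.M.a_inv_closed[OF n(1)]] by blast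
  qed
  show ?thesis
  proof (rule moduleI[OF A0.R.is_cring ab])
    fix a b C D assume a: "a \<in> carrier R" and C: "C \<in> carrier ?L" "D \<in> carrier ?L"
    from C obtain n x y where n: "x \<in> carrier (A n)" "y \<in> carrier (A n)" "C = cls n x" "D = cls n y"
      by (rule common_stage2)
    interpret A: module R "A n" by (rule mod)
    show "a \<odot>\<^bsub>?L\<^esub> (C \<oplus>\<^bsub>?L\<^esub> D) = a \<odot>\<^bsub>?L\<^esub> C \<oplus>\<^bsub>?L\<^esub> a \<odot>\<^bsub>?L\<^esub> D"
      using n a by (simp add: cls_add cls_smult A.smult_r_distr)
  next
    fix a b C assume a: "a \<in> carrier R" "b \<in> carrier R" and "C \<in> carrier ?L"
    then obtain n x where n: "x \<in> carrier (A n)" "C = cls n x" by (auto simp: carrier_direct_limit)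
    interpret A: module R "A n" by (rule mod)
    show "(a \<oplus>\<^bsub>R\<^esub> b) \<odot>\<^bsub>?L\<^esub> C = a \<odot>\<^bsub>?L\<^esub> C \<oplus>\<^bsub>?L\<^esub> b \<odot>\<^bsub>?L\<^esub> C"
      using n a by (simp add: cls_add cls_smult A.smult_l_distr)
    show "(a \<otimes>\<^bsub>R\<^esub> b) \<odot>\<^bsub>?L\<^esub> C = a \<odot>\<^bsub>?L\<^esub> (b \<odot>\<^bsub>?L\<^esub> C)"
      using n a by (simp add: cls_smult A.smult_assoc1)
  next
    fix a C assume a: "a \<in> carrier R" and "C \<in> carrier ?L"
    then obtain n x where n: "x \<in> carrier (A n)" "C = cls n x" by (auto simp: carrier_direct_limit)
    interpret A: module R "A n" by (rule mod)
    show "a \<odot>\<^bsub>?L\<^esub> C \<in> carrier ?L" using n a by (simp add: cls_smult cls_carrier)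
  next
    fix C assume "C \<in> carrier ?L"
    then obtain n x where n: "x \<in> carrier (A n)" "C = cls n x" by (auto simp: carrier_direct_limit)
    interpret A: module R "A n" by (rule mod)
    show "\<one>\<^bsub>R\<^esub> \<odot>\<^bsub>?L\<^esub> C = C" using n by (simp add: cls_smult)
  qed
qed

lemma cls_eq_zero_iff:
  assumes "x \<in> carrier (A n)"
  shows "cls n x = \<zero>\<^bsub>direct_limit A t\<^esub> \<longleftrightarrow> (\<exists>k. transition t n k x = \<zero>\<^bsub>A (n + k)\<^esub>)"
proof -
  interpret A: module R "A n" by (rule mod)
  have z: "transition t n k \<zero>\<^bsub>A n\<^esub> = \<zero>\<^bsub>A (n + k)\<^esub>" for k
    by (rule linear_map_zero[OF mod mod transition_linear])
  show ?thesis unfolding cls_zero[of n] cls_eq_iff[OF assms A.M.zero_closed]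
    by (auto simp: z)
qed

end

section \<open>First extension modules from generators and relations\<close>

text \<open>Let \<open>p\<close> be a family of generators of \<open>X\<close>, indexed by \<open>B\<close>, let \<open>L\<close> be the free module on \<open>B\<close> and \<open>K\<close> the kernel
  of \<open>\<pi> : L \<rightarrow> X\<close>. Then the first extension module of \<open>X\<close> and \<open>N\<close> is the module of linear maps from \<open>K\<close> to \<open>N\<close> modulo
  those that extend to \<open>L\<close>. To see this for the standard resolution, with terms \<open>F i\<close>, note that a cocycle of degree \<open>1\<close> is the same as
  a linear map on the cycles \<open>Z\<close> in \<open>F 0\<close>, and that \<open>L\<close> and \<open>F 0\<close> both map onto \<open>X\<close>.\<close>

locale presentation =
  fixes R :: "('a, 'r) ring_scheme" and X :: "('a, 'x) module" and N :: "('a, 'n) module"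
    and B :: "'b set" and p :: "'b \<Rightarrow> 'x"
  assumes X: "module R X" and N: "module R N" and p: "p \<in> B \<rightarrow> carrier X"
    and gen: "\<And>x. x \<in> carrier X \<Longrightarrow> \<exists>k\<in>carrier (free_module R B). lin_ext R X B (\<lambda>b. b) p k = x"
begin

sublocale E: cochain_complex R "Ext_complex R X N" "Ext_diff R X"
  by (rule Ext_cochain_complex[OF X N])

sublocale XM: module R X by (rule X)
sublocale NM: module R N by (rule N)

abbreviation "L \<equiv> free_module R B"
abbreviation "F \<equiv> std_res R X"
abbreviation "Z \<equiv> std_cycles R X 0"
abbreviation "ZM \<equiv> (F 0)\<lparr>carrier := Z\<rparr>"

definition \<pi> :: "('b \<Rightarrow> 'a) \<Rightarrow> 'x" where "\<pi> = lin_ext R X B (\<lambda>b. b) p"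

definition \<iota> :: "('b \<Rightarrow> 'a) \<Rightarrow> ('a, 'x) cell \<Rightarrow> 'a" where
  "\<iota> = lin_ext R (F 0) B (\<lambda>b. b) (\<lambda>b. basis_vec R (Gen (p b)))"

definition K :: "('b \<Rightarrow> 'a) set" where "K = {k \<in> carrier L. \<pi> k = \<zero>\<^bsub>X\<^esub>}"

abbreviation "KM \<equiv> L\<lparr>carrier := K\<rparr>"

definition on_cycles :: "((('a, 'x) cell \<Rightarrow> 'a) \<Rightarrow> 'n) \<Rightarrow> (('a, 'x) cell \<Rightarrow> 'a) \<Rightarrow> 'n" where
  "on_cycles c z = c (basis_vec R (cyc R z))"

lemma R: "cring R" by (rule XM.R.is_cring)

lemma L: "module R L" by (rule free_module_module[OF R])
lemma F: "module R (F i)" by (rule std_res_module[OF R])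

lemma \<pi>_linear: "linear_map R L X \<pi>"
  using linear_map_lin_ext[OF X, of "\<lambda>b. b" B p] p by (simp add: \<pi>_def)

lemma \<iota>_linear: "linear_map R L (F 0) \<iota>"
  and \<iota>_basis: "b \<in> B \<Longrightarrow> \<iota> (basis_vec R b) = basis_vec R (Gen (p b))"
proof -
  have P: "(\<lambda>b. basis_vec R (Gen (p b))) \<in> B \<rightarrow> carrier (F 0)"
    by (intro Pi_I basis_vec_std_res(1)[OF R] Pi_mem[OF p])
  show "linear_map R L (F 0) \<iota>"
    using linear_map_lin_ext[OF F inj_on_id2 P] by (simp add: \<iota>_def)
  show "b \<in> B \<Longrightarrow> \<iota> (basis_vec R b) = basis_vec R (Gen (p b))"
    using lin_ext_basis[OF F inj_on_id2 P] by (simp add: \<iota>_def)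
qed

lemma \<pi>_basis: "b \<in> B \<Longrightarrow> \<pi> (basis_vec R b) = p b"
  using lin_ext_basis[OF X inj_on_id2 p] by (simp add: \<pi>_def)

lemma aug_\<iota>:
  assumes "k \<in> carrier L"
  shows "std_aug R X (\<iota> k) = \<pi> k"
proof (rule linear_map_free_eq[OF R X linear_map_comp[OF \<iota>_linear std_aug_linear[OF X]] \<pi>_linear _ assms])
  fix b assume b: "b \<in> B"
  show "std_aug R X (\<iota> (basis_vec R b)) = \<pi> (basis_vec R b)"
    using Pi_mem[OF p b] by (simp only: \<iota>_basis[OF b] \<pi>_basis[OF b] std_aug_basis[OF X])
qed

lemma K_submodule: "submodule K R L"
  unfolding K_def by (rule kernel_submodule[OF L X \<pi>_linear])
lemma KM: "module R KM" by (rule submodule_module[OF L K_submodule])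
lemma Z_submodule: "submodule Z R (F 0)" by (rule std_cycles_submodule[OF X])
lemma ZM: "module R ZM" by (rule submodule_module[OF F Z_submodule])

lemma \<iota>_K: "linear_map R KM ZM \<iota>"
proof (rule linear_map_submodule_codomain)
  show "linear_map R KM (F 0) \<iota>"
    by (rule linear_map_submodule_domain[OF \<iota>_linear submodule_simps(1)[OF L K_submodule]])
  show "\<iota> k \<in> Z" if "k \<in> carrier KM" for k
    using that linear_mapD(1)[OF \<iota>_linear] aug_\<iota> by (auto simp: std_cycles_eq K_def)
qed

lemma cocycleD:
  assumes "c \<in> E.cocycles 1"
  shows "linear_map R (F 1) N c" "c \<in> extensional (carrier (F 1))"
    and "\<And>z. z \<in> std_cycles R X 1 \<Longrightarrow> c z = \<zero>\<^bsub>N\<^esub>"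
proof -
  have c: "c \<in> carrier (Ext_complex R X N 1)" and d: "Ext_diff R X 1 c = \<zero>\<^bsub>Ext_complex R X N (Suc 1)\<^esub>"
    using assms by (auto simp: E.cocycles_def)
  show "linear_map R (F 1) N c" "c \<in> extensional (carrier (F 1))"
    using c by (auto simp: Ext_complex_def hom_module_carrier)
  fix z assume z: "z \<in> std_cycles R X 1"
  have b: "basis_vec R (cyc R z) \<in> carrier (F (Suc 1))" by (rule basis_vec_std_res(2)[OF R z])
  have e: "Ext_diff R X 1 c (basis_vec R (cyc R z)) = c z"
    using b std_bd_basis[OF R z] by (simp add: Ext_diff_def compose_def)
  show "c z = \<zero>\<^bsub>N\<^esub>" unfolding e[symmetric] d using b by (simp add: Ext_complex_def hom_module_simps)
qed

text \<open>The element \<open>f\<close> and the basis element of its boundary have the same boundary, so they differ by a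
  cycle, and cocycles vanish on cycles.\<close>

lemma on_cycles_bd:
  assumes "c \<in> E.cocycles 1" "f \<in> carrier (F 1)"
  shows "on_cycles c (std_bd R X 0 f) = c f"
proof -
  let ?z = "std_bd R X 0 f"
  have z: "?z \<in> Z" using std_bd_cycles[OF X, of f 0] assms(2) by simp
  have b: "basis_vec R (cyc R ?z) \<in> carrier (F 1)" using basis_vec_std_res(2)[OF R z] by simp
  have "std_bd R X 0 (basis_vec R (cyc R ?z) \<ominus>\<^bsub>F 1\<^esub> f) = ?z \<ominus>\<^bsub>F 0\<^esub> ?z"
    using linear_map_minus[OF F F std_bd_linear[OF R, of X 0], of _ f] b assms(2) std_bd_basis[OF R z] by simp
  also have "\<dots> = \<zero>\<^bsub>F 0\<^esub>"
    using z submodule_simps(3)[OF F Z_submodule] by (simp add: module_minus_simps(3)[OF F])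
  finally have "basis_vec R (cyc R ?z) \<ominus>\<^bsub>F 1\<^esub> f \<in> std_cycles R X 1"
    using b assms(2) abelian_group.minus_closed[OF module.axioms(2)[OF F]] by (simp add: std_cycles_eq)
  hence "c (basis_vec R (cyc R ?z)) \<ominus>\<^bsub>N\<^esub> c f = \<zero>\<^bsub>N\<^esub>"
    using cocycleD[OF assms(1)] linear_map_minus[OF F N cocycleD(1)[OF assms(1)] b assms(2)] by simp
  thus ?thesis
    using linear_mapD(1)[OF cocycleD(1)[OF assms(1)]] b assms(2)
    by (simp add: on_cycles_def module_minus_simps(4)[OF N])
qed

lemma on_cycles_linear:
  assumes c: "c \<in> E.cocycles 1"
  shows "linear_map R ZM N (on_cycles c)"
proof (rule linear_mapI)
  note lc = cocycleD(1)[OF c]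
  have b: "basis_vec R (cyc R z) \<in> carrier (F 1)" if "z \<in> Z" for z
    using basis_vec_std_res(2)[OF R that] by simp
  note s = std_bd_basis[OF R, of _ X 0]
  note bl = std_bd_linear[OF R, of X 0, folded One_nat_def]
  note cl = abelian_monoid.a_closed[OF abelian_group.axioms(1)[OF module.axioms(2)[OF F]]]
  fix z assume "z \<in> carrier ZM"
  hence z: "z \<in> Z" by simp
  show "on_cycles c z \<in> carrier N"
    using linear_mapD(1)[OF lc b[OF z]] by (simp add: on_cycles_def)
  show "on_cycles c (a \<odot>\<^bsub>ZM\<^esub> z) = a \<odot>\<^bsub>N\<^esub> on_cycles c z" if a: "a \<in> carrier R" for a
    using on_cycles_bd[OF c module.smult_closed[OF F a b[OF z]]] linear_mapD(3)[OF bl a b[OF z]]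
      linear_mapD(3)[OF lc a b[OF z]] s[OF z] by (simp add: on_cycles_def)
  fix w assume "w \<in> carrier ZM"
  hence w: "w \<in> Z" by simp
  show "on_cycles c (z \<oplus>\<^bsub>ZM\<^esub> w) = on_cycles c z \<oplus>\<^bsub>N\<^esub> on_cycles c w"
    using on_cycles_bd[OF c cl[OF b[OF z] b[OF w]]] linear_mapD(2)[OF bl b[OF z] b[OF w]]
      linear_mapD(2)[OF lc b[OF z] b[OF w]] s[OF z] s[OF w] by (simp add: on_cycles_def)
qed

text \<open>Composing \<open>\<theta>\<close> with the boundary map gives a cocycle, since the boundary of a boundary vanishes.\<close>

lemma cocycle_from_cycles:
  assumes t: "linear_map R ZM N \<theta>"
  obtains c where "c \<in> E.cocycles 1" "\<And>z. z \<in> Z \<Longrightarrow> on_cycles c z = \<theta> z"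
proof
  define c where "c = compose (carrier (F 1)) \<theta> (std_bd R X 0)"
  have bz: "linear_map R (F 1) ZM (std_bd R X 0)"
    using linear_map_submodule_codomain[OF std_bd_linear[OF R, of X 0] std_bd_cycles[OF X]] by simp
  have "linear_map R (F 1) N (\<lambda>x. \<theta> (std_bd R X 0 x))" by (rule linear_map_comp[OF bz t])
  hence cc: "c \<in> carrier (Ext_complex R X N 1)"
    unfolding c_def Ext_complex_def hom_module_carrier compose_def
    using linear_map_restrict[OF F] by auto
  have "c (std_bd R X 1 f) = \<zero>\<^bsub>N\<^esub>" if "f \<in> carrier (F (Suc 1))" for f
    using std_bd_cycles[OF X that] linear_map_zero[OF ZM N t]
    by (simp add: c_def compose_def std_cycles_eq)
  hence "Ext_diff R X 1 c = \<zero>\<^bsub>Ext_complex R X N (Suc 1)\<^esub>"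
    by (auto simp: Ext_diff_def Ext_complex_def hom_module_simps compose_def restrict_def)
  thus "c \<in> E.cocycles 1" using cc by (simp add: E.cocycles_def)
  show "on_cycles c z = \<theta> z" if "z \<in> Z" for z
    using basis_vec_std_res(2)[OF R that] std_bd_basis[OF R that]
    by (simp add: on_cycles_def c_def compose_def)
qed

lemma coboundary_iff:
  assumes c: "c \<in> E.cocycles 1"
  shows "c \<in> coboundaries (Ext_complex R X N) (Ext_diff R X) 1 \<longleftrightarrow>
     (\<exists>\<psi>. linear_map R (F 0) N \<psi> \<and> (\<forall>z\<in>Z. on_cycles c z = \<psi> z))"
proof
  assume "c \<in> coboundaries (Ext_complex R X N) (Ext_diff R X) 1"
  then obtain \<psi> where psi: "\<psi> \<in> carrier (Ext_complex R X N 0)" "c = Ext_diff R X 0 \<psi>"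
    by (auto simp: coboundaries_def)
  have "on_cycles c z = \<psi> z" if "z \<in> Z" for z
    using psi(2) basis_vec_std_res(2)[OF R that] std_bd_basis[OF R that]
    by (simp add: on_cycles_def Ext_diff_def compose_def)
  thus "\<exists>\<psi>. linear_map R (F 0) N \<psi> \<and> (\<forall>z\<in>Z. on_cycles c z = \<psi> z)"
    using psi(1) by (auto simp: Ext_complex_def hom_module_carrier)
next
  assume "\<exists>\<psi>. linear_map R (F 0) N \<psi> \<and> (\<forall>z\<in>Z. on_cycles c z = \<psi> z)"
  then obtain \<psi> where psi: "linear_map R (F 0) N \<psi>" "\<And>z. z \<in> Z \<Longrightarrow> on_cycles c z = \<psi> z" by auto
  let ?p = "restrict \<psi> (carrier (F 0))"
  have "?p \<in> carrier (Ext_complex R X N 0)"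
    using iffD2[OF linear_map_restrict[OF F] psi(1)] by (simp add: Ext_complex_def hom_module_carrier)
  moreover have "c = Ext_diff R X 0 ?p"
  proof (rule extensionalityI[OF cocycleD(2)[OF c]])
    show "Ext_diff R X 0 ?p \<in> extensional (carrier (F 1))" by (simp add: Ext_diff_def compose_def)
    fix f assume f: "f \<in> carrier (F 1)"
    have "std_bd R X 0 f \<in> Z" using std_bd_cycles[OF X, of f 0] f by simp
    thus "c f = Ext_diff R X 0 ?p f"
      using on_cycles_bd[OF c f] psi(2) f submodule_simps(3)[OF F Z_submodule]
      by (simp add: Ext_diff_def compose_def)
  qed
  ultimately show "c \<in> coboundaries (Ext_complex R X N) (Ext_diff R X) 1"
    by (auto simp: coboundaries_def)
qed

text \<open>A linear section, on the level of free modules, of the presentation.\<close>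

lemma section_exists:
  obtains \<sigma> where "linear_map R (F 0) L \<sigma>" "\<And>f. f \<in> carrier (F 0) \<Longrightarrow> \<pi> (\<sigma> f) = std_aug R X f"
proof -
  define s where "s x = (SOME k. k \<in> carrier L \<and> \<pi> k = x)" for x
  have s: "s x \<in> carrier L" "\<pi> (s x) = x" if "x \<in> carrier X" for x
    using someI_ex[of "\<lambda>k. k \<in> carrier L \<and> \<pi> k = x"] gen[OF that] by (auto simp: s_def \<pi>_def)
  have P: "s \<in> carrier X \<rightarrow> carrier L" using s(1) by blast
  let ?\<sigma> = "lin_ext R L (carrier X) Gen s"
  have l: "linear_map R (F 0) L ?\<sigma>" unfolding std_res_simps by (rule linear_map_lin_ext[OF L inj_on_Gen P])
  have "\<pi> (?\<sigma> f) = std_aug R X f" if f: "f \<in> carrier (F 0)" for f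
  proof (rule linear_map_free_eq[OF R X linear_map_comp[OF l \<pi>_linear, unfolded std_res_simps]
        std_aug_linear[OF X, unfolded std_res_simps] _ f[unfolded std_res_simps]])
    fix c assume "c \<in> (Gen :: _ \<Rightarrow> ('a, 'x) cell) ` carrier X"
    then obtain x where x: "x \<in> carrier X" "c = Gen x" by auto
    show "\<pi> (?\<sigma> (basis_vec R c)) = std_aug R X (basis_vec R c)"
      using x s(2) by (simp only: lin_ext_basis[OF L inj_on_Gen P] std_aug_basis[OF X])
  qed
  thus ?thesis using that l by blast
qed

text \<open>For the harder direction, extend from \<open>Z\<close> to \<open>F 0\<close> as follows. With a section \<open>\<sigma> : F 0 \<rightarrow> L\<close>, every \<open>f\<close> is the sum
  of \<open>f - \<iota> (\<sigma> f)\<close>, which is a cycle, and of \<open>\<iota> (\<sigma> f)\<close>. On the first summand the cocycle itself is defined for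
  all \<open>f\<close>; on the second one it is given by the extension \<open>\<psi>\<close> to \<open>L\<close>.\<close>

lemma coboundary_iff_extends:
  assumes c: "c \<in> E.cocycles 1"
  shows "c \<in> coboundaries (Ext_complex R X N) (Ext_diff R X) 1 \<longleftrightarrow>
     (\<exists>\<psi>. linear_map R L N \<psi> \<and> (\<forall>k\<in>K. on_cycles c (\<iota> k) = \<psi> k))"
proof
  assume "c \<in> coboundaries (Ext_complex R X N) (Ext_diff R X) 1"
  then obtain \<psi> where psi: "linear_map R (F 0) N \<psi>" "\<And>z. z \<in> Z \<Longrightarrow> on_cycles c z = \<psi> z"
    using coboundary_iff[OF c] by auto
  show "\<exists>\<psi>. linear_map R L N \<psi> \<and> (\<forall>k\<in>K. on_cycles c (\<iota> k) = \<psi> k)"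
    using linear_map_comp[OF \<iota>_linear psi(1)] psi(2) linear_mapD(1)[OF \<iota>_K] by auto
next
  assume "\<exists>\<psi>. linear_map R L N \<psi> \<and> (\<forall>k\<in>K. on_cycles c (\<iota> k) = \<psi> k)"
  then obtain \<psi> where psi: "linear_map R L N \<psi>" "\<And>k. k \<in> K \<Longrightarrow> on_cycles c (\<iota> k) = \<psi> k" by auto
  obtain \<sigma> where sg: "linear_map R (F 0) L \<sigma>" "\<And>f. f \<in> carrier (F 0) \<Longrightarrow> \<pi> (\<sigma> f) = std_aug R X f"
    by (rule section_exists) blast
  let ?\<delta> = "\<lambda>f. f \<ominus>\<^bsub>F 0\<^esub> \<iota> (\<sigma> f)"
  have isg: "linear_map R (F 0) (F 0) (\<lambda>f. \<iota> (\<sigma> f))" by (rule linear_map_comp[OF sg(1) \<iota>_linear])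
  have id: "linear_map R (F 0) (F 0) (\<lambda>f. f)" by (rule linear_mapI) auto
  have dl: "linear_map R (F 0) (F 0) ?\<delta>" by (rule linear_map_pointwise(4)[OF F F id isg])
  have dZ: "?\<delta> f \<in> Z" if f: "f \<in> carrier (F 0)" for f
  proof -
    have "std_aug R X (?\<delta> f) = std_aug R X f \<ominus>\<^bsub>X\<^esub> std_aug R X f"
      using linear_map_minus[OF F X std_aug_linear[OF X] f linear_mapD(1)[OF isg f]]
        aug_\<iota>[OF linear_mapD(1)[OF sg(1) f]] sg(2)[OF f] by simp
    thus ?thesis using linear_mapD(1)[OF dl f] linear_mapD(1)[OF std_aug_linear[OF X] f]
      by (simp add: std_cycles_eq module_minus_simps(3)[OF X])
  qed
  have D: "linear_map R (F 0) N (\<lambda>f. on_cycles c (?\<delta> f))"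
    by (rule linear_map_comp[OF linear_map_submodule_codomain[OF dl dZ] on_cycles_linear[OF c]])
  have psi': "linear_map R (F 0) N (\<lambda>f. on_cycles c (?\<delta> f) \<oplus>\<^bsub>N\<^esub> \<psi> (\<sigma> f))"
    by (rule linear_map_pointwise(2)[OF N F D linear_map_comp[OF sg(1) psi(1)]])
  have "on_cycles c z = on_cycles c (?\<delta> z) \<oplus>\<^bsub>N\<^esub> \<psi> (\<sigma> z)" if z: "z \<in> Z" for z
  proof -
    have zF: "z \<in> carrier (F 0)" using z submodule_simps(3)[OF F Z_submodule] by simp
    have k: "\<sigma> z \<in> K" using z sg(2)[OF zF] linear_mapD(1)[OF sg(1) zF] by (simp add: K_def std_cycles_eq)
    have iz: "\<iota> (\<sigma> z) \<in> Z" using linear_mapD(1)[OF \<iota>_K] k by simp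
    have "on_cycles c (?\<delta> z \<oplus>\<^bsub>F 0\<^esub> \<iota> (\<sigma> z)) = on_cycles c (?\<delta> z) \<oplus>\<^bsub>N\<^esub> on_cycles c (\<iota> (\<sigma> z))"
      using linear_mapD(2)[OF on_cycles_linear[OF c]] dZ[OF zF] iz by simp
    thus ?thesis using psi(2)[OF k] linear_mapD(1)[OF isg zF] zF by (simp add: module_minus_simps(5)[OF F])
  qed
  thus "c \<in> coboundaries (Ext_complex R X N) (Ext_diff R X) 1"
    using coboundary_iff[OF c] psi' by auto
qed

text \<open>The map \<open>\<phi>\<close> on \<open>K\<close> represents the class \<open>\<xi>\<close>. Representatives are taken up to maps that extend to \<open>L\<close>, for then every
  linear map on \<open>K\<close> represents a class. Only the values of \<open>\<phi>\<close> on \<open>K\<close> matter.\<close>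

definition rep :: "(('b \<Rightarrow> 'a) \<Rightarrow> 'n) \<Rightarrow> ((('a, 'x) cell \<Rightarrow> 'a) \<Rightarrow> 'n) set \<Rightarrow> bool" where
  "rep \<phi> \<xi> \<longleftrightarrow> (\<exists>c\<in>E.cocycles 1. \<exists>\<psi>. \<xi> = E.coclass 1 c \<and> linear_map R L N \<psi> \<and>
     (\<forall>k\<in>K. \<phi> k = on_cycles c (\<iota> k) \<oplus>\<^bsub>N\<^esub> \<psi> k))"

lemma residue_linear:
  assumes "c \<in> E.cocycles 1" shows "linear_map R KM N (\<lambda>k. on_cycles c (\<iota> k))"
  by (rule linear_map_comp[OF \<iota>_K on_cycles_linear[OF assms]])

lemma rep_linear:
  assumes "rep \<phi> \<xi>" shows "linear_map R KM N \<phi>"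
proof -
  obtain c \<psi> where c: "c \<in> E.cocycles 1" "linear_map R L N \<psi>"
    "\<And>k. k \<in> K \<Longrightarrow> \<phi> k = on_cycles c (\<iota> k) \<oplus>\<^bsub>N\<^esub> \<psi> k" using assms by (auto simp: rep_def)
  have "linear_map R KM N (\<lambda>k. on_cycles c (\<iota> k) \<oplus>\<^bsub>N\<^esub> \<psi> k)"
    by (rule linear_map_pointwise(2)[OF N KM residue_linear[OF c(1)]
          linear_map_submodule_domain[OF c(2) submodule_simps(1)[OF L K_submodule]]])
  thus ?thesis using linear_map_cong[OF KM, of \<phi> "\<lambda>k. on_cycles c (\<iota> k) \<oplus>\<^bsub>N\<^esub> \<psi> k"] c(3) by simp
qed

lemma rep_carrier: "rep \<phi> \<xi> \<Longrightarrow> \<xi> \<in> carrier (Ext R 1 X N)"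
  by (auto simp: rep_def Ext_def E.carrier_cohomology)

lemma rep_exists:
  assumes "\<xi> \<in> carrier (Ext R 1 X N)" shows "\<exists>\<phi>. rep \<phi> \<xi>"
proof -
  obtain c where c: "c \<in> E.cocycles 1" "\<xi> = E.coclass 1 c"
    using assms by (auto simp: Ext_def E.carrier_cohomology)
  have "rep (\<lambda>k. on_cycles c (\<iota> k)) \<xi>" unfolding rep_def
    using c linear_map_pointwise(1)[OF N L] linear_mapD(1)[OF residue_linear[OF c(1)]]
    by (intro bexI[of _ c] exI[of _ "\<lambda>k. \<zero>\<^bsub>N\<^esub>"]) auto
  thus ?thesis by blast
qed

lemma on_cycles_add:
  assumes "k \<in> K"
  shows "on_cycles (c \<oplus>\<^bsub>Ext_complex R X N 1\<^esub> c') (\<iota> k) = on_cycles c (\<iota> k) \<oplus>\<^bsub>N\<^esub> on_cycles c' (\<iota> k)"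
    and "on_cycles (a \<odot>\<^bsub>Ext_complex R X N 1\<^esub> c) (\<iota> k) = a \<odot>\<^bsub>N\<^esub> on_cycles c (\<iota> k)"
proof -
  have "\<iota> k \<in> Z" using linear_mapD(1)[OF \<iota>_K] assms by simp
  hence "basis_vec R (cyc R (\<iota> k)) \<in> carrier (F 1)" using basis_vec_std_res(2)[OF R] by simp
  thus "on_cycles (c \<oplus>\<^bsub>Ext_complex R X N 1\<^esub> c') (\<iota> k) = on_cycles c (\<iota> k) \<oplus>\<^bsub>N\<^esub> on_cycles c' (\<iota> k)"
    "on_cycles (a \<odot>\<^bsub>Ext_complex R X N 1\<^esub> c) (\<iota> k) = a \<odot>\<^bsub>N\<^esub> on_cycles c (\<iota> k)"
    by (simp_all add: on_cycles_def Ext_complex_def hom_module_simps)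
qed

lemma rep_add:
  assumes "rep \<phi> \<xi>" "rep \<phi>' \<xi>'"
  shows "rep (\<lambda>k. \<phi> k \<oplus>\<^bsub>N\<^esub> \<phi>' k) (\<xi> \<oplus>\<^bsub>Ext R 1 X N\<^esub> \<xi>')"
proof -
  obtain c \<psi> where c: "c \<in> E.cocycles 1" "linear_map R L N \<psi>" "\<xi> = E.coclass 1 c"
    "\<And>k. k \<in> K \<Longrightarrow> \<phi> k = on_cycles c (\<iota> k) \<oplus>\<^bsub>N\<^esub> \<psi> k" using assms(1) by (auto simp: rep_def)
  obtain c' \<psi>' where c': "c' \<in> E.cocycles 1" "linear_map R L N \<psi>'" "\<xi>' = E.coclass 1 c'"
    "\<And>k. k \<in> K \<Longrightarrow> \<phi>' k = on_cycles c' (\<iota> k) \<oplus>\<^bsub>N\<^esub> \<psi>' k" using assms(2) by (auto simp: rep_def)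
  note sK = submodule_simps(3)[OF L K_submodule]
  have "\<phi> k \<oplus>\<^bsub>N\<^esub> \<phi>' k = on_cycles (c \<oplus>\<^bsub>Ext_complex R X N 1\<^esub> c') (\<iota> k) \<oplus>\<^bsub>N\<^esub> (\<psi> k \<oplus>\<^bsub>N\<^esub> \<psi>' k)"
    if k: "k \<in> K" for k
    using c(4)[OF k] c'(4)[OF k] on_cycles_add(1)[OF k, of c c'] linear_mapD(1)[OF residue_linear[OF c(1)]]
      linear_mapD(1)[OF residue_linear[OF c'(1)]] linear_mapD(1)[OF c(2)] linear_mapD(1)[OF c'(2)] k sK[OF k]
    by (simp add: NM.M.a_ac)
  thus ?thesis unfolding rep_def Ext_def
    using c c' E.coclass_add submodule_simps(4)[OF E.mod E.cocycles_submodule]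
      linear_map_pointwise(2)[OF N L c(2) c'(2)]
    by (intro bexI[of _ "c \<oplus>\<^bsub>Ext_complex R X N 1\<^esub> c'"] exI[of _ "\<lambda>k. \<psi> k \<oplus>\<^bsub>N\<^esub> \<psi>' k"]) auto
qed

lemma rep_smult:
  assumes a: "a \<in> carrier R" and "rep \<phi> \<xi>"
  shows "rep (\<lambda>k. a \<odot>\<^bsub>N\<^esub> \<phi> k) (a \<odot>\<^bsub>Ext R 1 X N\<^esub> \<xi>)"
proof -
  obtain c \<psi> where c: "c \<in> E.cocycles 1" "linear_map R L N \<psi>" "\<xi> = E.coclass 1 c"
    "\<And>k. k \<in> K \<Longrightarrow> \<phi> k = on_cycles c (\<iota> k) \<oplus>\<^bsub>N\<^esub> \<psi> k" using assms(2) by (auto simp: rep_def)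
  note sK = submodule_simps(3)[OF L K_submodule]
  have "a \<odot>\<^bsub>N\<^esub> \<phi> k = on_cycles (a \<odot>\<^bsub>Ext_complex R X N 1\<^esub> c) (\<iota> k) \<oplus>\<^bsub>N\<^esub> (a \<odot>\<^bsub>N\<^esub> \<psi> k)"
    if k: "k \<in> K" for k
    using c(4)[OF k] on_cycles_add(2)[OF k, of a c] linear_mapD(1)[OF residue_linear[OF c(1)]]
      linear_mapD(1)[OF c(2)] k sK[OF k] a
    by (simp add: NM.smult_r_distr)
  thus ?thesis unfolding rep_def Ext_def
    using c a E.coclass_smult submodule_simps(5)[OF E.mod E.cocycles_submodule]
      linear_map_pointwise(3)[OF N L c(2)]
    by (intro bexI[of _ "a \<odot>\<^bsub>Ext_complex R X N 1\<^esub> c"] exI[of _ "\<lambda>k. a \<odot>\<^bsub>N\<^esub> \<psi> k"]) auto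
qed

lemma rep_zero_iff:
  assumes "rep \<phi> \<xi>"
  shows "\<xi> = \<zero>\<^bsub>Ext R 1 X N\<^esub> \<longleftrightarrow> (\<exists>\<psi>. linear_map R L N \<psi> \<and> (\<forall>k\<in>K. \<phi> k = \<psi> k))"
proof -
  obtain c \<psi> where c: "c \<in> E.cocycles 1" "linear_map R L N \<psi>" "\<xi> = E.coclass 1 c"
    "\<And>k. k \<in> K \<Longrightarrow> \<phi> k = on_cycles c (\<iota> k) \<oplus>\<^bsub>N\<^esub> \<psi> k" using assms by (auto simp: rep_def)
  note sK = submodule_simps(3)[OF L K_submodule]
  have oc: "on_cycles c (\<iota> k) \<in> carrier N" "\<psi> k \<in> carrier N" if "k \<in> K" for k
    using linear_mapD(1)[OF residue_linear[OF c(1)]] linear_mapD(1)[OF c(2)] that sK[OF that] by auto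
  have "\<xi> = \<zero>\<^bsub>Ext R 1 X N\<^esub> \<longleftrightarrow> (\<exists>\<psi>. linear_map R L N \<psi> \<and> (\<forall>k\<in>K. on_cycles c (\<iota> k) = \<psi> k))"
    using E.coclass_eq_zero_iff[OF c(1)] coboundary_iff_extends[OF c(1)] by (simp add: Ext_def c(3))
  also have "\<dots> \<longleftrightarrow> (\<exists>\<psi>. linear_map R L N \<psi> \<and> (\<forall>k\<in>K. \<phi> k = \<psi> k))"
  proof
    assume "\<exists>\<psi>. linear_map R L N \<psi> \<and> (\<forall>k\<in>K. on_cycles c (\<iota> k) = \<psi> k)"
    then obtain \<psi>' where "linear_map R L N \<psi>'" "\<And>k. k \<in> K \<Longrightarrow> on_cycles c (\<iota> k) = \<psi>' k" by auto
    thus "\<exists>\<psi>. linear_map R L N \<psi> \<and> (\<forall>k\<in>K. \<phi> k = \<psi> k)"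
      using linear_map_pointwise(2)[OF N L _ c(2)] c(4) by (intro exI[of _ "\<lambda>k. \<psi>' k \<oplus>\<^bsub>N\<^esub> \<psi> k"]) auto
  next
    assume "\<exists>\<psi>. linear_map R L N \<psi> \<and> (\<forall>k\<in>K. \<phi> k = \<psi> k)"
    then obtain \<psi>' where p': "linear_map R L N \<psi>'" "\<And>k. k \<in> K \<Longrightarrow> \<phi> k = \<psi>' k" by auto
    have "on_cycles c (\<iota> k) = \<psi>' k \<ominus>\<^bsub>N\<^esub> \<psi> k" if k: "k \<in> K" for k
      using c(4)[OF k] p'(2)[OF k] oc[OF k] module_minus_simps(6)[OF N] by simp
    thus "\<exists>\<psi>. linear_map R L N \<psi> \<and> (\<forall>k\<in>K. on_cycles c (\<iota> k) = \<psi> k)"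
      using linear_map_pointwise(4)[OF N L p'(1) c(2)] by auto
  qed
  finally show ?thesis .
qed

text \<open>Composing \<open>\<phi>\<close> with the section \<open>\<sigma>\<close> gives a linear map on \<open>Z\<close>, thus a cocycle. Along \<open>\<iota>\<close> it returns \<open>\<phi>\<close> up to the map
  \<open>k \<mapsto> \<phi> (k - \<sigma> (\<iota> k))\<close>, which is defined on all of \<open>L\<close>.\<close>

lemma rep_onto:
  assumes phi: "linear_map R KM N \<phi>"
  shows "\<exists>\<xi>. rep \<phi> \<xi>"
proof -
  obtain \<sigma> where sg: "linear_map R (F 0) L \<sigma>" "\<And>f. f \<in> carrier (F 0) \<Longrightarrow> \<pi> (\<sigma> f) = std_aug R X f"
    by (rule section_exists) blast
  note sZ = submodule_simps(1,3)[OF F Z_submodule]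
  note sK = submodule_simps(3)[OF L K_submodule]
  have sZK: "linear_map R ZM KM \<sigma>"
    by (rule linear_map_submodule_codomain[OF linear_map_submodule_domain[OF sg(1) sZ(1)]])
      (use sg(2) linear_mapD(1)[OF sg(1)] in \<open>auto simp: K_def std_cycles_eq\<close>)
  obtain c where c: "c \<in> E.cocycles 1" "\<And>z. z \<in> Z \<Longrightarrow> on_cycles c z = \<phi> (\<sigma> z)"
    using cocycle_from_cycles[OF linear_map_comp[OF sZK phi]] by blast
  let ?\<rho> = "\<lambda>k. k \<ominus>\<^bsub>L\<^esub> \<sigma> (\<iota> k)"
  have si: "linear_map R L L (\<lambda>k. \<sigma> (\<iota> k))" by (rule linear_map_comp[OF \<iota>_linear sg(1)])
  have id: "linear_map R L L (\<lambda>k. k)" by (rule linear_mapI) auto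
  have rl: "linear_map R L L ?\<rho>" by (rule linear_map_pointwise(4)[OF L L id si])
  have rK: "?\<rho> k \<in> K" if k: "k \<in> carrier L" for k
  proof -
    have "\<pi> (?\<rho> k) = \<pi> k \<ominus>\<^bsub>X\<^esub> \<pi> k"
      using linear_map_minus[OF L X \<pi>_linear k linear_mapD(1)[OF si k]] sg(2)[OF linear_mapD(1)[OF \<iota>_linear k]]
        aug_\<iota>[OF k] by simp
    thus ?thesis using linear_mapD(1)[OF rl k] linear_mapD(1)[OF \<pi>_linear k]
      by (simp add: K_def module_minus_simps(3)[OF X])
  qed
  have "\<phi> k = on_cycles c (\<iota> k) \<oplus>\<^bsub>N\<^esub> \<phi> (?\<rho> k)" if k: "k \<in> K" for k
  proof -
    have iz: "\<iota> k \<in> Z" using linear_mapD(1)[OF \<iota>_K] k by simp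
    have sk: "\<sigma> (\<iota> k) \<in> K" using linear_mapD(1)[OF sZK] iz by simp
    have "\<phi> (?\<rho> k \<oplus>\<^bsub>L\<^esub> \<sigma> (\<iota> k)) = \<phi> (?\<rho> k) \<oplus>\<^bsub>N\<^esub> \<phi> (\<sigma> (\<iota> k))"
      using linear_mapD(2)[OF phi] rK[OF sK[OF k]] sk by simp
    moreover have "?\<rho> k \<oplus>\<^bsub>L\<^esub> \<sigma> (\<iota> k) = k" using sK[OF k] sK[OF sk] by (simp add: module_minus_simps(5)[OF L])
    ultimately show ?thesis
      using c(2)[OF iz] linear_mapD(1)[OF phi] rK[OF sK[OF k]] sk by (simp add: NM.M.a_comm)
  qed
  moreover have "linear_map R L N (\<lambda>k. \<phi> (?\<rho> k))"
    by (rule linear_map_comp[OF linear_map_submodule_codomain[OF rl rK] phi])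
  ultimately have "rep \<phi> (E.coclass 1 c)" unfolding rep_def using c(1)
    by (intro bexI[of _ c] exI[of _ "\<lambda>k. \<phi> (?\<rho> k)"]) auto
  thus ?thesis by blast
qed

end

text \<open>If \<open>h\<close> matches the generators, then the relations of \<open>X\<close> are among those of \<open>Y\<close>, and the induced map on
  extension modules is restriction of representatives: the same \<open>\<phi>\<close> represents the image.\<close>

lemma presentation_rep_natural:
  assumes PX: "presentation R X N B p" and PY: "presentation R Y N B q"
    and h: "linear_map R X Y h" and hp: "\<And>b. b \<in> B \<Longrightarrow> h (p b) = q b"
    and rep: "presentation.rep R Y N B q \<phi> \<xi>"
  shows "presentation.rep R X N B p \<phi> (Ext_map R 1 X h N \<xi>)"
proof -
  interpret PX: presentation R X N B p by fact
  interpret PY: presentation R Y N B q by fact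
  obtain c \<psi> where c: "c \<in> PY.E.cocycles 1" "linear_map R PX.L N \<psi>" "\<xi> = PY.E.coclass 1 c"
    "\<And>k. k \<in> PY.K \<Longrightarrow> \<phi> k = PY.on_cycles c (PY.\<iota> k) \<oplus>\<^bsub>N\<^esub> \<psi> k"
    using rep by (auto simp: PY.rep_def)
  let ?c = "compose (carrier (std_res R X 1)) c (std_map R X h 1)"
  note e = Ext_map_coclass[OF PX.X PY.X PX.N h c(1)]
  note m = std_map_linear[OF PX.X PY.X h]
  have pi: "PY.\<pi> k = h (PX.\<pi> k)" if "k \<in> carrier PX.L" for k
  proof (rule linear_map_free_eq[OF PX.R PY.X PY.\<pi>_linear linear_map_comp[OF PX.\<pi>_linear h] _ that])
    fix b assume b: "b \<in> B"
    show "PY.\<pi> (basis_vec R b) = h (PX.\<pi> (basis_vec R b))"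
      by (simp only: PX.\<pi>_basis[OF b] PY.\<pi>_basis[OF b] hp[OF b])
  qed
  have io: "PY.\<iota> k = std_map R X h 0 (PX.\<iota> k)" if k: "k \<in> carrier PX.L" for k
  proof (rule linear_map_free_eq[OF PX.R PY.F PY.\<iota>_linear linear_map_comp[OF PX.\<iota>_linear m(1)] _ k])
    fix b assume b: "b \<in> B"
    have "p b \<in> carrier X" using PX.p b by auto
    thus "PY.\<iota> (basis_vec R b) = std_map R X h 0 (PX.\<iota> (basis_vec R b))"
      using b by (simp add: PX.\<iota>_basis PY.\<iota>_basis hp std_map_0_linear(2)[OF PX.X PY.X h])
  qed
  have "\<phi> k = PX.on_cycles ?c (PX.\<iota> k) \<oplus>\<^bsub>N\<^esub> \<psi> k" if k: "k \<in> PX.K" for k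
  proof -
    have kL: "k \<in> carrier PX.L" using k by (simp add: PX.K_def)
    have "k \<in> PY.K" using k pi[OF kL] linear_map_zero[OF PX.X PY.X h] by (simp add: PX.K_def PY.K_def)
    moreover have iz: "PX.\<iota> k \<in> std_cycles R X 0" using linear_mapD(1)[OF PX.\<iota>_K] k by simp
    have "PX.on_cycles ?c (PX.\<iota> k) = PY.on_cycles c (PY.\<iota> k)"
      using basis_vec_std_res(2)[OF PX.R iz] m(3)[OF iz]
      by (simp add: PX.on_cycles_def PY.on_cycles_def compose_def io[OF kL])
    ultimately show ?thesis using c(4) by simp
  qed
  thus ?thesis unfolding PX.rep_def using e c by auto
qed

section \<open>Ideals and finitely generated modules\<close>

text \<open>The degree of the extension modules is kept as \<open>1\<close>, not rewritten to a successor.\<close>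

declare One_nat_def [simp del]

lemma regular_module_simps:
  "carrier (regular_module R) = carrier R" "\<zero>\<^bsub>regular_module R\<^esub> = \<zero>\<^bsub>R\<^esub>"
  "(\<oplus>\<^bsub>regular_module R\<^esub>) = (\<oplus>\<^bsub>R\<^esub>)" "(\<odot>\<^bsub>regular_module R\<^esub>) = (\<otimes>\<^bsub>R\<^esub>)"
  by (simp_all add: regular_module_def)

lemma regular_module_module:
  assumes "cring R" shows "module R (regular_module R)"
proof -
  interpret cring R by fact
  have "\<exists>y\<in>carrier (regular_module R). y \<oplus>\<^bsub>regular_module R\<^esub> x = \<zero>\<^bsub>regular_module R\<^esub>"
    if "x \<in> carrier (regular_module R)" for x
    using that by (intro bexI[of _ "\<ominus>\<^bsub>R\<^esub> x"]) (auto simp: regular_module_simps l_neg)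
  thus ?thesis
    by (intro moduleI abelian_groupI assms)
      (auto simp: regular_module_simps a_ac l_distr r_distr m_assoc)
qed

lemma submodule_regular_iff_ideal:
  assumes "cring R" shows "submodule J R (regular_module R) \<longleftrightarrow> ideal J R"
proof -
  interpret cring R by fact
  have sg: "subgroup J (add_monoid (regular_module R)) \<longleftrightarrow> subgroup J (add_monoid R)"
    by (simp add: subgroup_def m_inv_def regular_module_simps)
  show ?thesis
  proof
    assume J: "submodule J R (regular_module R)"
    note s = submodule_simps[OF regular_module_module[OF assms] J, unfolded regular_module_simps]
    show "ideal J R"
    proof (rule idealI[OF ring_axioms])
      show "subgroup J (add_monoid R)" using sg submodule.axioms(1)[OF J] by simp
      fix a x assume a: "a \<in> J" and x: "x \<in> carrier R"
      show "x \<otimes>\<^bsub>R\<^esub> a \<in> J" by (rule s(5)[OF x a])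
      thus "a \<otimes>\<^bsub>R\<^esub> x \<in> J" using m_comm[OF s(3)[OF a] x] by simp
    qed
  next
    assume J: "ideal J R"
    show "submodule J R (regular_module R)"
      by (rule submoduleI'[OF regular_module_module[OF assms]])
        (use J in \<open>auto simp: regular_module_simps ideal.Icarr ideal.I_l_closed
          additive_subgroup.a_closed[OF ideal.axioms(1)] additive_subgroup.zero_closed[OF ideal.axioms(1)]\<close>)
  qed
qed

text \<open>The scalars that carry \<open>y\<close> into a submodule form an ideal.\<close>

lemma genideal_smult_closed:
  fixes A :: "('a, 'x) module"
  assumes A: "module R A" and U: "submodule U R A" and G: "G \<subseteq> carrier R" and y: "y \<in> carrier A"
    and mult: "\<And>f. f \<in> G \<Longrightarrow> f \<odot>\<^bsub>A\<^esub> y \<in> U" and a: "a \<in> Idl\<^bsub>R\<^esub> G"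
  shows "a \<odot>\<^bsub>A\<^esub> y \<in> U"
proof -
  interpret A: module R A by (rule A)
  note R = A.R.is_cring
  have "linear_map R (regular_module R) A (\<lambda>c. c \<odot>\<^bsub>A\<^esub> y)"
    by (rule linear_mapI) (use y in \<open>auto simp: regular_module_simps A.smult_l_distr A.smult_assoc1\<close>)
  from preimage_submodule[OF regular_module_module[OF R] A this U]
  have "ideal {c \<in> carrier R. c \<odot>\<^bsub>A\<^esub> y \<in> U} R"
    unfolding submodule_regular_iff_ideal[OF R] by (simp add: regular_module_simps)
  hence "Idl\<^bsub>R\<^esub> G \<subseteq> {c \<in> carrier R. c \<odot>\<^bsub>A\<^esub> y \<in> U}"
    using mult G by (intro A.R.genideal_minimal) auto
  thus ?thesis using a by auto
qed

text \<open>Induction on the basis. The coefficients at \<open>b\<close> of the elements of \<open>K\<close> form an ideal, which has a finite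
  generating set \<open>A\<close>. Elements of \<open>K\<close> with these coefficients, together with generators of the
  submodule of all \<open>k\<close> in \<open>K\<close> with \<open>k b = 0\<close>, generate \<open>K\<close>. Generation is expressed by submodules of the free module on the whole type,
  which does not change in the induction.\<close>

lemma noetherian_free_submodule_finitely_generated:
  assumes "cring R" "noetherian_ring R" "finite S" "submodule K R (free_module R S)"
  shows "\<exists>W. finite W \<and> W \<subseteq> K \<and> (\<forall>U. submodule U R (free_module R UNIV) \<longrightarrow> W \<subseteq> U \<longrightarrow> K \<subseteq> U)"
  using assms(3,4)
proof (induction S arbitrary: K)
  case empty
  have "K \<subseteq> {\<zero>\<^bsub>free_module R UNIV\<^esub>}"
    using submodule_simps(1)[OF free_module_module[OF assms(1)] empty]
    by (fastforce simp: free_module_simps)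
  thus ?case using submodule_simps(2)[OF free_module_module[OF assms(1)]]
    by (intro exI[of _ "{}"]) blast
next
  case (insert b S)
  let ?F = "free_module R UNIV"
  interpret R: cring R by fact
  have F: "module R ?F" by (rule free_module_module[OF assms(1)])
  interpret F: module R ?F by (rule F)
  have RR: "module R (regular_module R)" by (rule regular_module_module[OF assms(1)])
  have K: "submodule K R ?F" by (rule free_module_submodule[OF assms(1) insert.prems subset_UNIV])
  note sK = submodule_simps[OF F K]
  have ev: "linear_map R ?F (regular_module R) (\<lambda>k. k b)"
    by (rule linear_mapI) (auto simp: free_module_simps regular_module_simps)
  have "ideal ((\<lambda>k. k b) ` K) R"
    using image_submodule[OF F RR ev K] submodule_regular_iff_ideal[OF assms(1)] by blast
  from noetherian_ring.finetely_gen[OF assms(2) this]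
  obtain A where A: "A \<subseteq> carrier R" "finite A" "(\<lambda>k. k b) ` K = Idl\<^bsub>R\<^esub> A"
    by (elim exE conjE) (rule that)
  have "A \<subseteq> (\<lambda>k. k b) ` K" unfolding A(3) by (rule R.genideal_self[OF A(1)])
  hence "\<forall>a\<in>A. \<exists>k\<in>K. k b = a" by auto
  then obtain g where g: "\<And>a. a \<in> A \<Longrightarrow> g a \<in> K" "\<And>a. a \<in> A \<Longrightarrow> g a b = a" by metis
  let ?K = "{k \<in> K. k b = \<zero>\<^bsub>R\<^esub>}"
  have cK: "k \<in> carrier (free_module R (insert b S))" if "k \<in> K" for k
    using submodule_simps(3)[OF free_module_module[OF assms(1)] insert.prems that] .
  have "submodule ?K R (free_module R S)"
  proof (rule submoduleI'[OF free_module_module[OF assms(1)]])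
    show "?K \<subseteq> carrier (free_module R S)" using cK by (fastforce simp: free_module_simps)
  qed (use sK in \<open>auto simp: free_module_simps\<close>)
  then obtain W where W: "finite W" "W \<subseteq> ?K"
      "\<And>U. submodule U R ?F \<Longrightarrow> W \<subseteq> U \<Longrightarrow> ?K \<subseteq> U"
    using insert.IH by meson
  have "K \<subseteq> U" if U: "submodule U R ?F" "W \<union> g ` A \<subseteq> U" for U
  proof
    fix k assume k: "k \<in> K"
    note sU = submodule_simps[OF F U(1)]
    have "submodule (U \<inter> K) R ?F"
      by (rule submoduleI'[OF F]) (use sU sK in auto)
    hence "ideal ((\<lambda>k. k b) ` (U \<inter> K)) R"
      using image_submodule[OF F RR ev] submodule_regular_iff_ideal[OF assms(1)] by blast
    moreover have "A \<subseteq> (\<lambda>k. k b) ` (U \<inter> K)"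
    proof
      fix a assume "a \<in> A"
      thus "a \<in> (\<lambda>k. k b) ` (U \<inter> K)" using g U(2) by (intro image_eqI[of _ _ "g a"]) auto
    qed
    ultimately have "Idl\<^bsub>R\<^esub> A \<subseteq> (\<lambda>k. k b) ` (U \<inter> K)" by (rule R.genideal_minimal)
    moreover have "k b \<in> Idl\<^bsub>R\<^esub> A" using A(3) k by blast
    ultimately obtain y where y: "y \<in> U" "y \<in> K" "y b = k b" by auto
    have kF: "k \<in> carrier ?F" "y \<in> carrier ?F" using sK(3) k y by auto
    have "(k \<ominus>\<^bsub>?F\<^esub> y) b = k b \<ominus>\<^bsub>regular_module R\<^esub> y b"
      by (rule linear_map_minus[OF F RR ev kF])
    also have "\<dots> = \<zero>\<^bsub>R\<^esub>"
      using y kF module_minus_simps(3)[OF RR] by (simp add: regular_module_simps free_module_simps)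
    finally have "k \<ominus>\<^bsub>?F\<^esub> y \<in> ?K" using sK(7) k y by simp
    hence "k \<ominus>\<^bsub>?F\<^esub> y \<in> U" using W(3)[OF U(1)] U(2) by blast
    hence "(k \<ominus>\<^bsub>?F\<^esub> y) \<oplus>\<^bsub>?F\<^esub> y \<in> U" using sU(4) y by simp
    thus "k \<in> U" using kF by (simp add: module_minus_simps(5)[OF F])
  qed
  thus ?case using W A(2) g(1) by (intro exI[of _ "W \<union> g ` A"]) auto
qed

lemma submodule_span_minimal:
  assumes "submodule U R A" "S \<subseteq> U" shows "submodule_span R A S \<subseteq> U"
  using assms by (auto simp: submodule_span_def)

lemma submodule_span_submodule:
  assumes "module R A" "S \<subseteq> carrier A"
  shows "submodule (submodule_span R A S) R A"
proof (rule submoduleI'[OF assms(1)])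
  note s = submodule_simps[OF assms(1)]
  show "submodule_span R A S \<subseteq> carrier A"
    by (rule submodule_span_minimal[OF module.carrier_is_submodule[OF assms(1)] assms(2)])
qed (use submodule_simps[OF assms(1)] in \<open>auto simp: submodule_span_def\<close>)

lemma ideal_smult_submodule:
  assumes "module R A" "ideal J R"
  shows "submodule (ideal_smult R J A) R A"
proof -
  interpret module R A by fact
  show ?thesis unfolding ideal_smult_def
    by (rule submodule_span_submodule[OF assms(1)]) (use ideal.Icarr[OF assms(2)] in auto)
qed

lemma ideal_smult_mem: "a \<in> J \<Longrightarrow> x \<in> carrier A \<Longrightarrow> a \<odot>\<^bsub>A\<^esub> x \<in> ideal_smult R J A"
  by (auto simp: ideal_smult_def submodule_span_def)

lemma ideal_smult_mono:
  assumes "J \<subseteq> J'" shows "ideal_smult R J A \<subseteq> ideal_smult R J' A"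
proof -
  have "{a \<odot>\<^bsub>A\<^esub> x | a x. a \<in> J \<and> x \<in> carrier A} \<subseteq> {a \<odot>\<^bsub>A\<^esub> x | a x. a \<in> J' \<and> x \<in> carrier A}"
    using assms by blast
  thus ?thesis unfolding ideal_smult_def submodule_span_def by (intro Inter_anti_mono) auto
qed

lemma ideal_power:
  assumes "cring R" "ideal I R"
  shows "ideal (I [^]\<^bsub>ideals_set R\<^esub> (n::nat)) R"
    and "I [^]\<^bsub>ideals_set R\<^esub> (0::nat) = carrier R"
    and "I [^]\<^bsub>ideals_set R\<^esub> Suc n = (I [^]\<^bsub>ideals_set R\<^esub> n) \<cdot>\<^bsub>R\<^esub> I"
    and "I [^]\<^bsub>ideals_set R\<^esub> Suc n \<subseteq> I [^]\<^bsub>ideals_set R\<^esub> n"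
proof -
  interpret cring R by fact
  show z: "I [^]\<^bsub>ideals_set R\<^esub> (0::nat) = carrier R"
    by (simp add: nat_pow_def ideals_set_def)
  show s: "I [^]\<^bsub>ideals_set R\<^esub> Suc n = (I [^]\<^bsub>ideals_set R\<^esub> n) \<cdot>\<^bsub>R\<^esub> I" for n :: nat
    by (simp add: nat_pow_def ideals_set_def)
  show i: "ideal (I [^]\<^bsub>ideals_set R\<^esub> (n::nat)) R" for n
  proof (induction n)
    case 0 thus ?case unfolding z by (rule oneideal)
  next
    case (Suc n) thus ?case unfolding s by (rule ideal_prod_is_ideal[OF _ assms(2)])
  qed
  show "I [^]\<^bsub>ideals_set R\<^esub> Suc n \<subseteq> I [^]\<^bsub>ideals_set R\<^esub> n"
    unfolding s using ideal_prod_inter[OF i assms(2)] by blast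
qed

lemma linear_map_quot_proj:
  assumes M: "module R M" and V: "submodule V R M" and U: "submodule U R M" and VU: "V \<subseteq> U"
  shows "linear_map R (quot_module M V) (quot_module M U) (quot_map M U (\<lambda>x. x))"
    and "x \<in> carrier M \<Longrightarrow> quot_map M U (\<lambda>x. x) (V +>\<^bsub>M\<^esub> x) = U +>\<^bsub>M\<^esub> x"
proof -
  interpret module R M by fact
  have id: "linear_map R M M (\<lambda>x. x)" by (rule linear_mapI) auto
  have q: "quot_map M U (\<lambda>x. x) (V +>\<^bsub>M\<^esub> x) = U +>\<^bsub>M\<^esub> x" if "x \<in> carrier M" for x
    using quot_map_coset[OF M V M U id _ that] VU by simp
  thus "x \<in> carrier M \<Longrightarrow> quot_map M U (\<lambda>x. x) (V +>\<^bsub>M\<^esub> x) = U +>\<^bsub>M\<^esub> x" .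
  show "linear_map R (quot_module M V) (quot_module M U) (quot_map M U (\<lambda>x. x))"
    by (rule linear_mapI)
      (auto simp: carrier_quot_module quot_module_add[OF M V] quot_module_add[OF M U]
        quot_module_smult[OF M V] quot_module_smult[OF M U] q)
qed

locale generated_module =
  fixes R :: "('a, 'r) ring_scheme" and M :: "('a, 'm) module" and S :: "'m set"
  assumes M: "module R M" and S: "S \<subseteq> carrier M" and span: "submodule_span R M S = carrier M"
begin

sublocale MM: module R M by (rule M)

abbreviation "L \<equiv> free_module R S"

definition ev :: "('m \<Rightarrow> 'a) \<Rightarrow> 'm" where "ev = lin_ext R M S (\<lambda>m. m) (\<lambda>m. m)"

lemma L: "module R L" by (rule free_module_module[OF MM.R.is_cring])

lemma ev_linear: "linear_map R L M ev"
  using linear_map_lin_ext[OF M inj_on_id2, of "\<lambda>m. m" S] S by (auto simp: ev_def)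

lemma ev_basis: "m \<in> S \<Longrightarrow> ev (basis_vec R m) = m"
  using lin_ext_basis[OF M inj_on_id2, of "\<lambda>m. m" S] S by (auto simp: ev_def)

lemma ev_onto:
  assumes "x \<in> carrier M" obtains k where "k \<in> carrier L" "ev k = x"
proof -
  have "submodule_span R M S \<subseteq> ev ` carrier L"
  proof (rule submodule_span_minimal)
    show "submodule (ev ` carrier L) R M"
      by (rule image_submodule[OF L M ev_linear module.carrier_is_submodule[OF L]])
    show "S \<subseteq> ev ` carrier L"
    proof
      fix m assume "m \<in> S"
      thus "m \<in> ev ` carrier L"
        using ev_basis basis_vec_carrier[OF MM.R.is_cring] by (intro image_eqI[of _ _ "basis_vec R m"]) auto
    qed
  qed
  thus ?thesis using that assms span by blast
qed

text \<open>Generators of \<open>M\<close> also generate every quotient \<open>M / U\<close>. The free module \<open>L\<close> is the same for all \<open>U\<close>, and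
  the relations of \<open>M / U\<close> are the preimage of \<open>U\<close> in \<open>L\<close>.\<close>

lemma quotient_presentation:
  assumes U: "submodule U R M" and N: "module R N"
  shows "presentation R (quot_module M U) N S (\<lambda>m. U +>\<^bsub>M\<^esub> m)"
    and "presentation.K R (quot_module M U) S (\<lambda>m. U +>\<^bsub>M\<^esub> m) = {k \<in> carrier L. ev k \<in> U}"
proof -
  note R = MM.R.is_cring
  have Q: "module R (quot_module M U)" by (rule quot_module_module[OF M U])
  have P: "(\<lambda>m. U +>\<^bsub>M\<^esub> m) \<in> S \<rightarrow> carrier (quot_module M U)" using S by (auto simp: carrier_quot_module)
  have e: "lin_ext R (quot_module M U) S (\<lambda>b. b) (\<lambda>m. U +>\<^bsub>M\<^esub> m) k = U +>\<^bsub>M\<^esub> ev k"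
    if k: "k \<in> carrier L" for k
  proof (rule linear_map_free_eq[OF R Q _ linear_map_comp[OF ev_linear linear_map_proj[OF M U]] _ k])
    show "linear_map R L (quot_module M U) (lin_ext R (quot_module M U) S (\<lambda>b. b) (\<lambda>m. U +>\<^bsub>M\<^esub> m))"
      using linear_map_lin_ext[OF Q inj_on_id2 P] by simp
    fix c assume c: "c \<in> S"
    show "lin_ext R (quot_module M U) S (\<lambda>b. b) (\<lambda>m. U +>\<^bsub>M\<^esub> m) (basis_vec R c) = U +>\<^bsub>M\<^esub> ev (basis_vec R c)"
      using lin_ext_basis[OF Q inj_on_id2 P c] ev_basis[OF c] by simp
  qed
  show pr: "presentation R (quot_module M U) N S (\<lambda>m. U +>\<^bsub>M\<^esub> m)"
  proof (rule presentation.intro[OF Q N P])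
    fix C assume "C \<in> carrier (quot_module M U)"
    then obtain x where x: "x \<in> carrier M" "C = U +>\<^bsub>M\<^esub> x" by (auto simp: carrier_quot_module)
    obtain k where k: "k \<in> carrier L" "ev k = x" by (rule ev_onto[OF x(1)])
    thus "\<exists>k\<in>carrier L. lin_ext R (quot_module M U) S (\<lambda>b. b) (\<lambda>m. U +>\<^bsub>M\<^esub> m) k = C"
      using e x by auto
  qed
  show "presentation.K R (quot_module M U) S (\<lambda>m. U +>\<^bsub>M\<^esub> m) = {k \<in> carrier L. ev k \<in> U}"
    unfolding presentation.K_def[OF pr] presentation.\<pi>_def[OF pr] zero_quot_module
    using e coset_eq_self_iff[OF M U] linear_mapD(1)[OF ev_linear] by auto
qed

end

section \<open>First generalized local cohomology\<close>

text \<open>The first generalized local cohomology module \<open>H\<close> of \<open>M\<close> and a module \<open>N\<close> in which no nonzero element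
  is killed by \<open>I\<close>. The relations of \<open>M / I\<^sup>n M\<close> form the submodule \<open>Kn n\<close> of \<open>L\<close>, these submodules decrease with \<open>n\<close>,
  and the transition maps of the direct limit restrict linear maps on \<open>Kn n\<close> to \<open>Kn (n + 1)\<close>.\<close>

locale torsion_free_setting = generated_module R M S
  for R :: "('a, 'r) ring_scheme" and M :: "('a, 'm) module" and S :: "'m set" +
  fixes I :: "'a set" and N :: "('a, 'n) module"
  assumes I: "ideal I R" and N: "module R N"
    and tf: "\<And>x. x \<in> carrier N \<Longrightarrow> (\<And>a. a \<in> I \<Longrightarrow> a \<odot>\<^bsub>N\<^esub> x = \<zero>\<^bsub>N\<^esub>) \<Longrightarrow> x = \<zero>\<^bsub>N\<^esub>"
begin

sublocale NN: module R N by (rule N)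

abbreviation "Ip n \<equiv> I [^]\<^bsub>ideals_set R\<^esub> (n::nat)"
abbreviation "J n \<equiv> ideal_smult R (Ip n) M"
abbreviation "X n \<equiv> power_quot R I M n"
abbreviation "p n \<equiv> (\<lambda>m. J n +>\<^bsub>M\<^esub> m)"
abbreviation "H \<equiv> gen_local_cohomology R I 1 M N"

definition Kn :: "nat \<Rightarrow> ('m \<Rightarrow> 'a) set" where "Kn n = {k \<in> carrier L. ev k \<in> J n}"

abbreviation "KM n \<equiv> L\<lparr>carrier := Kn n\<rparr>"

lemmas R = MM.R.is_cring
lemmas Ip = ideal_power[OF R I]

lemma J: "submodule (J n) R M" by (rule ideal_smult_submodule[OF M Ip(1)])

lemma J_Suc: "J (Suc n) \<subseteq> J n" by (rule ideal_smult_mono[OF Ip(4)])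

lemma Kn: "submodule (Kn n) R L" unfolding Kn_def by (rule preimage_submodule[OF L M ev_linear J])
lemma KM: "module R (KM n)" by (rule submodule_module[OF L Kn])

lemma Kn_mono: "Kn (n + k) \<subseteq> Kn n"
proof (induction k)
  case (Suc k)
  have "Kn (Suc (n + k)) \<subseteq> Kn (n + k)" using J_Suc[of "n + k"] by (auto simp: Kn_def)
  thus ?case using Suc by simp
qed simp

lemma X: "module R (X n)" unfolding power_quot_def by (rule quot_module_module[OF M J])

lemma X_pres: "presentation R (X n) N S (p n)"
  unfolding power_quot_def by (rule quotient_presentation(1)[OF J N])

lemma X_K: "presentation.K R (X n) S (p n) = Kn n"
  unfolding power_quot_def Kn_def by (rule quotient_presentation(2)[OF J N])

lemma proj_linear: "linear_map R (X (Suc n)) (X n) (power_quot_proj R I M n)"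
  and proj_p: "m \<in> S \<Longrightarrow> power_quot_proj R I M n (p (Suc n) m) = p n m"
  unfolding power_quot_def power_quot_proj_def
  using linear_map_quot_proj[OF M J J J_Suc] S by blast+

abbreviation "A n \<equiv> Ext R 1 (X n) N"
abbreviation "t n \<equiv> Ext_map R 1 (X (Suc n)) (power_quot_proj R I M n) N"

sublocale D: direct_system R A t
  by (rule direct_system.intro) (rule Ext_module[OF X N], rule Ext_map_linear[OF X X N proj_linear])

lemma H_eq: "H = direct_limit A t" by (simp add: gen_local_cohomology_def)

lemma H: "module R H" unfolding H_eq by (rule D.direct_limit_module)

abbreviation "xrep n \<equiv> presentation.rep R (X n) N S (p n)"

lemma xrep_transition: "xrep n \<phi> \<xi> \<Longrightarrow> xrep (n + k) \<phi> (transition t n k \<xi>)"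
proof (induction k)
  case (Suc k)
  have "xrep (Suc (n + k)) \<phi> (t (n + k) (transition t n k \<xi>))"
    by (rule presentation_rep_natural[OF X_pres X_pres proj_linear proj_p Suc.IH[OF Suc.prems]])
  thus ?case by simp
qed simp

text \<open>An element of \<open>H\<close> is represented by a linear map from some \<open>Kn n\<close> to \<open>N\<close>.\<close>

definition repH where "repH n \<phi> h \<longleftrightarrow> (\<exists>\<xi>. h = D.cls n \<xi> \<and> xrep n \<phi> \<xi>)"

lemma repH_exists:
  assumes "h \<in> carrier H" shows "\<exists>n \<phi>. repH n \<phi> h"
proof -
  obtain n \<xi> where x: "\<xi> \<in> carrier (A n)" "h = D.cls n \<xi>"
    using assms by (auto simp: H_eq D.carrier_direct_limit)
  thus ?thesis using presentation.rep_exists[OF X_pres x(1)] by (auto simp: repH_def)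
qed

lemma repH_linear: "repH n \<phi> h \<Longrightarrow> linear_map R (KM n) N \<phi>"
  using presentation.rep_linear[OF X_pres, unfolded X_K] by (auto simp: repH_def)

lemma repHI: "xrep n \<phi> \<xi> \<Longrightarrow> repH n \<phi> (D.cls n \<xi>)"
  by (auto simp: repH_def)

lemma repHE:
  assumes "repH n \<phi> h"
  obtains \<xi> where "h = D.cls n \<xi>" "xrep n \<phi> \<xi>" "\<xi> \<in> carrier (A n)"
proof -
  obtain \<xi> where x: "h = D.cls n \<xi>" "xrep n \<phi> \<xi>" using assms by (auto simp: repH_def)
  show ?thesis by (rule that[OF x presentation.rep_carrier[OF X_pres x(2)]])
qed

lemma repH_mono:
  assumes "repH n \<phi> h" shows "repH (n + k) \<phi> h"
proof -
  obtain \<xi> where x: "h = D.cls n \<xi>" "xrep n \<phi> \<xi>" "\<xi> \<in> carrier (A n)" by (rule repHE[OF assms])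
  show ?thesis using repHI[OF xrep_transition[OF x(2), of k]] D.cls_transition[OF x(3), of k] x(1) by simp
qed

lemma repH_add:
  assumes "repH n \<phi> h" "repH n \<phi>' h'"
  shows "repH n (\<lambda>k. \<phi> k \<oplus>\<^bsub>N\<^esub> \<phi>' k) (h \<oplus>\<^bsub>H\<^esub> h')"
proof -
  obtain \<xi> where x: "h = D.cls n \<xi>" "xrep n \<phi> \<xi>" "\<xi> \<in> carrier (A n)" by (rule repHE[OF assms(1)])
  obtain \<xi>' where x': "h' = D.cls n \<xi>'" "xrep n \<phi>' \<xi>'" "\<xi>' \<in> carrier (A n)" by (rule repHE[OF assms(2)])
  show ?thesis
    using repHI[OF presentation.rep_add[OF X_pres x(2) x'(2)]] D.cls_add[OF x(3) x'(3)]
    by (simp add: H_eq x(1) x'(1))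
qed

lemma repH_smult:
  assumes a: "a \<in> carrier R" and r: "repH n \<phi> h"
  shows "repH n (\<lambda>k. a \<odot>\<^bsub>N\<^esub> \<phi> k) (a \<odot>\<^bsub>H\<^esub> h)"
proof -
  obtain \<xi> where x: "h = D.cls n \<xi>" "xrep n \<phi> \<xi>" "\<xi> \<in> carrier (A n)" by (rule repHE[OF r])
  show ?thesis
    using repHI[OF presentation.rep_smult[OF X_pres a x(2)]] D.cls_smult[OF a x(3)]
    by (simp add: H_eq x(1))
qed

lemma repH_onto:
  assumes "linear_map R (KM n) N \<phi>" shows "\<exists>h. repH n \<phi> h"
  using presentation.rep_onto[OF X_pres, unfolded X_K, OF assms] by (auto simp: repH_def)

lemma repH_carrier:
  assumes "repH n \<phi> h" shows "h \<in> carrier H"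
  by (rule repHE[OF assms]) (simp add: H_eq D.cls_carrier)

lemma tf_power:
  assumes "x \<in> carrier N" "\<And>a. a \<in> Ip n \<Longrightarrow> a \<odot>\<^bsub>N\<^esub> x = \<zero>\<^bsub>N\<^esub>"
  shows "x = \<zero>\<^bsub>N\<^esub>"
  using assms
proof (induction n arbitrary: x)
  case 0
  have "\<one>\<^bsub>R\<^esub> \<odot>\<^bsub>N\<^esub> x = \<zero>\<^bsub>N\<^esub>" by (rule 0(2)) (simp only: Ip(2) MM.R.one_closed)
  thus ?case using 0 by simp
next
  case (Suc n)
  have "b \<odot>\<^bsub>N\<^esub> x = \<zero>\<^bsub>N\<^esub>" if b: "b \<in> I" for b
  proof (rule Suc.IH)
    have bR: "b \<in> carrier R" by (rule ideal.Icarr[OF I b])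
    thus "b \<odot>\<^bsub>N\<^esub> x \<in> carrier N" using Suc by simp
    fix a assume a: "a \<in> Ip n"
    have "(a \<otimes>\<^bsub>R\<^esub> b) \<odot>\<^bsub>N\<^esub> x = \<zero>\<^bsub>N\<^esub>"
      by (rule Suc.prems(2)) (simp only: Ip(3) ideal_prod.prod[OF a b])
    thus "a \<odot>\<^bsub>N\<^esub> (b \<odot>\<^bsub>N\<^esub> x) = \<zero>\<^bsub>N\<^esub>"
      using bR ideal.Icarr[OF Ip(1) a] Suc by (simp add: NN.smult_assoc1)
  qed
  thus ?case by (rule tf[OF Suc.prems(1)])
qed

text \<open>An element of the limit vanishes if a representative becomes extendable to \<open>L\<close> at some later stage
  \<open>n + l\<close>. Then it is extendable at stage \<open>n\<close> already: for \<open>k\<close> in \<open>Kn n\<close>, the difference of \<open>\<phi> k\<close> and \<open>\<psi> k\<close> is killed by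
  the power \<open>n + l\<close> of \<open>I\<close>, which moves \<open>k\<close> into \<open>Kn (n + l)\<close>, and so it is zero.\<close>

lemma repH_zero_iff:
  assumes r: "repH n \<phi> h"
  shows "h = \<zero>\<^bsub>H\<^esub> \<longleftrightarrow> (\<exists>\<psi>. linear_map R L N \<psi> \<and> (\<forall>k\<in>Kn n. \<phi> k = \<psi> k))"
proof -
  obtain \<xi> where x: "h = D.cls n \<xi>" "xrep n \<phi> \<xi>" and xc: "\<xi> \<in> carrier (A n)" by (rule repHE[OF r])
  have "h = \<zero>\<^bsub>H\<^esub> \<longleftrightarrow> (\<exists>l. transition t n l \<xi> = \<zero>\<^bsub>A (n + l)\<^esub>)"
    unfolding x(1) H_eq by (rule D.cls_eq_zero_iff[OF xc])
  also have "\<dots> \<longleftrightarrow> (\<exists>l \<psi>. linear_map R L N \<psi> \<and> (\<forall>k\<in>Kn (n + l). \<phi> k = \<psi> k))"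
    using presentation.rep_zero_iff[OF X_pres xrep_transition[OF x(2)]] by (simp add: X_K)
  also have "\<dots> \<longleftrightarrow> (\<exists>\<psi>. linear_map R L N \<psi> \<and> (\<forall>k\<in>Kn n. \<phi> k = \<psi> k))"
  proof
    assume "\<exists>l \<psi>. linear_map R L N \<psi> \<and> (\<forall>k\<in>Kn (n + l). \<phi> k = \<psi> k)"
    then obtain l \<psi> where p: "linear_map R L N \<psi>" "\<And>k. k \<in> Kn (n + l) \<Longrightarrow> \<phi> k = \<psi> k" by auto
    have "\<phi> k = \<psi> k" if k: "k \<in> Kn n" for k
    proof -
      have kL: "k \<in> carrier L" using k by (simp add: Kn_def)
      have v: "\<phi> k \<in> carrier N" "\<psi> k \<in> carrier N"
        using linear_mapD(1)[OF repH_linear[OF r]] linear_mapD(1)[OF p(1)] k kL by auto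
      have "\<phi> k \<ominus>\<^bsub>N\<^esub> \<psi> k = \<zero>\<^bsub>N\<^esub>"
      proof (rule tf_power)
        show "\<phi> k \<ominus>\<^bsub>N\<^esub> \<psi> k \<in> carrier N" using v by simp
        fix a assume a: "a \<in> Ip (n + l)"
        have aR: "a \<in> carrier R" by (rule ideal.Icarr[OF Ip(1) a])
        have "ev (a \<odot>\<^bsub>L\<^esub> k) \<in> J (n + l)"
          using linear_mapD(3)[OF ev_linear aR kL] ideal_smult_mem[OF a linear_mapD(1)[OF ev_linear kL]] by simp
        hence "a \<odot>\<^bsub>L\<^esub> k \<in> Kn (n + l)" using module.smult_closed[OF L aR kL] by (simp add: Kn_def)
        hence "\<phi> (a \<odot>\<^bsub>L\<^esub> k) = \<psi> (a \<odot>\<^bsub>L\<^esub> k)" by (rule p(2))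
        hence "a \<odot>\<^bsub>N\<^esub> \<phi> k = a \<odot>\<^bsub>N\<^esub> \<psi> k"
          using linear_mapD(3)[OF repH_linear[OF r] aR] linear_mapD(3)[OF p(1) aR kL] k by simp
        thus "a \<odot>\<^bsub>N\<^esub> (\<phi> k \<ominus>\<^bsub>N\<^esub> \<psi> k) = \<zero>\<^bsub>N\<^esub>"
          using linear_map_minus[OF N N linear_map_smult[OF N aR] v] aR v
          by (simp add: module_minus_simps(3)[OF N])
      qed
      thus ?thesis using v module_minus_simps(4)[OF N] by simp
    qed
    thus "\<exists>\<psi>. linear_map R L N \<psi> \<and> (\<forall>k\<in>Kn n. \<phi> k = \<psi> k)" using p(1) by blast
  next
    assume "\<exists>\<psi>. linear_map R L N \<psi> \<and> (\<forall>k\<in>Kn n. \<phi> k = \<psi> k)"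
    thus "\<exists>l \<psi>. linear_map R L N \<psi> \<and> (\<forall>k\<in>Kn (n + l). \<phi> k = \<psi> k)" by (intro exI[of _ 0]) simp
  qed
  finally show ?thesis .
qed

lemma repH_unique:
  assumes r: "repH n \<phi> h" and r': "repH n \<phi>' h'" and eq: "\<And>k. k \<in> Kn n \<Longrightarrow> \<phi> k = \<phi>' k"
  shows "h = h'"
proof -
  interpret HM: module R H by (rule H)
  note hc = repH_carrier[OF r] repH_carrier[OF r']
  have m1: "\<ominus>\<^bsub>R\<^esub> \<one>\<^bsub>R\<^esub> \<in> carrier R" by simp
  note rr = repH_add[OF r repH_smult[OF m1 r']]
  have "\<phi> k \<oplus>\<^bsub>N\<^esub> (\<ominus>\<^bsub>R\<^esub> \<one>\<^bsub>R\<^esub>) \<odot>\<^bsub>N\<^esub> \<phi>' k = \<zero>\<^bsub>N\<^esub>" if k: "k \<in> Kn n" for k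
    using eq[OF k] linear_mapD(1)[OF repH_linear[OF r']] k
    by (simp add: module_neg_smult[OF N, symmetric] NN.M.r_neg)
  hence "h \<oplus>\<^bsub>H\<^esub> (\<ominus>\<^bsub>R\<^esub> \<one>\<^bsub>R\<^esub>) \<odot>\<^bsub>H\<^esub> h' = \<zero>\<^bsub>H\<^esub>"
    using iffD2[OF repH_zero_iff[OF rr]] linear_map_pointwise(1)[OF N L] by blast
  thus ?thesis
    using hc module_minus_simps(4)[OF H] by (simp add: a_minus_def module_neg_smult[OF H])
qed

end

section \<open>Extensions of a cyclic module\<close>

locale cyclic_Ext =
  fixes R :: "('a, 'r) ring_scheme" and I :: "'a set" and H :: "('a, 'h) module"
  assumes I: "ideal I R" and H: "module R H"
begin

sublocale HM: module R H by (rule H)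

lemmas R = HM.R.is_cring

abbreviation "RI \<equiv> quot_module (regular_module R) I"
abbreviation "T \<equiv> Ext R 1 RI H"
abbreviation "IM \<equiv> (regular_module R)\<lparr>carrier := I\<rparr>"

lemma I_submodule: "submodule I R (regular_module R)"
  using I submodule_regular_iff_ideal[OF R] by blast

lemma IM: "module R IM" by (rule submodule_module[OF regular_module_module[OF R] I_submodule])

lemma RI: "module R RI" by (rule quot_module_module[OF regular_module_module[OF R] I_submodule])

lemma T: "module R T" by (rule Ext_module[OF RI H])

sublocale G: generated_module R "regular_module R" "{\<one>\<^bsub>R\<^esub>}"
proof (rule generated_module.intro[OF regular_module_module[OF R]])
  show "{\<one>\<^bsub>R\<^esub>} \<subseteq> carrier (regular_module R)" by (simp add: regular_module_simps)
  have RR: "module R (regular_module R)" by (rule regular_module_module[OF R])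
  show "submodule_span R (regular_module R) {\<one>\<^bsub>R\<^esub>} = carrier (regular_module R)"
  proof
    show "submodule_span R (regular_module R) {\<one>\<^bsub>R\<^esub>} \<subseteq> carrier (regular_module R)"
      by (rule submodule_span_minimal[OF module.carrier_is_submodule[OF RR]]) (simp add: regular_module_simps)
    show "carrier (regular_module R) \<subseteq> submodule_span R (regular_module R) {\<one>\<^bsub>R\<^esub>}"
    proof
      fix x assume x: "x \<in> carrier (regular_module R)"
      have "x \<in> U" if U: "submodule U R (regular_module R)" "\<one>\<^bsub>R\<^esub> \<in> U" for U
        using submodule_simps(5)[OF RR U(1) _ U(2), of x] x by (simp add: regular_module_simps)
      thus "x \<in> submodule_span R (regular_module R) {\<one>\<^bsub>R\<^esub>}" by (simp add: submodule_span_def)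
    qed
  qed
qed

lemmas pres = G.quotient_presentation(1)[OF I_submodule H]
lemmas pres_K = G.quotient_presentation(2)[OF I_submodule H]

abbreviation "trep \<equiv> presentation.rep R RI H {\<one>\<^bsub>R\<^esub>} (\<lambda>m. I +>\<^bsub>regular_module R\<^esub> m)"

definition vec :: "'a \<Rightarrow> 'a \<Rightarrow> 'a" where "vec a = a \<odot>\<^bsub>G.L\<^esub> basis_vec R \<one>\<^bsub>R\<^esub>"

lemma vec_linear: "linear_map R (regular_module R) G.L vec"
proof -
  have b: "basis_vec R \<one>\<^bsub>R\<^esub> \<in> carrier G.L" by (rule basis_vec_carrier[OF R]) simp
  show ?thesis
    using b module.smult_closed[OF G.L _ b] module.smult_l_distr[OF G.L _ _ b] module.smult_assoc1[OF G.L _ _ b]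
    by (intro linear_mapI) (auto simp: vec_def regular_module_simps)
qed

lemma vec_eval:
  assumes "k \<in> carrier G.L" shows "vec (k \<one>\<^bsub>R\<^esub>) = k"
proof
  fix c show "vec (k \<one>\<^bsub>R\<^esub>) c = k c"
    using assms by (cases "c = \<one>\<^bsub>R\<^esub>") (auto simp: vec_def free_module_simps basis_vec_def)
qed

lemma vec_one: "a \<in> carrier R \<Longrightarrow> vec a \<one>\<^bsub>R\<^esub> = a"
  by (simp add: vec_def free_module_simps basis_vec_def)

lemma ev_eq:
  assumes k: "k \<in> carrier G.L" shows "G.ev k = k \<one>\<^bsub>R\<^esub>"
proof (rule linear_map_free_eq[OF R regular_module_module[OF R] G.ev_linear _ _ k])
  show "linear_map R G.L (regular_module R) (\<lambda>k. k \<one>\<^bsub>R\<^esub>)"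
    by (rule linear_mapI) (auto simp: free_module_simps regular_module_simps)
  show "G.ev (basis_vec R c) = basis_vec R c \<one>\<^bsub>R\<^esub>" if "c \<in> {\<one>\<^bsub>R\<^esub>}" for c
    using that G.ev_basis by (simp add: basis_vec_def)
qed

lemma K_eq: "presentation.K R RI {\<one>\<^bsub>R\<^esub>} (\<lambda>m. I +>\<^bsub>regular_module R\<^esub> m) = vec ` I"
proof -
  have "{k \<in> carrier G.L. G.ev k \<in> I} = vec ` I"
  proof
    show "{k \<in> carrier G.L. G.ev k \<in> I} \<subseteq> vec ` I" using ev_eq vec_eval by force
    show "vec ` I \<subseteq> {k \<in> carrier G.L. G.ev k \<in> I}"
      using ev_eq vec_one ideal.Icarr[OF I] linear_mapD(1)[OF vec_linear] by (auto simp: regular_module_simps)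
  qed
  thus ?thesis using pres_K by simp
qed

text \<open>A class of extensions of \<open>R / I\<close> is represented by a linear map on \<open>I\<close>, the relations of the generator
  \<open>1\<close> of \<open>R / I\<close>.\<close>

definition repT :: "('a \<Rightarrow> 'h) \<Rightarrow> ((('a, 'a set) cell \<Rightarrow> 'a) \<Rightarrow> 'h) set \<Rightarrow> bool" where
  "repT g \<tau> \<longleftrightarrow> (\<exists>\<phi>. trep \<phi> \<tau> \<and> (\<forall>a\<in>I. g a = \<phi> (vec a)))"

lemma repT_exists: "\<tau> \<in> carrier T \<Longrightarrow> \<exists>g. repT g \<tau>"
  using presentation.rep_exists[OF pres] by (fastforce simp: repT_def)

lemma repT_carrier: "repT g \<tau> \<Longrightarrow> \<tau> \<in> carrier T"
  using presentation.rep_carrier[OF pres] by (auto simp: repT_def)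

lemma repT_linear:
  assumes "repT g \<tau>" shows "linear_map R IM H g"
proof -
  obtain \<phi> where p: "trep \<phi> \<tau>" "\<And>a. a \<in> I \<Longrightarrow> g a = \<phi> (vec a)" using assms by (auto simp: repT_def)
  have "linear_map R (G.L\<lparr>carrier := vec ` I\<rparr>) H \<phi>"
    using presentation.rep_linear[OF pres p(1)] by (simp only: K_eq)
  moreover have "linear_map R IM (G.L\<lparr>carrier := vec ` I\<rparr>) vec"
    by (rule linear_map_submodule_codomain[OF linear_map_submodule_domain[OF vec_linear]])
      (use ideal.Icarr[OF I] in \<open>auto simp: regular_module_simps\<close>)
  ultimately have "linear_map R IM H (\<lambda>a. \<phi> (vec a))" by (rule linear_map_comp[rotated])
  thus ?thesis using linear_map_cong[OF IM, of g "\<lambda>a. \<phi> (vec a)"] p(2) by simp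
qed

lemma repT_add: "repT g \<tau> \<Longrightarrow> repT g' \<tau>' \<Longrightarrow> repT (\<lambda>a. g a \<oplus>\<^bsub>H\<^esub> g' a) (\<tau> \<oplus>\<^bsub>T\<^esub> \<tau>')"
  unfolding repT_def using presentation.rep_add[OF pres] by force

lemma repT_smult: "b \<in> carrier R \<Longrightarrow> repT g \<tau> \<Longrightarrow> repT (\<lambda>a. b \<odot>\<^bsub>H\<^esub> g a) (b \<odot>\<^bsub>T\<^esub> \<tau>)"
  unfolding repT_def using presentation.rep_smult[OF pres] by force

lemma repT_multiplication:
  assumes r: "repT g \<tau>" and h: "h \<in> carrier H" and g: "\<And>a. a \<in> I \<Longrightarrow> g a = a \<odot>\<^bsub>H\<^esub> h"
  shows "\<tau> = \<zero>\<^bsub>T\<^esub>"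
proof -
  obtain \<phi> where p: "trep \<phi> \<tau>" "\<And>a. a \<in> I \<Longrightarrow> g a = \<phi> (vec a)" using r by (auto simp: repT_def)
  have "linear_map R G.L H (\<lambda>k. k \<one>\<^bsub>R\<^esub> \<odot>\<^bsub>H\<^esub> h)"
    by (rule linear_mapI) (use h in \<open>auto simp: free_module_simps HM.smult_l_distr HM.smult_assoc1\<close>)
  moreover have "\<forall>k\<in>vec ` I. \<phi> k = k \<one>\<^bsub>R\<^esub> \<odot>\<^bsub>H\<^esub> h"
    using p(2) g ideal.Icarr[OF I] vec_one by auto
  ultimately show ?thesis using presentation.rep_zero_iff[OF pres p(1)] K_eq by auto
qed

end

section \<open>The obstruction vector of an extension\<close>

context torsion_free_setting
begin

text \<open>The submodule \<open>E\<close> of those \<open>k\<close> for which the equations \<open>f x = \<phi> f k\<close> have a common solution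
  contains the relations of \<open>M\<close>, with \<open>x = 0\<close>, and it contains \<open>G K\<^sub>n\<close>: for \<open>k = f l\<close> the solution
  is \<open>\<phi> f l\<close>, because \<open>g (\<phi> f l) = f (\<phi> g l) = \<phi> g (f l)\<close>. As \<open>G\<close> generates \<open>I\<close>, the image of \<open>E\<close> in
  \<open>M\<close> contains \<open>I\<^sup>n\<^sup>+\<^sup>1 M\<close>, so that \<open>E\<close> contains \<open>K\<^sub>n\<^sub>+\<^sub>1\<close>.\<close>

lemma division_exists:
  assumes G: "G \<subseteq> carrier R" "I = Idl\<^bsub>R\<^esub> G"
    and lin: "\<And>f. f \<in> G \<Longrightarrow> linear_map R (KM n) N (\<phi> f)"
    and comm: "\<And>f f' k. f \<in> G \<Longrightarrow> f' \<in> G \<Longrightarrow> k \<in> Kn n \<Longrightarrow> f' \<odot>\<^bsub>N\<^esub> \<phi> f k = f \<odot>\<^bsub>N\<^esub> \<phi> f' k"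
    and ker: "\<And>f k. f \<in> G \<Longrightarrow> k \<in> carrier L \<Longrightarrow> ev k = \<zero>\<^bsub>M\<^esub> \<Longrightarrow> \<phi> f k = \<zero>\<^bsub>N\<^esub>"
    and k: "k \<in> Kn (Suc n)"
  shows "\<exists>x\<in>carrier N. \<forall>f\<in>G. f \<odot>\<^bsub>N\<^esub> x = \<phi> f k"
proof -
  define E where "E = {k \<in> Kn n. \<exists>x\<in>carrier N. \<forall>f\<in>G. f \<odot>\<^bsub>N\<^esub> x = \<phi> f k}"
  note sKn = submodule_simps[OF L Kn]
  have GR: "f \<in> carrier R" if "f \<in> G" for f using that G by auto
  have kerE: "k \<in> E" if "k \<in> carrier L" "ev k = \<zero>\<^bsub>M\<^esub>" for k
  proof -
    have "k \<in> Kn n" using that submodule_simps(2)[OF M J] by (simp add: Kn_def)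
    thus ?thesis using that ker GR unfolding E_def by (auto intro!: bexI[of _ "\<zero>\<^bsub>N\<^esub>"])
  qed
  have E: "submodule E R L"
  proof (rule submoduleI'[OF L])
    show "E \<subseteq> carrier L" using sKn(1) by (auto simp: E_def)
    show "\<zero>\<^bsub>L\<^esub> \<in> E"
      using kerE linear_map_zero[OF L M ev_linear] sKn(2,3) by blast
  next
    fix k l assume "k \<in> E" "l \<in> E"
    then obtain x y where *: "k \<in> Kn n" "l \<in> Kn n" "x \<in> carrier N" "y \<in> carrier N"
      "\<And>f. f \<in> G \<Longrightarrow> f \<odot>\<^bsub>N\<^esub> x = \<phi> f k" "\<And>f. f \<in> G \<Longrightarrow> f \<odot>\<^bsub>N\<^esub> y = \<phi> f l"
      by (auto simp: E_def)
    have "f \<odot>\<^bsub>N\<^esub> (x \<oplus>\<^bsub>N\<^esub> y) = \<phi> f (k \<oplus>\<^bsub>L\<^esub> l)" if f: "f \<in> G" for f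
      using linear_mapD(2)[OF lin[OF f], of k l] * f GR[OF f] by (simp add: NN.smult_r_distr)
    thus "k \<oplus>\<^bsub>L\<^esub> l \<in> E" using * sKn(4) unfolding E_def by (auto intro!: bexI[of _ "x \<oplus>\<^bsub>N\<^esub> y"])
  next
    fix a k assume a: "a \<in> carrier R" and "k \<in> E"
    then obtain x where *: "k \<in> Kn n" "x \<in> carrier N" "\<And>f. f \<in> G \<Longrightarrow> f \<odot>\<^bsub>N\<^esub> x = \<phi> f k"
      by (auto simp: E_def)
    have "f \<odot>\<^bsub>N\<^esub> (a \<odot>\<^bsub>N\<^esub> x) = \<phi> f (a \<odot>\<^bsub>L\<^esub> k)" if f: "f \<in> G" for f
      using linear_mapD(3)[OF lin[OF f] a, of k] *(1,2) GR[OF f] a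
      by (simp add: *(3)[OF f, symmetric] NN.smult_assoc1[symmetric] MM.R.m_comm)
    thus "a \<odot>\<^bsub>L\<^esub> k \<in> E" using * a sKn(5) unfolding E_def by (auto intro!: bexI[of _ "a \<odot>\<^bsub>N\<^esub> x"])
  qed
  have evE: "submodule (ev ` E) R M" by (rule image_submodule[OF L M ev_linear E])
  have Gmul: "f \<odot>\<^bsub>M\<^esub> y \<in> ev ` E" if f: "f \<in> G" and y: "y \<in> J n" for f y
  proof -
    obtain l where l: "l \<in> carrier L" "ev l = y" by (rule ev_onto[OF submodule_simps(3)[OF M J y]])
    have lK: "l \<in> Kn n" using l y by (simp add: Kn_def)
    have "g \<odot>\<^bsub>N\<^esub> \<phi> f l = \<phi> g (f \<odot>\<^bsub>L\<^esub> l)" if g: "g \<in> G" for g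
      using linear_mapD(3)[OF lin[OF g] GR[OF f], of l] comm[OF f g lK] lK by simp
    hence "f \<odot>\<^bsub>L\<^esub> l \<in> E"
      using linear_mapD(1)[OF lin[OF f], of l] lK sKn(5)[OF GR[OF f] lK] unfolding E_def by auto
    moreover have "ev (f \<odot>\<^bsub>L\<^esub> l) = f \<odot>\<^bsub>M\<^esub> y" using linear_mapD(3)[OF ev_linear GR[OF f] l(1)] l(2) by simp
    ultimately show ?thesis by (metis imageI)
  qed
  have "J (Suc n) \<subseteq> ev ` E"
    unfolding ideal_smult_def
  proof (rule submodule_span_minimal[OF evE], rule subsetI)
    fix y assume "y \<in> {a \<odot>\<^bsub>M\<^esub> x | a x. a \<in> Ip (Suc n) \<and> x \<in> carrier M}"
    then obtain a x where y: "y = a \<odot>\<^bsub>M\<^esub> x" "a \<in> Ip n \<cdot>\<^bsub>R\<^esub> I" "x \<in> carrier M" by (auto simp: Ip(3) simp del: nat_pow_Suc)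
    from y(2) have "a \<in> carrier R \<and> a \<odot>\<^bsub>M\<^esub> x \<in> ev ` E"
    proof induction
      case (prod s u)
      have s: "s \<in> carrier R" "u \<in> carrier R" using prod ideal.Icarr[OF Ip(1)] ideal.Icarr[OF I] by auto
      have sJ: "s \<odot>\<^bsub>M\<^esub> x \<in> J n" by (rule ideal_smult_mem[OF prod(1) y(3)])
      have "u \<odot>\<^bsub>M\<^esub> (s \<odot>\<^bsub>M\<^esub> x) \<in> ev ` E"
        by (rule genideal_smult_closed[OF M evE G(1) submodule_simps(3)[OF M J sJ] Gmul[OF _ sJ] prod(2)[unfolded G(2)]])
      moreover have "u \<odot>\<^bsub>M\<^esub> (s \<odot>\<^bsub>M\<^esub> x) = (s \<otimes>\<^bsub>R\<^esub> u) \<odot>\<^bsub>M\<^esub> x"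
        using s y(3) MM.R.m_comm[OF s] by (simp add: MM.smult_assoc1)
      ultimately show ?case using s by simp
    next
      case (sum s1 s2)
      thus ?case using submodule_simps(4)[OF M evE] y(3) by (simp add: MM.smult_l_distr)
    qed
    thus "y \<in> ev ` E" using y(1) by simp
  qed
  moreover have kL: "k \<in> carrier L" "ev k \<in> J (Suc n)" using k by (auto simp: Kn_def)
  ultimately obtain l where l: "l \<in> E" "ev l = ev k" by force
  note sE = submodule_simps[OF L E]
  have "ev (k \<ominus>\<^bsub>L\<^esub> l) = \<zero>\<^bsub>M\<^esub>"
    using linear_map_minus[OF L M ev_linear kL(1) sE(3)[OF l(1)]] l(2) linear_mapD(1)[OF ev_linear kL(1)]
    by (simp add: module_minus_simps(3)[OF M])
  hence "k \<ominus>\<^bsub>L\<^esub> l \<in> E"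
    using kerE abelian_group.minus_closed[OF module.axioms(2)[OF L]] kL(1) sE(3)[OF l(1)] by blast
  hence "k \<in> E"
    using sE(4)[OF _ l(1)] kL(1) sE(3)[OF l(1)] module_minus_simps(5)[OF L] by metis
  thus ?thesis by (auto simp: E_def)
qed

text \<open>The maps \<open>\<phi> f\<close> represent the values \<open>g f\<close> at the generators \<open>f\<close> of \<open>I\<close>, on a common stage \<open>n\<close>. Since
  \<open>f' (g f) = f (g f')\<close> in \<open>H\<close>, the difference \<open>f' (\<phi> f) - f (\<phi> f')\<close> extends to a linear map \<open>\<psi> f f'\<close> on \<open>L\<close>. The vector \<open>v\<close> lists
  the values of these extensions on the basis \<open>S\<close> of \<open>L\<close>, and the values of the \<open>\<phi> f\<close> on a set \<open>W\<close> of relations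
  of \<open>M\<close>.\<close>

definition obstruction where
  "obstruction G W v g n \<phi> \<psi> \<longleftrightarrow>
     (\<forall>f\<in>G. repH n (\<phi> f) (g f)) \<and>
     (\<forall>f\<in>G. \<forall>f'\<in>G. linear_map R L N (\<psi> f f') \<and>
        (\<forall>k\<in>Kn n. f' \<odot>\<^bsub>N\<^esub> \<phi> f k \<ominus>\<^bsub>N\<^esub> f \<odot>\<^bsub>N\<^esub> \<phi> f' k = \<psi> f f' k)) \<and>
     (\<forall>f\<in>G. \<forall>f'\<in>G. \<forall>m\<in>S. v (Inl (f, f', m)) = \<psi> f f' (basis_vec R m)) \<and>
     (\<forall>f\<in>G. \<forall>w\<in>W. v (Inr (f, w)) = \<phi> f w)"

lemma obstruction_mono:
  "obstruction G W v g n \<phi> \<psi> \<Longrightarrow> obstruction G W v g (n + k) \<phi> \<psi>"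
  unfolding obstruction_def using repH_mono Kn_mono[of n k] by (auto simp: subset_iff)

lemma obstruction_values:
  assumes "obstruction G W v g n \<phi> \<psi>" "f \<in> G" "k \<in> Kn n"
  shows "\<phi> f k \<in> carrier N"
  using assms linear_mapD(1)[OF repH_linear] by (auto simp: obstruction_def)

lemma obstruction_add:
  assumes G: "G \<subseteq> carrier R" and o: "obstruction G W v g n \<phi> \<psi>" and o': "obstruction G W v' g' n \<phi>' \<psi>'"
  shows "obstruction G W (\<lambda>i. v i \<oplus>\<^bsub>N\<^esub> v' i) (\<lambda>a. g a \<oplus>\<^bsub>H\<^esub> g' a) n
     (\<lambda>f k. \<phi> f k \<oplus>\<^bsub>N\<^esub> \<phi>' f k) (\<lambda>f f' k. \<psi> f f' k \<oplus>\<^bsub>N\<^esub> \<psi>' f f' k)"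
proof -
  have "f' \<odot>\<^bsub>N\<^esub> (\<phi> f k \<oplus>\<^bsub>N\<^esub> \<phi>' f k) \<ominus>\<^bsub>N\<^esub> f \<odot>\<^bsub>N\<^esub> (\<phi> f' k \<oplus>\<^bsub>N\<^esub> \<phi>' f' k) = \<psi> f f' k \<oplus>\<^bsub>N\<^esub> \<psi>' f f' k"
    if f: "f \<in> G" "f' \<in> G" and k: "k \<in> Kn n" for f f' k
  proof -
    have e: "\<psi> f f' k = f' \<odot>\<^bsub>N\<^esub> \<phi> f k \<ominus>\<^bsub>N\<^esub> f \<odot>\<^bsub>N\<^esub> \<phi> f' k"
        "\<psi>' f f' k = f' \<odot>\<^bsub>N\<^esub> \<phi>' f k \<ominus>\<^bsub>N\<^esub> f \<odot>\<^bsub>N\<^esub> \<phi>' f' k"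
      using o o' f k unfolding obstruction_def by auto
    show ?thesis unfolding e
      using obstruction_values[OF o f(1) k] obstruction_values[OF o f(2) k]
        obstruction_values[OF o' f(1) k] obstruction_values[OF o' f(2) k] f G
      by (simp add: a_minus_def NN.smult_r_distr NN.M.minus_add NN.M.a_ac subset_iff)
  qed
  thus ?thesis using o o' repH_add linear_map_pointwise(2)[OF N L]
    by (simp add: obstruction_def)
qed

lemma obstruction_smult:
  assumes G: "G \<subseteq> carrier R" and a: "a \<in> carrier R" and o: "obstruction G W v g n \<phi> \<psi>"
  shows "obstruction G W (\<lambda>i. a \<odot>\<^bsub>N\<^esub> v i) (\<lambda>b. a \<odot>\<^bsub>H\<^esub> g b) n
     (\<lambda>f k. a \<odot>\<^bsub>N\<^esub> \<phi> f k) (\<lambda>f f' k. a \<odot>\<^bsub>N\<^esub> \<psi> f f' k)"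
proof -
  have "f' \<odot>\<^bsub>N\<^esub> (a \<odot>\<^bsub>N\<^esub> \<phi> f k) \<ominus>\<^bsub>N\<^esub> f \<odot>\<^bsub>N\<^esub> (a \<odot>\<^bsub>N\<^esub> \<phi> f' k) = a \<odot>\<^bsub>N\<^esub> \<psi> f f' k"
    if f: "f \<in> G" "f' \<in> G" and k: "k \<in> Kn n" for f f' k
  proof -
    have e: "\<psi> f f' k = f' \<odot>\<^bsub>N\<^esub> \<phi> f k \<ominus>\<^bsub>N\<^esub> f \<odot>\<^bsub>N\<^esub> \<phi> f' k"
      using o f k unfolding obstruction_def by auto
    have fR: "f \<in> carrier R" "f' \<in> carrier R" using f G by auto
    note v = obstruction_values[OF o f(1) k] obstruction_values[OF o f(2) k]
    have "a \<odot>\<^bsub>N\<^esub> \<psi> f f' k = a \<odot>\<^bsub>N\<^esub> (f' \<odot>\<^bsub>N\<^esub> \<phi> f k) \<ominus>\<^bsub>N\<^esub> a \<odot>\<^bsub>N\<^esub> (f \<odot>\<^bsub>N\<^esub> \<phi> f' k)"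
      unfolding e using linear_map_minus[OF N N linear_map_smult[OF N a]] v fR by simp
    thus ?thesis using v fR a
      by (simp add: NN.smult_assoc1[symmetric] MM.R.m_comm)
  qed
  thus ?thesis using o repH_smult[OF a] linear_map_pointwise(3)[OF N L _ a]
    by (simp add: obstruction_def)
qed

lemma obstruction_exists:
  assumes G: "finite G" "G \<subseteq> I" and g: "linear_map R ((regular_module R)\<lparr>carrier := I\<rparr>) H g"
  obtains n \<phi> \<psi> where "\<And>f. f \<in> G \<Longrightarrow> repH n (\<phi> f) (g f)"
    and "\<And>f f'. f \<in> G \<Longrightarrow> f' \<in> G \<Longrightarrow> linear_map R L N (\<psi> f f')"
    and "\<And>f f' k. f \<in> G \<Longrightarrow> f' \<in> G \<Longrightarrow> k \<in> Kn n \<Longrightarrow>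
      f' \<odot>\<^bsub>N\<^esub> \<phi> f k \<ominus>\<^bsub>N\<^esub> f \<odot>\<^bsub>N\<^esub> \<phi> f' k = \<psi> f f' k"
proof -
  interpret HM: module R H by (rule H)
  have GR: "f \<in> carrier R" "f \<in> I" if "f \<in> G" for f using that G ideal.Icarr[OF I] by auto
  have gc: "g f \<in> carrier H" if "f \<in> G" for f using linear_mapD(1)[OF g] GR that by simp
  have "\<forall>f\<in>G. \<exists>n \<phi>. repH n \<phi> (g f)" using repH_exists gc by blast
  then obtain nn \<phi> where p: "\<And>f. f \<in> G \<Longrightarrow> repH (nn f) (\<phi> f) (g f)" by metis
  \<comment> \<open>The sum bounds all \<open>nn f\<close>, and it is \<open>0\<close> if \<open>G\<close> is empty.\<close>
  define n where "n = sum nn G"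
  have r: "repH n (\<phi> f) (g f)" if f: "f \<in> G" for f
  proof -
    have "nn f \<le> n" unfolding n_def using G(1) f by (simp add: member_le_sum)
    thus ?thesis using repH_mono[OF p[OF f], of "n - nn f"] by simp
  qed
  have "\<exists>\<psi>. linear_map R L N \<psi> \<and> (\<forall>k\<in>Kn n. f' \<odot>\<^bsub>N\<^esub> \<phi> f k \<ominus>\<^bsub>N\<^esub> f \<odot>\<^bsub>N\<^esub> \<phi> f' k = \<psi> k)"
    if f: "f \<in> G" "f' \<in> G" for f f'
  proof -
    note c = GR[OF f(1)] GR[OF f(2)]
    have mf: "\<ominus>\<^bsub>R\<^esub> f \<in> carrier R" using c by simp
    have "f' \<odot>\<^bsub>H\<^esub> g f = g (f' \<otimes>\<^bsub>R\<^esub> f)" "f \<odot>\<^bsub>H\<^esub> g f' = g (f \<otimes>\<^bsub>R\<^esub> f')"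
      using linear_mapD(3)[OF g, of f' f] linear_mapD(3)[OF g, of f f'] c
      by (simp_all add: regular_module_simps)
    hence "f' \<odot>\<^bsub>H\<^esub> g f = f \<odot>\<^bsub>H\<^esub> g f'" using MM.R.m_comm[of f f'] c by simp
    hence z: "f' \<odot>\<^bsub>H\<^esub> g f \<oplus>\<^bsub>H\<^esub> (\<ominus>\<^bsub>R\<^esub> f) \<odot>\<^bsub>H\<^esub> g f' = \<zero>\<^bsub>H\<^esub>"
      using gc[OF f(1)] gc[OF f(2)] c by (simp add: HM.smult_l_minus HM.M.r_neg)
    have rr: "repH n (\<lambda>k. f' \<odot>\<^bsub>N\<^esub> \<phi> f k \<oplus>\<^bsub>N\<^esub> (\<ominus>\<^bsub>R\<^esub> f) \<odot>\<^bsub>N\<^esub> \<phi> f' k)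
        (f' \<odot>\<^bsub>H\<^esub> g f \<oplus>\<^bsub>H\<^esub> (\<ominus>\<^bsub>R\<^esub> f) \<odot>\<^bsub>H\<^esub> g f')"
      by (rule repH_add[OF repH_smult[OF c(3) r[OF f(1)]] repH_smult[OF mf r[OF f(2)]]])
    obtain \<psi> where s: "linear_map R L N \<psi>"
      "\<And>k. k \<in> Kn n \<Longrightarrow> f' \<odot>\<^bsub>N\<^esub> \<phi> f k \<oplus>\<^bsub>N\<^esub> (\<ominus>\<^bsub>R\<^esub> f) \<odot>\<^bsub>N\<^esub> \<phi> f' k = \<psi> k"
      using iffD1[OF repH_zero_iff[OF rr] z] by blast
    have "f' \<odot>\<^bsub>N\<^esub> \<phi> f k \<ominus>\<^bsub>N\<^esub> f \<odot>\<^bsub>N\<^esub> \<phi> f' k = \<psi> k" if k: "k \<in> Kn n" for k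
      using s(2)[OF k] c linear_mapD(1)[OF repH_linear[OF r[OF f(2)]]] k
      by (simp add: NN.smult_l_minus a_minus_def)
    thus ?thesis using s(1) by blast
  qed
  hence "\<forall>f\<in>G. \<forall>f'\<in>G. \<exists>\<psi>. linear_map R L N \<psi> \<and>
      (\<forall>k\<in>Kn n. f' \<odot>\<^bsub>N\<^esub> \<phi> f k \<ominus>\<^bsub>N\<^esub> f \<odot>\<^bsub>N\<^esub> \<phi> f' k = \<psi> k)" by blast
  then obtain \<psi> where "\<forall>f\<in>G. \<forall>f'\<in>G. linear_map R L N (\<psi> f f') \<and>
      (\<forall>k\<in>Kn n. f' \<odot>\<^bsub>N\<^esub> \<phi> f k \<ominus>\<^bsub>N\<^esub> f \<odot>\<^bsub>N\<^esub> \<phi> f' k = \<psi> f f' k)"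
    by (simp only: bchoice_iff) blast
  thus ?thesis using that[OF r, of \<psi>] by blast
qed

lemma tf_generators:
  assumes G: "G \<subseteq> carrier R" "I = Idl\<^bsub>R\<^esub> G" and x: "x \<in> carrier N"
    and z: "\<And>f. f \<in> G \<Longrightarrow> f \<odot>\<^bsub>N\<^esub> x = \<zero>\<^bsub>N\<^esub>"
  shows "x = \<zero>\<^bsub>N\<^esub>"
proof (rule tf[OF x])
  have zero: "submodule {\<zero>\<^bsub>N\<^esub>} R N" by (rule submoduleI'[OF N]) auto
  show "a \<odot>\<^bsub>N\<^esub> x = \<zero>\<^bsub>N\<^esub>" if "a \<in> I" for a
    using genideal_smult_closed[OF N zero G(1) x _ that[unfolded G(2)]] z by simp
qed

text \<open>Since \<open>N\<close> has no \<open>I\<close>-torsion, a common solution of the equations \<open>f x = \<phi> f k\<close> is unique, and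
  therefore depends linearly on \<open>k\<close>.\<close>

lemma common_quotient:
  assumes G: "G \<subseteq> carrier R" "I = Idl\<^bsub>R\<^esub> G" and B: "module R B"
    and lin: "\<And>f. f \<in> G \<Longrightarrow> linear_map R B N (\<phi> f)"
    and ex: "\<And>k. k \<in> carrier B \<Longrightarrow> \<exists>x\<in>carrier N. \<forall>f\<in>G. f \<odot>\<^bsub>N\<^esub> x = \<phi> f k"
  obtains \<chi> where "linear_map R B N \<chi>"
    and "\<forall>k\<in>carrier B. \<forall>f\<in>G. f \<odot>\<^bsub>N\<^esub> \<chi> k = \<phi> f k"
proof -
  interpret B: module R B by (rule B)
  have GR: "f \<in> carrier R" if "f \<in> G" for f using that G by auto
  have "\<forall>k\<in>carrier B. \<exists>x. x \<in> carrier N \<and> (\<forall>f\<in>G. f \<odot>\<^bsub>N\<^esub> x = \<phi> f k)" using ex by blast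
  from bchoice[OF this] obtain \<chi>
    where chi: "\<And>k. k \<in> carrier B \<Longrightarrow> \<chi> k \<in> carrier N"
      "\<And>k f. k \<in> carrier B \<Longrightarrow> f \<in> G \<Longrightarrow> f \<odot>\<^bsub>N\<^esub> \<chi> k = \<phi> f k" by blast
  have uniq: "x = y" if x: "x \<in> carrier N" "y \<in> carrier N" and e: "\<And>f. f \<in> G \<Longrightarrow> f \<odot>\<^bsub>N\<^esub> x = f \<odot>\<^bsub>N\<^esub> y" for x y
  proof -
    have "f \<odot>\<^bsub>N\<^esub> (x \<ominus>\<^bsub>N\<^esub> y) = \<zero>\<^bsub>N\<^esub>" if f: "f \<in> G" for f
      using linear_map_minus[OF N N linear_map_smult[OF N GR[OF f]] x] e[OF f] x GR[OF f]
      by (simp add: module_minus_simps(3)[OF N])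
    hence "x \<ominus>\<^bsub>N\<^esub> y = \<zero>\<^bsub>N\<^esub>" using tf_generators[OF G] x by simp
    thus ?thesis using x module_minus_simps(4)[OF N] by simp
  qed
  have "linear_map R B N \<chi>"
  proof (rule linear_mapI)
    fix k assume k: "k \<in> carrier B"
    show "\<chi> k \<in> carrier N" by (rule chi(1)[OF k])
    show "\<chi> (a \<odot>\<^bsub>B\<^esub> k) = a \<odot>\<^bsub>N\<^esub> \<chi> k" if a: "a \<in> carrier R" for a
    proof (rule uniq)
      have ak: "a \<odot>\<^bsub>B\<^esub> k \<in> carrier B" using a k by simp
      show "\<chi> (a \<odot>\<^bsub>B\<^esub> k) \<in> carrier N" "a \<odot>\<^bsub>N\<^esub> \<chi> k \<in> carrier N" using a chi(1) k ak by simp_all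
      fix f assume f: "f \<in> G"
      have "f \<odot>\<^bsub>N\<^esub> (a \<odot>\<^bsub>N\<^esub> \<chi> k) = a \<odot>\<^bsub>N\<^esub> \<phi> f k"
        using chi(1)[OF k] a GR[OF f]
        by (simp add: chi(2)[OF k f, symmetric] NN.smult_assoc1[symmetric] MM.R.m_comm)
      thus "f \<odot>\<^bsub>N\<^esub> \<chi> (a \<odot>\<^bsub>B\<^esub> k) = f \<odot>\<^bsub>N\<^esub> (a \<odot>\<^bsub>N\<^esub> \<chi> k)"
        using chi(2)[OF ak f] linear_mapD(3)[OF lin[OF f] a k] by simp
    qed
    fix l assume l: "l \<in> carrier B"
    show "\<chi> (k \<oplus>\<^bsub>B\<^esub> l) = \<chi> k \<oplus>\<^bsub>N\<^esub> \<chi> l"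
    proof (rule uniq)
      have kl: "k \<oplus>\<^bsub>B\<^esub> l \<in> carrier B" using k l by simp
      show "\<chi> (k \<oplus>\<^bsub>B\<^esub> l) \<in> carrier N" "\<chi> k \<oplus>\<^bsub>N\<^esub> \<chi> l \<in> carrier N" using chi(1) k l kl by simp_all
      fix f assume f: "f \<in> G"
      show "f \<odot>\<^bsub>N\<^esub> \<chi> (k \<oplus>\<^bsub>B\<^esub> l) = f \<odot>\<^bsub>N\<^esub> (\<chi> k \<oplus>\<^bsub>N\<^esub> \<chi> l)"
        using chi(1)[OF k] chi(1)[OF l] GR[OF f] chi(2)[OF k f] chi(2)[OF l f] chi(2)[OF kl f]
          linear_mapD(2)[OF lin[OF f] k l] by (simp add: NN.smult_r_distr)
    qed
  qed
  thus ?thesis using that chi(2) by blast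
qed

text \<open>If all entries of the vector vanish, then the \<open>\<phi> f\<close> vanish on the relations of \<open>M\<close> and
  satisfy \<open>f' (\<phi> f) = f (\<phi> f')\<close>. On \<open>K\<^sub>n\<^sub>+\<^sub>1\<close> they are therefore of the form \<open>f \<chi>\<close> for one linear map \<open>\<chi>\<close>, and
  the class \<open>h\<close> of \<open>\<chi>\<close> satisfies \<open>g f = f h\<close>.\<close>

lemma obstruction_zero:
  assumes G: "G \<subseteq> carrier R" "I = Idl\<^bsub>R\<^esub> G"
    and W: "\<And>U. submodule U R (free_module R UNIV) \<Longrightarrow> W \<subseteq> U \<Longrightarrow> {k \<in> carrier L. ev k = \<zero>\<^bsub>M\<^esub>} \<subseteq> U"
      "W \<subseteq> {k \<in> carrier L. ev k = \<zero>\<^bsub>M\<^esub>}"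
    and g: "linear_map R ((regular_module R)\<lparr>carrier := I\<rparr>) H g"
    and o: "obstruction G W (\<lambda>i. \<zero>\<^bsub>N\<^esub>) g n \<phi> \<psi>"
  shows "\<exists>h\<in>carrier H. \<forall>a\<in>I. g a = a \<odot>\<^bsub>H\<^esub> h"
proof -
  interpret HM: module R H by (rule H)
  have r: "repH n (\<phi> f) (g f)" if "f \<in> G" for f using o that by (auto simp: obstruction_def)
  note rl = repH_linear[OF r]
  have GR: "f \<in> carrier R" "f \<in> I" if "f \<in> G" for f using that G MM.R.genideal_self[OF G(1)] by auto
  have K0: "{k \<in> carrier L. ev k = \<zero>\<^bsub>M\<^esub>} \<subseteq> Kn n"
    using submodule_simps(2)[OF M J] by (auto simp: Kn_def)
  have ker: "\<phi> f k = \<zero>\<^bsub>N\<^esub>" if f: "f \<in> G" and k: "k \<in> carrier L" "ev k = \<zero>\<^bsub>M\<^esub>" for f k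
  proof -
    have "submodule {k \<in> carrier (KM n). \<phi> f k = \<zero>\<^bsub>N\<^esub>} R L"
      by (rule submodule_trans[OF L Kn kernel_submodule[OF KM N rl[OF f]]])
    hence "submodule {k \<in> Kn n. \<phi> f k = \<zero>\<^bsub>N\<^esub>} R (free_module R UNIV)"
      using free_module_submodule[OF R _ subset_UNIV] by simp
    moreover have "W \<subseteq> {k \<in> Kn n. \<phi> f k = \<zero>\<^bsub>N\<^esub>}" using W(2) K0 o f by (auto simp: obstruction_def)
    ultimately show ?thesis using W(1) k by blast
  qed
  have comm: "f' \<odot>\<^bsub>N\<^esub> \<phi> f k = f \<odot>\<^bsub>N\<^esub> \<phi> f' k" if f: "f \<in> G" "f' \<in> G" and k: "k \<in> Kn n" for f f' k
  proof -
    have p: "linear_map R L N (\<psi> f f')" "f' \<odot>\<^bsub>N\<^esub> \<phi> f k \<ominus>\<^bsub>N\<^esub> f \<odot>\<^bsub>N\<^esub> \<phi> f' k = \<psi> f f' k"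
      "\<forall>m\<in>S. \<zero>\<^bsub>N\<^esub> = \<psi> f f' (basis_vec R m)"
      using o f k unfolding obstruction_def by blast+
    have "\<psi> f f' k = \<zero>\<^bsub>N\<^esub>"
      by (rule linear_map_free_eq[OF R N p(1) linear_map_pointwise(1)[OF N L]
            bspec[OF p(3), symmetric] submodule_simps(3)[OF L Kn k]])
    thus ?thesis using p(2) module_minus_simps(4)[OF N] obstruction_values[OF o _ k] f GR by simp
  qed
  have r1: "repH (Suc n) (\<phi> f) (g f)" if "f \<in> G" for f
    using repH_mono[OF r[OF that], of 1] by (simp add: Suc_eq_plus1)
  have div: "\<exists>x\<in>carrier N. \<forall>f\<in>G. f \<odot>\<^bsub>N\<^esub> x = \<phi> f k" if "k \<in> carrier (KM (Suc n))" for k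
  proof -
    have k: "k \<in> Kn (Suc n)" using that by simp
    show ?thesis by (rule division_exists[OF G rl comm ker k])
  qed
  obtain \<chi> where lin: "linear_map R (KM (Suc n)) N \<chi>"
    and chi: "\<forall>k\<in>carrier (KM (Suc n)). \<forall>f\<in>G. f \<odot>\<^bsub>N\<^esub> \<chi> k = \<phi> f k"
    by (rule common_quotient[OF G KM repH_linear[OF r1] div])
  obtain h where h: "repH (Suc n) \<chi> h" using repH_onto[OF lin] by blast
  have hc: "h \<in> carrier H" by (rule repH_carrier[OF h])
  have gf: "g f = f \<odot>\<^bsub>H\<^esub> h" if f: "f \<in> G" for f
    by (rule repH_unique[OF r1[OF f] repH_smult[OF GR(1)[OF f] h]]) (use chi f in simp)
  \<comment> \<open>Both sides are linear in \<open>a\<close>, so the equality extends from \<open>G\<close> to the ideal that \<open>G\<close> generates.\<close>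
  have RR: "module R (regular_module R)" by (rule regular_module_module[OF R])
  have Is: "submodule I R (regular_module R)" using I submodule_regular_iff_ideal[OF R] by blast
  have hl: "linear_map R (regular_module R) H (\<lambda>a. a \<odot>\<^bsub>H\<^esub> h)"
    by (rule linear_mapI) (use hc in \<open>auto simp: regular_module_simps HM.smult_l_distr HM.smult_assoc1\<close>)
  have "submodule {a \<in> carrier ((regular_module R)\<lparr>carrier := I\<rparr>). g a = a \<odot>\<^bsub>H\<^esub> h} R ((regular_module R)\<lparr>carrier := I\<rparr>)"
    by (rule equalizer_submodule[OF submodule_module[OF RR Is] H g
          linear_map_submodule_domain[OF hl submodule_simps(1)[OF RR Is]]])
  from submodule_trans[OF RR Is this]
  have "submodule {a \<in> I. g a = a \<odot>\<^bsub>H\<^esub> h} R (regular_module R)" by simp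
  hence "ideal {a \<in> I. g a = a \<odot>\<^bsub>H\<^esub> h} R" using submodule_regular_iff_ideal[OF R] by blast
  moreover have "G \<subseteq> {a \<in> I. g a = a \<odot>\<^bsub>H\<^esub> h}" using gf GR by auto
  ultimately have "Idl\<^bsub>R\<^esub> G \<subseteq> {a \<in> I. g a = a \<odot>\<^bsub>H\<^esub> h}" by (rule MM.R.genideal_minimal)
  hence "I \<subseteq> {a \<in> I. g a = a \<odot>\<^bsub>H\<^esub> h}" by (rule ord_eq_le_trans[OF G(2)])
  thus ?thesis using hc by blast
qed

text \<open>The obstruction vectors lie in a finite power of \<open>N\<close>, and they determine classes of
  extensions by a linear relation.\<close>

theorem weakly_laskerian_Ext_gen_local_cohomology:
  assumes noeth: "noetherian_ring R" and finS: "finite S" and WL: "weakly_laskerian R N"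
  shows "weakly_laskerian R (Ext R 1 (quot_module (regular_module R) I) H)"
proof -
  interpret C: cyclic_Ext R I H by (rule cyclic_Ext.intro[OF I H])
  from noetherian_ring.finetely_gen[OF noeth I]
  obtain G where G: "G \<subseteq> carrier R" "finite G" "I = Idl\<^bsub>R\<^esub> G" by (elim exE conjE) (rule that)
  have GI: "G \<subseteq> I" unfolding G(3) by (rule MM.R.genideal_self[OF G(1)])
  let ?K = "{k \<in> carrier L. ev k = \<zero>\<^bsub>M\<^esub>}"
  have "submodule ?K R L" by (rule kernel_submodule[OF L M ev_linear])
  from noetherian_free_submodule_finitely_generated[OF R noeth finS this]
  obtain W where W: "finite W" "W \<subseteq> ?K"
      "\<And>U. submodule U R (free_module R UNIV) \<Longrightarrow> W \<subseteq> U \<Longrightarrow> ?K \<subseteq> U"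
    by meson
  define B where "B = (G \<times> G \<times> S) <+> (G \<times> W)"
  have finB: "finite B" using G(2) finS W(1) by (simp add: B_def)
  let ?P = "power_module N B"
  define \<Phi> where "\<Phi> v \<tau> \<longleftrightarrow> v \<in> carrier ?P \<and> (\<exists>g n \<phi> \<psi>. C.repT g \<tau> \<and> obstruction G W v g n \<phi> \<psi>)" for v \<tau>
  show ?thesis
  proof (rule weakly_laskerian_linear_relation[OF weakly_laskerian_power_module[OF WL finB] C.T, where \<Phi> = \<Phi>])
    show "v \<in> carrier ?P \<and> \<tau> \<in> carrier C.T" if "\<Phi> v \<tau>" for v \<tau>
      using that C.repT_carrier by (auto simp: \<Phi>_def)
  next
    fix v w \<tau> \<tau>' assume v: "\<Phi> v \<tau>" and w: "\<Phi> w \<tau>'"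
    obtain g n \<phi> \<psi> where o: "v \<in> carrier ?P" "C.repT g \<tau>" "obstruction G W v g n \<phi> \<psi>"
      using v by (auto simp: \<Phi>_def)
    obtain g' n' \<phi>' \<psi>' where o': "w \<in> carrier ?P" "C.repT g' \<tau>'" "obstruction G W w g' n' \<phi>' \<psi>'"
      using w by (auto simp: \<Phi>_def)
    have "obstruction G W w g' (n + n') \<phi>' \<psi>'" using obstruction_mono[OF o'(3), of n] by (simp add: add.commute)
    from obstruction_add[OF G(1) obstruction_mono[OF o(3), of n'] this] C.repT_add[OF o(2) o'(2)]
    show "\<Phi> (v \<oplus>\<^bsub>?P\<^esub> w) (\<tau> \<oplus>\<^bsub>C.T\<^esub> \<tau>')"
      using o(1) o'(1) unfolding \<Phi>_def by (auto simp: power_module_simps)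
  next
    fix a v \<tau> assume a: "a \<in> carrier R" and v: "\<Phi> v \<tau>"
    obtain g n \<phi> \<psi> where o: "v \<in> carrier ?P" "C.repT g \<tau>" "obstruction G W v g n \<phi> \<psi>"
      using v by (auto simp: \<Phi>_def)
    from obstruction_smult[OF G(1) a o(3)] C.repT_smult[OF a o(2)]
    show "\<Phi> (a \<odot>\<^bsub>?P\<^esub> v) (a \<odot>\<^bsub>C.T\<^esub> \<tau>)"
      using o(1) a unfolding \<Phi>_def by (auto simp: power_module_simps)
  next
    fix \<tau> assume "\<tau> \<in> carrier C.T"
    then obtain g where g: "C.repT g \<tau>" using C.repT_exists by blast
    obtain n \<phi> \<psi> where o: "\<And>f. f \<in> G \<Longrightarrow> repH n (\<phi> f) (g f)"
      "\<And>f f'. f \<in> G \<Longrightarrow> f' \<in> G \<Longrightarrow> linear_map R L N (\<psi> f f')"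
      "\<And>f f' k. f \<in> G \<Longrightarrow> f' \<in> G \<Longrightarrow> k \<in> Kn n \<Longrightarrow>
        f' \<odot>\<^bsub>N\<^esub> \<phi> f k \<ominus>\<^bsub>N\<^esub> f \<odot>\<^bsub>N\<^esub> \<phi> f' k = \<psi> f f' k"
      by (rule obstruction_exists[OF G(2) GI C.repT_linear[OF g]]) blast
    define v where "v i = (case i of
        Inl (f, f', m) \<Rightarrow> if f \<in> G \<and> f' \<in> G \<and> m \<in> S then \<psi> f f' (basis_vec R m) else \<zero>\<^bsub>N\<^esub>
      | Inr (f, w) \<Rightarrow> if f \<in> G \<and> w \<in> W then \<phi> f w else \<zero>\<^bsub>N\<^esub>)" for i
    have "obstruction G W v g n \<phi> \<psi>" unfolding obstruction_def using o by (auto simp: v_def)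
    moreover have "v \<in> carrier ?P"
    proof -
      have "\<phi> f w \<in> carrier N" if "f \<in> G" "w \<in> W" for f w
        using linear_mapD(1)[OF repH_linear[OF o(1)[OF that(1)]], of w] that(2) W(2)
          submodule_simps(2)[OF M J] by (auto simp: Kn_def)
      moreover have "\<psi> f f' (basis_vec R m) \<in> carrier N" if "f \<in> G" "f' \<in> G" "m \<in> S" for f f' m
        by (rule linear_mapD(1)[OF o(2)[OF that(1,2)] basis_vec_carrier[OF R that(3)]])
      ultimately have "v i \<in> carrier N" for i
        by (auto simp: v_def split: sum.split)
      moreover have "v i = \<zero>\<^bsub>N\<^esub>" if "i \<notin> B" for i
        using that by (auto simp: v_def B_def split: sum.split)
      ultimately show ?thesis by (simp add: power_module_simps)
    qed
    ultimately show "\<exists>v. \<Phi> v \<tau>" using g unfolding \<Phi>_def by blast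
  next
    fix \<tau> assume "\<Phi> \<zero>\<^bsub>?P\<^esub> \<tau>"
    then obtain g n \<phi> \<psi> where o: "C.repT g \<tau>" "obstruction G W (\<lambda>b. \<zero>\<^bsub>N\<^esub>) g n \<phi> \<psi>"
      by (auto simp: \<Phi>_def power_module_simps)
    obtain h where "h \<in> carrier H" "\<And>a. a \<in> I \<Longrightarrow> g a = a \<odot>\<^bsub>H\<^esub> h"
      using obstruction_zero[OF G(1,3) W(3,2) C.repT_linear[OF o(1)] o(2)] by blast
    thus "\<tau> = \<zero>\<^bsub>C.T\<^esub>" by (rule C.repT_multiplication[OF o(1)])
  qed
qed

end

section \<open>Positive depth\<close>

text \<open>An element \<open>x\<close> killed by \<open>I\<close> gives a linear map \<open>R / I \<rightarrow> N\<close> with \<open>1 \<mapsto> x\<close>, hence a class in the zeroth local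
  cohomology module, which vanishes. So the cocycle of this class is zero at some later stage
  \<open>1 + k\<close>. But at each stage it still takes the value \<open>x\<close> at the basis element of the coset of \<open>1\<close>.\<close>

lemma depth_pos_torsion_free:
  assumes R: "cring R" and I: "ideal I R" and N: "module R N" and depth: "ideal_depth R I N > 0"
    and x: "x \<in> carrier N" and Ix: "\<And>a. a \<in> I \<Longrightarrow> a \<odot>\<^bsub>N\<^esub> x = \<zero>\<^bsub>N\<^esub>"
  shows "x = \<zero>\<^bsub>N\<^esub>"
proof -
  interpret R: cring R by fact
  interpret N: module R N by fact
  let ?M = "regular_module R"
  let ?X = "power_quot R I ?M"
  let ?J = "\<lambda>n::nat. ideal_smult R (I [^]\<^bsub>ideals_set R\<^esub> n) ?M"
  have M: "module R ?M" by (rule regular_module_module[OF R])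
  note Ip = ideal_power[OF R I]
  have J: "submodule (?J n) R ?M" for n by (rule ideal_smult_submodule[OF M Ip(1)])
  have JS: "?J (Suc n) \<subseteq> ?J n" for n by (rule ideal_smult_mono[OF Ip(4)])
  have X: "module R (?X n)" for n unfolding power_quot_def by (rule quot_module_module[OF M J])
  let ?pr = "power_quot_proj R I ?M"
  have pl: "linear_map R (?X (Suc n)) (?X n) (?pr n)"
    and pp: "m \<in> carrier R \<Longrightarrow> ?pr n (?J (Suc n) +>\<^bsub>?M\<^esub> m) = ?J n +>\<^bsub>?M\<^esub> m" for n m
    unfolding power_quot_def power_quot_proj_def
    using linear_map_quot_proj[OF M J J JS] by (simp_all add: regular_module_simps)
  let ?A = "\<lambda>n. Ext R 0 (?X n) N"
  let ?t = "\<lambda>n. Ext_map R 0 (?X (Suc n)) (?pr n) N"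
  interpret D: direct_system R ?A ?t
    by (rule direct_system.intro) (rule Ext_module[OF X N], rule Ext_map_linear[OF X X N pl])
  have triv: "trivial_module (direct_limit ?A ?t)"
  proof (rule ccontr)
    assume "\<not> ?thesis"
    hence "\<not> trivial_module (local_cohomology R I 0 N)"
      by (simp add: local_cohomology_def gen_local_cohomology_def)
    hence "ideal_depth R I N \<le> enat 0" unfolding ideal_depth_def by (intro Inf_lower) auto
    thus False using depth by (simp add: zero_enat_def[symmetric])
  qed
  interpret E: cochain_complex R "Ext_complex R (?X n) N" "Ext_diff R (?X n)" for n
    by (rule Ext_cochain_complex[OF X N])
  have one: "?J n +>\<^bsub>?M\<^esub> \<one>\<^bsub>R\<^esub> \<in> carrier (?X n)" for n
    by (simp add: power_quot_def carrier_quot_module regular_module_simps)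
  \<comment> \<open>Stage \<open>1\<close> is \<open>R / I\<^sup>1\<close>, where \<open>I\<^sup>1\<close> is by definition the product of the unit ideal and \<open>I\<close>.\<close>
  have I1: "I [^]\<^bsub>ideals_set R\<^esub> (1::nat) \<subseteq> I"
    unfolding One_nat_def Ip(3) using R.ideal_prod_inter[OF Ip(1) I] by blast
  have mx: "linear_map R ?M N (\<lambda>a. a \<odot>\<^bsub>N\<^esub> x)"
    by (rule linear_mapI) (use x in \<open>auto simp: regular_module_simps N.smult_l_distr N.smult_assoc1\<close>)
  have ker: "?J 1 \<subseteq> {a \<in> carrier ?M. a \<odot>\<^bsub>N\<^esub> x = \<zero>\<^bsub>N\<^esub>}"
    unfolding ideal_smult_def
  proof (rule submodule_span_minimal[OF kernel_submodule[OF M N mx]], rule subsetI)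
    fix y assume "y \<in> {a \<odot>\<^bsub>?M\<^esub> z | a z. a \<in> I [^]\<^bsub>ideals_set R\<^esub> (1::nat) \<and> z \<in> carrier ?M}"
    then obtain a z where y: "y = a \<otimes>\<^bsub>R\<^esub> z" "a \<in> I" "z \<in> carrier R"
      using I1 by (auto simp: regular_module_simps)
    have a: "a \<in> carrier R" by (rule ideal.Icarr[OF I y(2)])
    have "(a \<otimes>\<^bsub>R\<^esub> z) \<odot>\<^bsub>N\<^esub> x = z \<odot>\<^bsub>N\<^esub> (a \<odot>\<^bsub>N\<^esub> x)"
      using a y x by (simp add: N.smult_assoc1[symmetric] R.m_comm)
    thus "y \<in> {a \<in> carrier ?M. a \<odot>\<^bsub>N\<^esub> x = \<zero>\<^bsub>N\<^esub>}" using y a Ix by (simp add: regular_module_simps)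
  qed
  obtain q where "linear_map R (quot_module ?M (?J 1)) N q"
    and q: "\<And>a. a \<in> carrier ?M \<Longrightarrow> q (?J 1 +>\<^bsub>?M\<^esub> a) = a \<odot>\<^bsub>N\<^esub> x"
    by (rule linear_map_quot_factor[OF M J N mx]) (use ker in auto)
  hence ql: "linear_map R (?X 1) N q" by (simp add: power_quot_def)
  let ?F = "\<lambda>n. std_res R (?X n)"
  have F: "module R (?F n i)" for n i by (rule std_res_module[OF R])
  define c where "c = (\<lambda>f\<in>carrier (?F 1 0). q (std_aug R (?X 1) f))"
  have c: "c \<in> E.cocycles 1 0"
  proof -
    have "linear_map R (?F 1 0) N (\<lambda>f. q (std_aug R (?X 1) f))"
      by (rule linear_map_comp[OF std_aug_linear[OF X] ql])
    hence "c \<in> carrier (Ext_complex R (?X 1) N 0)"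
      unfolding c_def Ext_complex_def hom_module_carrier using iffD2[OF linear_map_restrict[OF F]] by auto
    moreover have "Ext_diff R (?X 1) 0 c = \<zero>\<^bsub>Ext_complex R (?X 1) N (Suc 0)\<^esub>"
    proof -
      have "c (std_bd R (?X 1) 0 f) = \<zero>\<^bsub>N\<^esub>" if "f \<in> carrier (?F 1 (Suc 0))" for f
        using std_bd_cycles[OF X that] linear_map_zero[OF X N ql] by (simp add: c_def std_cycles_eq)
      thus ?thesis by (auto simp: Ext_diff_def Ext_complex_def hom_module_simps compose_def restrict_def)
    qed
    ultimately show ?thesis by (simp add: E.cocycles_def)
  qed
  have cls: "E.coclass 1 0 c \<in> carrier (?A 1)" using c by (simp add: Ext_def E.carrier_cohomology)
  have "D.cls 1 (E.coclass 1 0 c) = \<zero>\<^bsub>direct_limit ?A ?t\<^esub>"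
    using D.cls_carrier[OF cls] triv by (simp add: trivial_module_def)
  then obtain k where k: "transition ?t 1 k (E.coclass 1 0 c) = \<zero>\<^bsub>?A (1 + k)\<^esub>"
    using D.cls_eq_zero_iff[OF cls] by auto
  let ?b = "\<lambda>n. basis_vec R (Gen (?J n +>\<^bsub>?M\<^esub> \<one>\<^bsub>R\<^esub>))"
  have tr: "\<exists>e\<in>E.cocycles (1 + k) 0. transition ?t 1 k (E.coclass 1 0 c) = E.coclass (1 + k) 0 e \<and> e (?b (1 + k)) = x" for k
  proof (induction k)
    case 0
    have "c (?b 1) = x"
      using basis_vec_std_res(1)[OF R one[of 1]] std_aug_basis[OF X one[of 1]] q[of "\<one>\<^bsub>R\<^esub>"] x
      by (simp add: c_def regular_module_simps)
    thus ?case using c by auto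
  next
    case (Suc k)
    then obtain e where e: "e \<in> E.cocycles (1 + k) 0"
      "transition ?t 1 k (E.coclass 1 0 c) = E.coclass (1 + k) 0 e" "e (?b (1 + k)) = x" by auto
    let ?e = "compose (carrier (?F (Suc (1 + k)) 0)) e (std_map R (?X (Suc (1 + k))) (?pr (1 + k)) 0)"
    note m = Ext_map_coclass[OF X X N pl e(1)]
    have "?e (?b (Suc (1 + k))) = x"
      using basis_vec_std_res(1)[OF R one[of "Suc (1 + k)"]] std_map_0_linear(2)[OF X X pl one[of "Suc (1 + k)"]]
        pp[OF R.one_closed] e(3)
      by (simp add: compose_def)
    thus ?case using m e(2) by (intro bexI[of _ ?e]) auto
  qed
  from tr[of k] obtain e where e: "e \<in> E.cocycles (1 + k) 0"
      "E.coclass (1 + k) 0 e = \<zero>\<^bsub>?A (1 + k)\<^esub>" "e (?b (1 + k)) = x"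
    unfolding k by (elim bexE conjE) (rule that, assumption, erule sym, assumption)
  have "e = \<zero>\<^bsub>Ext_complex R (?X (1 + k)) N 0\<^esub>"
    using E.coclass_eq_zero_iff[OF e(1)] e(2) by (simp add: Ext_def coboundaries_def)
  thus ?thesis using e(3) basis_vec_std_res(1)[OF R one[of "1 + k"]]
    by (simp add: Ext_complex_def hom_module_simps)
qed

section \<open>Extensions of a quotient ring by first generalized local cohomology\<close>

theorem theorem2p10:
  fixes R :: "('a, 'r) ring_scheme"
    and I :: "'a set"
    and M :: "('a, 'm) module"
    and N :: "('a, 'n) module"
  assumes "cring R" and "noetherian_ring R"
    and "ideal I R" and "I \<noteq> carrier R"
    and "fin_gen_module R M"
    and "weakly_laskerian R N"
    and "\<forall>i>0. trivial_module (Tor R i (quot_module (regular_module R) I) M)"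
    and "ideal_depth R I N > 0"
  shows "weakly_laskerian R
           (Ext R 1 (quot_module (regular_module R) I) (gen_local_cohomology R I 1 M N)) \<and>
         finite (Ass R
           (Ext R 1 (quot_module (regular_module R) I) (gen_local_cohomology R I 1 M N)))"
proof -
  have modN: "module R N" using assms(6) by (simp add: weakly_laskerian_def)
  obtain S where gens: "module R M" "finite S" "S \<subseteq> carrier M" "submodule_span R M S = carrier M"
    using assms(5) by (auto simp: fin_gen_module_def)
  interpret torsion_free_setting R M S I N
    by (intro torsion_free_setting.intro generated_module.intro torsion_free_setting_axioms.intro
        gens(1,3,4) assms(3) modN)
      (rule depth_pos_torsion_free[OF assms(1,3) modN assms(8)])
  have "weakly_laskerian R (Ext R 1 (quot_module (regular_module R) I) (gen_local_cohomology R I 1 M N))"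
    by (rule weakly_laskerian_Ext_gen_local_cohomology[OF assms(2) gens(2) assms(6)])
  thus ?thesis using weakly_laskerian_finite_Ass by blast
qed

end
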